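(* Let $\mathcal{F}$ be a finite degenerate family of graphs with $\beta'(\mathcal{F})\geq 2$. Suppose $\widetilde{H}$ is a graph on $n+1-\beta'(\mathcal{F})$ vertices with $e(\widetilde{H})\leq rn+O(1)$, where $r\in[0,\frac34)$. For sufficiently large $n$, if $$\{T\vee \widetilde{H}: T\in\mathrm{Ex}(\beta'(\mathcal{F})-1,\mathcal{H}(\mathcal{F}))\}\subseteq \mathrm{Ex}(n,\mathcal{F}),$$ then $\mathrm{Ex_{sp}}(n,\mathcal{F})\subseteq\mathcal{G}(\mathcal{F})\subseteq\mathrm{Ex}(n,\mathcal{F})$.
   Context: All graphs are simple. A graph is $\mathcal{F}$-free if it contains no member of $\mathcal{F}$ as a subgraph. $\operatorname{ex}(n,\mathcal{F})$ is the maximum number of edges of an $\mathcal{F}$-free graph on $n$ vertices and $\mathrm{Ex}(n,\mathcal{F})$ the set of extremal graphs. For a graph $G_0$, $\mathrm{Ex}_{G_0}(n,\mathcal{F})$ is the set of $\mathcal{F}$-free $n$-vertex graphs containing $G_0$ as a subgraph with the maximum number of edges among such graphs. $\mathrm{Ex_{sp}}(n,\mathcal{F})$ is the set of $\mathcal{F}$-free $n$-vertex graphs with maximum adjacency spectral radius among all $\mathcal{F}$-free $n$-vertex graphs. A covering of $G$ is a vertex set meeting all edges; $\beta(G)$ is the minimum size of a covering, $\beta'(G)$ the minimum size of an independent covering ($+\infty$ if $G$ is not bipartite); $\beta(\mathcal{F})$, $\beta'(\mathcal{F})$ are the minima over $F\in\mathcal{F}$. $\mathcal{F}$ is finite degenerate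 if it contains a bipartite graph and the orders of its members are bounded by a fixed constant. $\mathcal{M}(\mathcal{F})=\{F[S]: F\in\mathcal{F},\ S\text{ a covering of }F,\ |S|<\beta'(\mathcal{F})\}$; $\mathcal{H}(\mathcal{F})=\{K_{\beta'(\mathcal{F})}\}$ if $\beta'(\mathcal{F})=\beta(\mathcal{F})$ and $\mathcal{H}(\mathcal{F})=\mathcal{M}(\mathcal{F})$ otherwise. $\vee$ is the join, $I_m$ the edgeless graph on $m$ vertices. $\mathcal{G}_0(\mathcal{F})=\{T\vee I_{n+1-\beta'(\mathcal{F})}: T\in\mathrm{Ex}(\beta'(\mathcal{F})-1,\mathcal{H}(\mathcal{F}))\}$ and $\mathcal{G}(\mathcal{F})=\bigcup_{H'\in\mathcal{G}_0(\mathcal{F})}\mathrm{Ex}_{H'}(n,\mathcal{F})$. *)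

theory Defs
  imports
    "Graph_Theory.Pair_Digraph"
    "Jordan_Normal_Form.Spectral_Radius"
    "HOL-Library.Extended_Nat"
    "HOL-Library.Nat_Bijection"
begin

text \<open>
  A finite simple graph is a symmetric loop-free finite digraph, i.e. a \<open>G\<close> with \<open>pair_graph G\<close>;
  each undirected edge is a pair of opposite arcs. Vertices are natural numbers. The classes of
  \<open>n\<close>-vertex graphs below range over all \<open>n\<close>-element vertex sets, so they are closed under
  isomorphism (within graphs on natural numbers).
\<close>

type_synonym ngraph = "nat pair_pre_digraph"

definition edges :: "ngraph \<Rightarrow> nat set set" where
  "edges G = {{u, v} |u v. (u, v) \<in> parcs G}"

definition num_edges :: "ngraph \<Rightarrow> nat" where
  "num_edges G = card (edges G)"

text \<open>Containment as a not necessarily induced subgraph, up to isomorphism.\<close>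

definition contains :: "ngraph \<Rightarrow> ngraph \<Rightarrow> bool" where
  "contains G H \<longleftrightarrow>
     (\<exists>f. inj_on f (pverts H) \<and> f ` pverts H \<subseteq> pverts G \<and>
          (\<forall>(u, v) \<in> parcs H. (f u, f v) \<in> parcs G))"

definition free_of :: "ngraph set \<Rightarrow> ngraph \<Rightarrow> bool" where
  "free_of \<F> G \<longleftrightarrow> (\<forall>F\<in>\<F>. \<not> contains G F)"

definition free_graphs :: "nat \<Rightarrow> ngraph set \<Rightarrow> ngraph set" where
  "free_graphs n \<F> = {G. pair_graph G \<and> card (pverts G) = n \<and> free_of \<F> G}"

definition extremal :: "nat \<Rightarrow> ngraph set \<Rightarrow> ngraph set" where
  "extremal n \<F> = {G. is_arg_max num_edges (\<lambda>G. G \<in> free_graphs n \<F>) G}"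

definition extremal_containing :: "ngraph \<Rightarrow> nat \<Rightarrow> ngraph set \<Rightarrow> ngraph set" where
  "extremal_containing G\<^sub>0 n \<F> =
     {G. is_arg_max num_edges (\<lambda>G. G \<in> free_graphs n \<F> \<and> contains G G\<^sub>0) G}"

text \<open>The vertices are listed in increasing order; the spectrum does not depend on this choice.\<close>

definition adjacency_matrix :: "ngraph \<Rightarrow> complex mat" where
  "adjacency_matrix G =
     (let vs = sorted_list_of_set (pverts G) in
      mat (length vs) (length vs) (\<lambda>(i, j). if (vs ! i, vs ! j) \<in> parcs G then 1 else 0))"

definition graph_spectral_radius :: "ngraph \<Rightarrow> real" where
  "graph_spectral_radius G = spectral_radius (adjacency_matrix G)"

definition extremal_sp :: "nat \<Rightarrow> ngraph set \<Rightarrow> ngraph set" where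
  "extremal_sp n \<F> = {G. is_arg_max graph_spectral_radius (\<lambda>G. G \<in> free_graphs n \<F>) G}"

definition covering :: "ngraph \<Rightarrow> nat set \<Rightarrow> bool" where
  "covering G S \<longleftrightarrow> S \<subseteq> pverts G \<and> (\<forall>(u, v) \<in> parcs G. u \<in> S \<or> v \<in> S)"

definition independent_set :: "ngraph \<Rightarrow> nat set \<Rightarrow> bool" where
  "independent_set G S \<longleftrightarrow> S \<subseteq> pverts G \<and> (\<forall>(u, v) \<in> parcs G. \<not> (u \<in> S \<and> v \<in> S))"

definition bipartite :: "ngraph \<Rightarrow> bool" where
  "bipartite G \<longleftrightarrow>
     (\<exists>A B. A \<union> B = pverts G \<and> A \<inter> B = {} \<and> parcs G \<subseteq> A \<times> B \<union> B \<times> A)"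

definition \<beta> :: "ngraph \<Rightarrow> enat" where
  "\<beta> G = (INF S \<in> {S. covering G S}. enat (card S))"

text \<open>
  A graph that is not bipartite has no independent covering, and then the infimum over the
  empty set is \<open>\<infinity>\<close>; see \<open>\<beta>'_infinity_iff\<close> below.
\<close>

definition \<beta>' :: "ngraph \<Rightarrow> enat" where
  "\<beta>' G = (INF S \<in> {S. covering G S \<and> independent_set G S}. enat (card S))"

definition \<beta>_fam :: "ngraph set \<Rightarrow> enat" where
  "\<beta>_fam \<F> = (INF F\<in>\<F>. \<beta> F)"

definition \<beta>'_fam :: "ngraph set \<Rightarrow> enat" where
  "\<beta>'_fam \<F> = (INF F\<in>\<F>. \<beta>' F)"

definition finite_degenerate :: "ngraph set \<Rightarrow> bool" where
  "finite_degenerate \<F> \<longleftrightarrow>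
     (\<forall>F\<in>\<F>. pair_graph F) \<and> (\<exists>F\<in>\<F>. bipartite F) \<and> (\<exists>c. \<forall>F\<in>\<F>. card (pverts F) \<le> c)"

definition induced :: "ngraph \<Rightarrow> nat set \<Rightarrow> ngraph" where
  "induced G S = \<lparr>pverts = pverts G \<inter> S, parcs = parcs G \<inter> S \<times> S\<rparr>"

definition complete_graph :: "nat \<Rightarrow> ngraph" where
  "complete_graph k = \<lparr>pverts = {..<k}, parcs = {(u, v). u < k \<and> v < k \<and> u \<noteq> v}\<rparr>"

definition edgeless_graph :: "nat \<Rightarrow> ngraph" where
  "edgeless_graph m = \<lparr>pverts = {..<m}, parcs = {}\<rparr>"

text \<open>The bijection \<open>sum_encode\<close> of \<open>nat + nat\<close> with \<open>nat\<close> makes the two vertex sets disjoint.\<close>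

definition graph_join :: "ngraph \<Rightarrow> ngraph \<Rightarrow> ngraph" (infixl \<open>\<^bold>\<or>\<close> 65) where
  "G \<^bold>\<or> H =
     (let l = (\<lambda>u. sum_encode (Inl u)); r = (\<lambda>v. sum_encode (Inr v)) in
      \<lparr>pverts = l ` pverts G \<union> r ` pverts H,
       parcs = map_prod l l ` parcs G \<union> map_prod r r ` parcs H
         \<union> (l ` pverts G) \<times> (r ` pverts H) \<union> (r ` pverts H) \<times> (l ` pverts G)\<rparr>)"

definition \<M> :: "ngraph set \<Rightarrow> ngraph set" where
  "\<M> \<F> = {induced F S |F S. F \<in> \<F> \<and> covering F S \<and> enat (card S) < \<beta>'_fam \<F>}"

definition \<H> :: "ngraph set \<Rightarrow> ngraph set" where
  "\<H> \<F> = (if \<beta>'_fam \<F> = \<beta>_fam \<F> then {complete_graph (the_enat (\<beta>'_fam \<F>))} else \<M> \<F>)"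

definition \<G>\<^sub>0 :: "nat \<Rightarrow> ngraph set \<Rightarrow> ngraph set" where
  "\<G>\<^sub>0 n \<F> =
     {T \<^bold>\<or> edgeless_graph (n + 1 - the_enat (\<beta>'_fam \<F>)) |T.
        T \<in> extremal (the_enat (\<beta>'_fam \<F>) - 1) (\<H> \<F>)}"

definition \<G> :: "nat \<Rightarrow> ngraph set \<Rightarrow> ngraph set" where
  "\<G> n \<F> = (\<Union>H'\<in>\<G>\<^sub>0 n \<F>. extremal_containing H' n \<F>)"

lemma \<beta>'_infinity_iff:
  assumes "pair_graph G"
  shows "\<beta>' G = \<infinity> \<longleftrightarrow> \<not> bipartite G"
proof -
  interpret pair_graph G by fact
  have "bipartite G \<longleftrightarrow> (\<exists>S. covering G S \<and> independent_set G S)"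
  proof
    assume "bipartite G"
    then obtain A B where "A \<union> B = pverts G" "A \<inter> B = {}" "parcs G \<subseteq> A \<times> B \<union> B \<times> A"
      by (auto simp: bipartite_def)
    then have "covering G A \<and> independent_set G A"
      by (fastforce simp: covering_def independent_set_def)
    then show "\<exists>S. covering G S \<and> independent_set G S" ..
  next
    assume "\<exists>S. covering G S \<and> independent_set G S"
    then obtain S where S: "covering G S" "independent_set G S" by auto
    have "parcs G \<subseteq> S \<times> (pverts G - S) \<union> (pverts G - S) \<times> S"
    proof (rule subrelI)
      fix u v assume uv: "(u, v) \<in> parcs G"
      then have "u \<in> pverts G" "v \<in> pverts G"
        by (auto dest: in_arcsD1 in_arcsD2)
      with S uv show "(u, v) \<in> S \<times> (pverts G - S) \<union> (pverts G - S) \<times> S"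
        by (fastforce simp: covering_def independent_set_def)
    qed
    moreover have "S \<union> (pverts G - S) = pverts G" "S \<inter> (pverts G - S) = {}"
      using S by (auto simp: covering_def)
    ultimately show "bipartite G" unfolding bipartite_def by blast
  qed
  moreover have "\<beta>' G = \<infinity> \<longleftrightarrow> \<not> (\<exists>S. covering G S \<and> independent_set G S)"
    unfolding \<beta>'_def top_enat_def[symmetric] Inf_top_conv by (auto simp: top_enat_def)
  ultimately show ?thesis by blast
qed

end

theory Submission
  imports Defs
begin

text \<open>
  Write \<open>\<beta>' = s + 1\<close>. A spectral extremal graph \<open>G\<close> has spectral radius \<open>\<rho> \<ge> \<surd>(s (n - s))\<close>.
  The hypothesis makes the Turan number linear with a bounded constant, so the family contains a
  forest and all subgraphs of \<open>G\<close> are sparse. Counting walks of length two then isolates a set \<open>L\<close>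
  of \<open>s\<close> vertices with eigenvector entries close to one, and rewiring an exceptional vertex to \<open>L\<close>
  shows that \<open>L\<close> is joined to all other vertices: \<open>G = T \<or> R\<close>, where \<open>R\<close> has bounded degree.

  Comparing \<open>\<rho>\<close> with the spectral radius of \<open>T\<^sub>0 \<or> H\<close> at order \<open>\<rho>\<close> shows that \<open>T\<close> is extremal.
  It remains to exclude \<open>e(R) < e(H)\<close>. Since \<open>r < 3/4\<close>, neither \<open>R\<close> nor \<open>H\<close> has many disjoint copies
  of a triangle or of a tree on four vertices, for otherwise disjoint copies of it alone would give
  too many edges. So up to boundedly many vertices their components are single vertices, edges, or
  paths on three vertices, and such paths are numerous only if \<open>H\<close> consists almost entirely of them.
  On these components \<open>(\<rho> - A) z = 1\<close> is solved explicitly; the sum of \<open>z\<close>, which governs the spectral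
  radius of the join, is then determined by the number of edges up to \<open>O(\<rho>\<^sup>-\<^sup>3)\<close>, whereas one edge
  contributes about \<open>2 \<rho>\<^sup>-\<^sup>2\<close>.
\<close>

section \<open>Finite simple graphs\<close>


text \<open>After the first spectral lemma only the inequality \<rho> x \<le> A x for a nonzero x
  \<ge> 0 is used: the absolute values of an eigenvector of largest modulus satisfy it, and every
  later comparison is one-sided. Strict lower bounds for competitors come from Rayleigh quotients.

  The delicate point is precision. The sum of (\<rho> - A)^-1 1 over R expands as |R|/\<rho> + 2
  e(R)/\<rho>^2 + (sum of squared degrees)/\<rho>^3 + ... Since n has order \<rho>^2, the third term
  may have order 1/\<rho>, far above the value 2/\<rho>^2 of one edge. So R and H must be known up
  to O(1) vertices. On a component K1, K2 or P3 the sum is exactly order/\<rho> + \<theta> * size,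
  with \<theta> = 2/(\<rho>(\<rho> - 1)) for K2 and \<theta> = (2\<rho> + 3)/(\<rho>(\<rho>^2 - 2))
  for P3. These rates differ. Hence two cases: either neither graph has many P3, or H is almost
  entirely P3, and then the larger rate still bounds R from above.

  The bound 3/4 is the edge density of disjoint four-vertex trees; disjoint triangles and disjoint
  P3 have densities 1 and 2/3.\<close>

definition nb :: "ngraph \<Rightarrow> nat \<Rightarrow> nat set" where
  "nb G v = {w. (v, w) \<in> parcs G}"

lemma pair_graphI:
  assumes "finite (pverts G)" and "parcs G \<subseteq> pverts G \<times> pverts G"
    and "\<And>u v. (u, v) \<in> parcs G \<Longrightarrow> (v, u) \<in> parcs G" and "\<And>u. (u, u) \<notin> parcs G"
  shows "pair_graph G"
proof -
  have "finite (parcs G)" using assms(1,2) by (meson finite_SigmaI finite_subset)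
  moreover have "symmetric (with_proj G)"
    using assms(3) unfolding symmetric_def by (auto intro: symI)
  ultimately show ?thesis using assms by unfold_locales auto
qed

lemma pair_graphD:
  assumes "pair_graph G"
  shows "finite (pverts G)" and "finite (parcs G)" and "(u, v) \<in> parcs G \<Longrightarrow> (v, u) \<in> parcs G"
    and "(u, u) \<notin> parcs G" and "(u, v) \<in> parcs G \<Longrightarrow> u \<in> pverts G"
    and "(u, v) \<in> parcs G \<Longrightarrow> v \<in> pverts G"
proof -
  interpret pair_graph G by fact
  show "finite (pverts G)" "finite (parcs G)" by simp_all
  show "(u, u) \<notin> parcs G" using no_loops[of "(u, u)"] by auto
  show "(u, v) \<in> parcs G \<Longrightarrow> (v, u) \<in> parcs G" by (metis arcs_symmetric)
  show "(u, v) \<in> parcs G \<Longrightarrow> u \<in> pverts G" "(u, v) \<in> parcs G \<Longrightarrow> v \<in> pverts G"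
    by (auto dest: in_arcsD1 in_arcsD2)
qed

lemma nb_graph:
  assumes "pair_graph G"
  shows "finite (nb G v)" and "nb G v \<subseteq> pverts G" and "v \<notin> nb G v"
    and "w \<in> nb G v \<longleftrightarrow> v \<in> nb G w" and "v \<notin> pverts G \<Longrightarrow> nb G v = {}"
proof -
  show s: "nb G v \<subseteq> pverts G" using pair_graphD(6)[OF assms] by (auto simp: nb_def)
  then show "finite (nb G v)" using pair_graphD(1)[OF assms] by (rule finite_subset)
  show "v \<notin> nb G v" using pair_graphD(4)[OF assms] by (auto simp: nb_def)
  show "w \<in> nb G v \<longleftrightarrow> v \<in> nb G w" using pair_graphD(3)[OF assms] by (auto simp: nb_def)
  show "v \<notin> pverts G \<Longrightarrow> nb G v = {}" using pair_graphD(5)[OF assms] by (auto simp: nb_def)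
qed

lemma parcs_eq_Sigma: "pair_graph G \<Longrightarrow> parcs G = Sigma (pverts G) (nb G)"
  using pair_graphD(5) by (fastforce simp: nb_def)

lemma card_parcs:
  assumes "pair_graph G"
  shows "card (parcs G) = 2 * num_edges G"
proof -
  let ?f = "\<lambda>(u, v). {u, v}"
  have e: "edges G = ?f ` parcs G" by (force simp: edges_def image_def)
  have fin: "finite (parcs G)" by (rule pair_graphD[OF assms])
  have two: "card {a \<in> parcs G. ?f a = b} = 2" if b: "b \<in> edges G" for b
  proof -
    obtain u v where uv: "b = {u, v}" "(u, v) \<in> parcs G" using b by (auto simp: edges_def)
    then have "u \<noteq> v" "(v, u) \<in> parcs G" using pair_graphD(3,4)[OF assms] by auto
    then have "{a \<in> parcs G. ?f a = b} = {(u, v), (v, u)}"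
      using uv by (auto simp: doubleton_eq_iff)
    then show ?thesis using \<open>u \<noteq> v\<close> by simp
  qed
  have "card (parcs G) = (\<Sum>b\<in>edges G. card {a \<in> parcs G. ?f a = b})"
    unfolding e using sum.image_gen[OF fin, of "\<lambda>_. 1::nat" ?f] by simp
  then show ?thesis using two by (simp add: num_edges_def)
qed

lemma sum_degrees:
  assumes "pair_graph G"
  shows "(\<Sum>v\<in>pverts G. card (nb G v)) = 2 * num_edges G"
proof -
  have "card (Sigma (pverts G) (nb G)) = (\<Sum>v\<in>pverts G. card (nb G v))"
    by (rule card_SigmaI) (use nb_graph(1)[OF assms] pair_graphD(1)[OF assms] in auto)
  then show ?thesis using card_parcs[OF assms] parcs_eq_Sigma[OF assms] by simp
qed

text \<open>Self-adjointness of the adjacency operator, in the only form needed: the sum over all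
  arcs is invariant under reversal.\<close>

lemma sum_sum_nb_swap:
  assumes "pair_graph G"
  shows "(\<Sum>v\<in>pverts G. \<Sum>w\<in>nb G v. f v w) = (\<Sum>w\<in>pverts G. \<Sum>v\<in>nb G w. f v w)"
proof -
  let ?V = "pverts G"
  have fV: "finite ?V" by (rule pair_graphD[OF assms])
  have r: "(\<Sum>w\<in>nb G v. g w) = (\<Sum>w\<in>?V. if w \<in> nb G v then g w else 0)" for v g
    using sum.inter_restrict[OF fV, of g "nb G v"] nb_graph(2)[OF assms, of v]
    by (simp add: Int_absorb1)
  have "(\<Sum>v\<in>?V. \<Sum>w\<in>nb G v. f v w) = (\<Sum>v\<in>?V. \<Sum>w\<in>?V. if w \<in> nb G v then f v w else 0)"
    by (simp add: r)
  also have "\<dots> = (\<Sum>w\<in>?V. \<Sum>v\<in>?V. if w \<in> nb G v then f v w else 0)" by (rule sum.swap)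
  also have "\<dots> = (\<Sum>w\<in>?V. \<Sum>v\<in>?V. if v \<in> nb G w then f v w else 0)"
    using nb_graph(4)[OF assms] by simp
  also have "\<dots> = (\<Sum>w\<in>?V. \<Sum>v\<in>nb G w. f v w)"
    by (simp add: r)
  finally show ?thesis .
qed

lemma containsI:
  assumes "inj_on f (pverts H)" and "\<And>v. v \<in> pverts H \<Longrightarrow> f v \<in> pverts G"
    and "\<And>u v. (u, v) \<in> parcs H \<Longrightarrow> (f u, f v) \<in> parcs G"
  shows "contains G H"
  using assms unfolding contains_def by (intro exI[of _ f]) auto

lemma contains_trans:
  assumes "contains G H" and "contains H K" and "pair_graph K"
  shows "contains G K"
proof -
  obtain f where f: "inj_on f (pverts H)" "f ` pverts H \<subseteq> pverts G"
    "\<And>u v. (u, v) \<in> parcs H \<Longrightarrow> (f u, f v) \<in> parcs G"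
    using assms(1) unfolding contains_def by fast
  obtain g where g: "inj_on g (pverts K)" "g ` pverts K \<subseteq> pverts H"
    "\<And>u v. (u, v) \<in> parcs K \<Longrightarrow> (g u, g v) \<in> parcs H"
    using assms(2) unfolding contains_def by fast
  show ?thesis
  proof (rule containsI[where f = "f \<circ> g"])
    show "inj_on (f \<circ> g) (pverts K)"
      using f(1) g(1,2) by (meson comp_inj_on inj_on_subset)
    show "(f \<circ> g) v \<in> pverts G" if "v \<in> pverts K" for v
      using that f(2) g(2) by auto
  qed (use f g in auto)
qed

lemma nb_induced: "nb (induced G S) v = (if v \<in> S then nb G v \<inter> S else {})"
  by (auto simp: nb_def induced_def)

lemma pair_graph_induced: "pair_graph G \<Longrightarrow> pair_graph (induced G S)"
  by (rule pair_graphI) (auto simp: induced_def dest: pair_graphD)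

section \<open>Neighbourhoods, orders and sizes of joins\<close>

abbreviation inl :: "nat \<Rightarrow> nat" where "inl u \<equiv> sum_encode (Inl u)"
abbreviation inr :: "nat \<Rightarrow> nat" where "inr u \<equiv> sum_encode (Inr u)"

lemma inj_inl: "inj_on inl A" and inj_inr: "inj_on inr A"
  by (auto simp: inj_on_def sum_encode_eq)

lemma graph_join_eq:
  "G \<^bold>\<or> H = \<lparr>pverts = inl ` pverts G \<union> inr ` pverts H,
     parcs = map_prod inl inl ` parcs G \<union> map_prod inr inr ` parcs H
       \<union> (inl ` pverts G) \<times> (inr ` pverts H) \<union> (inr ` pverts H) \<times> (inl ` pverts G)\<rparr>"
  unfolding graph_join_def Let_def by (rule refl)

lemma pverts_join: "pverts (G \<^bold>\<or> H) = inl ` pverts G \<union> inr ` pverts H"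
  by (simp add: graph_join_eq)

lemma parcs_join:
  "(inl u, inl v) \<in> parcs (G \<^bold>\<or> H) \<longleftrightarrow> (u, v) \<in> parcs G"
  "(inr u, inr v) \<in> parcs (G \<^bold>\<or> H) \<longleftrightarrow> (u, v) \<in> parcs H"
  "(inl u, inr v) \<in> parcs (G \<^bold>\<or> H) \<longleftrightarrow> u \<in> pverts G \<and> v \<in> pverts H"
  "(inr u, inl v) \<in> parcs (G \<^bold>\<or> H) \<longleftrightarrow> u \<in> pverts H \<and> v \<in> pverts G"
  by (auto simp: graph_join_eq sum_encode_eq)

lemma nb_join:
  "u \<in> pverts G \<Longrightarrow> nb (G \<^bold>\<or> H) (inl u) = inl ` nb G u \<union> inr ` pverts H"
  "v \<in> pverts H \<Longrightarrow> nb (G \<^bold>\<or> H) (inr v) = inl ` pverts G \<union> inr ` nb H v"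
  by (auto simp: nb_def graph_join_eq sum_encode_eq)

lemma pair_graph_join:
  assumes "pair_graph G" and "pair_graph H"
  shows "pair_graph (G \<^bold>\<or> H)"
  using assms
  by (intro pair_graphI) (auto simp: graph_join_eq sum_encode_eq dest: pair_graphD)

lemma card_pverts_join:
  assumes "pair_graph G" and "pair_graph H"
  shows "card (pverts (G \<^bold>\<or> H)) = card (pverts G) + card (pverts H)"
  using pair_graphD(1)[OF assms(1)] pair_graphD(1)[OF assms(2)] unfolding pverts_join
  by (subst card_Un_disjoint) (auto simp: card_image inj_inl inj_inr sum_encode_eq)

lemma sum_join:
  assumes "finite A" and "finite B"
  shows "(\<Sum>v\<in>inl ` A \<union> inr ` B. f v) = (\<Sum>u\<in>A. f (inl u)) + (\<Sum>v\<in>B. f (inr v))"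
  using assms by (subst sum.union_disjoint) (auto simp: sum.reindex inj_inl inj_inr sum_encode_eq)

lemma card_join:
  assumes "finite A" and "finite B"
  shows "card (inl ` A \<union> inr ` B) = card A + card B"
  using sum_join[OF assms, of "\<lambda>_. 1::nat"] by simp

lemma num_edges_join:
  assumes "pair_graph G" and "pair_graph H"
  shows "num_edges (G \<^bold>\<or> H) = num_edges G + num_edges H + card (pverts G) * card (pverts H)"
proof -
  note fin = pair_graphD(1)[OF assms(1)] pair_graphD(1)[OF assms(2)]
    nb_graph(1)[OF assms(1)] nb_graph(1)[OF assms(2)]
  have "2 * num_edges (G \<^bold>\<or> H) = (\<Sum>v\<in>pverts (G \<^bold>\<or> H). card (nb (G \<^bold>\<or> H) v))"
    using sum_degrees[OF pair_graph_join[OF assms]] by simp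
  also have "\<dots> = (\<Sum>u\<in>pverts G. card (nb G u) + card (pverts H))
      + (\<Sum>v\<in>pverts H. card (pverts G) + card (nb H v))"
    unfolding pverts_join sum_join[OF fin(1,2)]
    by (intro arg_cong2[where f = "(+)"] sum.cong) (simp_all add: nb_join card_join fin)
  also have "\<dots> = 2 * (num_edges G + num_edges H + card (pverts G) * card (pverts H))"
    using sum_degrees[OF assms(1)] sum_degrees[OF assms(2)] by (simp add: sum.distrib)
  finally show ?thesis by simp
qed

section \<open>Spectral radius and Rayleigh quotients\<close>


lemma adjacency_matrix_carrier:
  "adjacency_matrix G \<in> carrier_mat (card (pverts G)) (card (pverts G))"
  unfolding adjacency_matrix_def Let_def by (rule carrier_matI) simp_all

text \<open>The bridge from coordinates to vertices: from here on the matrix acts on functions on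
  the vertex set, and the order in which the vertices are listed disappears.\<close>

lemma adjacency_matrix_mult_vec:
  assumes G: "pair_graph G" and v: "v \<in> carrier_vec (card (pverts G))"
    and i: "i < card (pverts G)"
    and f: "\<And>j. j < card (pverts G) \<Longrightarrow> f (sorted_list_of_set (pverts G) ! j) = v $ j"
  shows "(adjacency_matrix G *\<^sub>v v) $ i = (\<Sum>w\<in>nb G (sorted_list_of_set (pverts G) ! i). f w)"
proof -
  let ?vs = "sorted_list_of_set (pverts G)" and ?V = "pverts G"
  let ?m = "card ?V"
  have fV: "finite ?V" by (rule pair_graphD[OF G])
  have len: "length ?vs = ?m" and set: "set ?vs = ?V" using fV by simp_all
  have bij: "bij_betw ((!) ?vs) {..<?m} ?V"
    by (rule bij_betw_nth) (simp_all add: len set)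
  have "(adjacency_matrix G *\<^sub>v v) $ i
      = (\<Sum>j = 0..<?m. (if (?vs ! i, ?vs ! j) \<in> parcs G then 1 else 0) * v $ j)"
    using i v len by (auto simp: adjacency_matrix_def Let_def scalar_prod_def intro!: sum.cong)
  also have "\<dots> = (\<Sum>j<?m. if ?vs ! j \<in> nb G (?vs ! i) then f (?vs ! j) else 0)"
    by (rule sum.cong) (auto simp: f nb_def)
  also have "\<dots> = (\<Sum>w\<in>?V. if w \<in> nb G (?vs ! i) then f w else 0)"
    using sum.reindex_bij_betw[OF bij, of "\<lambda>w. if w \<in> nb G (?vs ! i) then f w else 0"] by simp
  also have "\<dots> = (\<Sum>w\<in>nb G (?vs ! i). f w)"
    using sum.inter_restrict[OF fV, of f "nb G (?vs ! i)"] nb_graph(2)[OF G, of "?vs ! i"]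
    by (simp add: Int_absorb1)
  finally show ?thesis .
qed

text \<open>Take the absolute values of an eigenvector whose eigenvalue has largest modulus; the
  triangle inequality turns A v = k v into the stated inequality.\<close>

lemma ex_subeigenvector:
  assumes G: "pair_graph G" and ne: "pverts G \<noteq> {}"
  shows "\<exists>x. (\<forall>v. 0 \<le> x v) \<and> (\<exists>v\<in>pverts G. x v \<noteq> 0)
    \<and> (\<forall>v\<in>pverts G. graph_spectral_radius G * x v \<le> (\<Sum>w\<in>nb G v. x w))"
proof -
  let ?vs = "sorted_list_of_set (pverts G)" and ?V = "pverts G" and ?A = "adjacency_matrix G"
  let ?m = "card ?V"
  have fV: "finite ?V" by (rule pair_graphD[OF G])
  have len: "length ?vs = ?m" and set: "set ?vs = ?V" using fV by simp_all
  have bij: "bij_betw ((!) ?vs) {..<?m} ?V"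
    by (rule bij_betw_nth) (simp_all add: len set)
  have m: "?m > 0" using fV ne by (simp add: card_gt_0_iff)
  note A = adjacency_matrix_carrier[of G]
  obtain k where k: "eigenvalue ?A k" "norm k = graph_spectral_radius G"
    using spectral_radius_mem_max(1)[OF A m] unfolding graph_spectral_radius_def spectrum_def by auto
  obtain v where v: "v \<in> carrier_vec ?m" "v \<noteq> 0\<^sub>v ?m" "?A *\<^sub>v v = k \<cdot>\<^sub>v v"
    using k(1) A unfolding eigenvalue_def eigenvector_def by auto
  define p where "p = the_inv_into {..<?m} ((!) ?vs)"
  define f where "f = (\<lambda>u. v $ p u)"
  have p: "p (?vs ! j) = j" if "j < ?m" for j
    using that bij unfolding p_def by (intro the_inv_into_f_f) (auto simp: bij_betw_def)
  then have f: "f (?vs ! j) = v $ j" if "j < ?m" for j using that by (simp add: f_def)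
  have ix: "\<exists>i<?m. u = ?vs ! i" if "u \<in> ?V" for u
    using that bij by (auto simp: bij_betw_def)
  have "graph_spectral_radius G * norm (f u) \<le> (\<Sum>w\<in>nb G u. norm (f w))" if u: "u \<in> ?V" for u
  proof -
    obtain i where i: "i < ?m" "u = ?vs ! i" using ix[OF u] by auto
    have "k * f u = (\<Sum>w\<in>nb G u. f w)"
      using adjacency_matrix_mult_vec[OF G v(1) i(1), of f] f v(1,3) i by simp
    then have "norm k * norm (f u) = norm (\<Sum>w\<in>nb G u. f w)"
      by (metis norm_mult)
    then show ?thesis using norm_sum[of f "nb G u"] k(2) by simp
  qed
  moreover have "\<exists>u\<in>?V. norm (f u) \<noteq> 0"
  proof (rule ccontr)
    assume z: "\<not> ?thesis"
    have "v $ i = 0" if "i < ?m" for i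
    proof -
      have "?vs ! i \<in> ?V" using that bij by (auto simp: bij_betw_def)
      then show ?thesis using z f[OF that] by simp
    qed
    then show False using v(1,2) by (auto simp: vec_eq_iff)
  qed
  ultimately show ?thesis by (intro exI[of _ "\<lambda>u. norm (f u)"]) auto
qed

text \<open>By contradiction, for t strictly between the spectral radius and \<mu>. The powers of
  A/t stay bounded, since its spectral radius is below 1. But the moments \<open>a k\<close> = <y,
  (A/t)^k y> satisfy N a(2k) \<ge> a(k)^2 with N = <y, y>, so that a(2^k) \<ge> N (\<mu>/t)^(2^k),
  which is unbounded.\<close>

lemma spectral_radius_ge_Rayleigh:
  assumes G: "pair_graph G" and y: "(\<Sum>v\<in>pverts G. (y v)\<^sup>2) > 0"
    and ray: "\<mu> * (\<Sum>v\<in>pverts G. (y v)\<^sup>2) \<le> (\<Sum>v\<in>pverts G. y v * (\<Sum>w\<in>nb G v. y w))"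
  shows "\<mu> \<le> graph_spectral_radius G"
proof (rule ccontr)
  let ?vs = "sorted_list_of_set (pverts G)" and ?V = "pverts G" and ?A = "adjacency_matrix G"
  let ?m = "card ?V" and ?\<rho> = "graph_spectral_radius G"
  assume "\<not> \<mu> \<le> ?\<rho>"
  then have mu: "?\<rho> < \<mu>" by simp
  have fV: "finite ?V" by (rule pair_graphD[OF G])
  have len: "length ?vs = ?m" and set: "set ?vs = ?V" using fV by simp_all
  have bij: "bij_betw ((!) ?vs) {..<?m} ?V"
    by (rule bij_betw_nth) (simp_all add: len set)
  have "?V \<noteq> {}" using y by auto
  then have m: "?m > 0" using fV by (simp add: card_gt_0_iff)
  note A = adjacency_matrix_carrier[of G]
  have rho0: "0 \<le> ?\<rho>"
    using spectral_radius_mem_max(1)[OF A m] unfolding graph_spectral_radius_def by auto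
  define t where "t = (?\<rho> + \<mu>) / 2"
  have t: "?\<rho> < t" "t < \<mu>" "0 < t" using mu rho0 by (auto simp: t_def)
  define B where "B = complex_of_real (1 / t) \<cdot>\<^sub>m ?A"
  have B: "B \<in> carrier_mat ?m ?m" using A by (simp add: B_def)
  have "spectral_radius B < 1"
  proof -
    obtain k v where k: "norm k = spectral_radius B" "eigenvector B v k"
      using spectral_radius_mem_max(1)[OF B m] by (auto simp: spectrum_def eigenvalue_def)
    then have v: "v \<in> carrier_vec ?m" "v \<noteq> 0\<^sub>v ?m" "B *\<^sub>v v = k \<cdot>\<^sub>v v"
      using B by (auto simp: eigenvector_def)
    have "?A *\<^sub>v v = complex_of_real t \<cdot>\<^sub>v (B *\<^sub>v v)"
      using A v(1) t(3) by (intro eq_vecI) (auto simp: B_def scalar_prod_def sum_distrib_left)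
    then have "eigenvector ?A v (complex_of_real t * k)"
      using A v by (auto simp: eigenvector_def smult_smult_assoc)
    then have "norm (complex_of_real t * k) \<le> ?\<rho>"
      unfolding graph_spectral_radius_def
      by (intro spectral_radius_mem_max(2)[OF A m]) (auto simp: spectrum_def eigenvalue_def image_def)
    then have "t * norm k \<le> ?\<rho>" using t by (simp add: norm_mult)
    then have "t * norm k < t * 1" using t by linarith
    then have "norm k < 1" using t(3) by (metis mult_less_cancel_left_pos)
    then show ?thesis using k(1) by simp
  qed
  then obtain c where c: "\<And>k. norm_bound (B ^\<^sub>m k) c"
    using spectral_radius_jnf_norm_bound_less_1_upper_triangular[OF B] by blast
  \<comment> \<open>\<open>T\<close> is the action of \<open>B\<close> on real functions on the
    vertices, and \<open>vf\<close> translates such functions into vectors.\<close>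
  define T where "T = (\<lambda>f v. (\<Sum>w\<in>nb G v. f w) / t)"
  define vf where "vf = (\<lambda>f :: nat \<Rightarrow> real. vec ?m (\<lambda>i. complex_of_real (f (?vs ! i))))"
  have Bvf: "B *\<^sub>v vf f = vf (T f)" for f
  proof (rule eq_vecI)
    fix i assume "i < dim_vec (vf (T f))"
    then have i: "i < ?m" by (simp add: vf_def)
    have "(?A *\<^sub>v vf f) $ i = (\<Sum>w\<in>nb G (?vs ! i). complex_of_real (f w))"
      by (rule adjacency_matrix_mult_vec[OF G _ i]) (auto simp: vf_def)
    moreover have "(B *\<^sub>v vf f) $ i = complex_of_real (1 / t) * (?A *\<^sub>v vf f) $ i"
      using A i unfolding B_def by (auto simp: scalar_prod_def vf_def sum_distrib_left mult.assoc)
    ultimately show "(B *\<^sub>v vf f) $ i = vf (T f) $ i"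
      using i by (simp add: vf_def T_def)
  qed (use B in \<open>simp add: vf_def\<close>)
  have pow: "(B ^\<^sub>m k) *\<^sub>v vf f = vf ((T ^^ k) f)" for k f
  proof (induction k arbitrary: f)
    case 0
    show ?case using B by (simp add: vf_def)
  next
    case (Suc k)
    have "(B ^\<^sub>m Suc k) *\<^sub>v vf f = (B ^\<^sub>m k) *\<^sub>v (B *\<^sub>v vf f)"
      unfolding pow_mat.simps
      by (rule assoc_mult_mat_vec[of _ ?m ?m _ ?m]) (use B in \<open>auto simp: vf_def\<close>)
    then show ?case by (simp add: Bvf Suc funpow_swap1)
  qed
  define ip where "ip = (\<lambda>f g :: nat \<Rightarrow> real. \<Sum>v\<in>?V. f v * g v)"
  have ip_T: "ip (T f) g = ip f (T g)" for f g
  proof -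
    have "ip (T f) g = (\<Sum>v\<in>?V. \<Sum>w\<in>nb G v. f w * g v) / t"
      by (simp add: ip_def T_def sum_distrib_right sum_divide_distrib)
    also have "\<dots> = (\<Sum>w\<in>?V. \<Sum>v\<in>nb G w. f w * g v) / t"
      using sum_sum_nb_swap[OF G, of "\<lambda>v w. f w * g v"] by simp
    also have "\<dots> = ip f (T g)"
      by (simp add: ip_def T_def sum_distrib_left sum_divide_distrib)
    finally show ?thesis .
  qed
  define a where "a k = ip y ((T ^^ k) y)" for k
  have ip_pow: "ip ((T ^^ k) f) g = ip f ((T ^^ k) g)" for k f g
    by (induction k arbitrary: f g) (simp_all add: ip_T funpow_swap1)
  define N where "N = ip y y"
  have N: "N > 0" using y by (simp add: N_def ip_def power2_eq_square)
  \<comment> \<open>Cauchy-Schwarz for y and \<open>T\<close>^k y, whose squared length is a(2k)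
    because \<open>T\<close> is self-adjoint; it is read off from the expanded square of N
    \<open>T\<close>^k y - a(k) y.\<close>
  have dbl: "N * a (2 * k) \<ge> (a k)\<^sup>2" for k
  proof -
    let ?g = "(T ^^ k) y"
    have g2: "a (2 * k) = ip ?g ?g"
      by (simp add: a_def ip_pow mult_2 funpow_add)
    have "0 \<le> (\<Sum>v\<in>?V. (N * ?g v - a k * y v)\<^sup>2)" by (rule sum_nonneg) simp
    also have "\<dots> = (\<Sum>v\<in>?V. N\<^sup>2 * (?g v * ?g v) - 2 * N * a k * (y v * ?g v) + (a k)\<^sup>2 * (y v * y v))"
      by (rule sum.cong) (auto simp: power2_eq_square algebra_simps)
    also have "\<dots> = N\<^sup>2 * ip ?g ?g - 2 * N * a k * ip y ?g + (a k)\<^sup>2 * ip y y"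
      by (simp add: ip_def sum.distrib sum_subtractf sum_distrib_left)
    also have "\<dots> = N * (N * a (2 * k) - (a k)\<^sup>2)"
      by (simp only: g2[symmetric] a_def[symmetric] N_def[symmetric])
        (simp add: power2_eq_square algebra_simps)
    finally show ?thesis using N by (simp add: zero_le_mult_iff)
  qed
  have a1: "a 1 \<ge> N * (\<mu> / t)"
  proof -
    have "a 1 = (\<Sum>v\<in>?V. y v * (\<Sum>w\<in>nb G v. y w)) / t"
      unfolding sum_divide_distrib[of _ ?V] by (simp add: a_def ip_def T_def)
    moreover have "N = (\<Sum>v\<in>?V. (y v)\<^sup>2)" by (simp add: N_def ip_def power2_eq_square)
    ultimately show ?thesis using ray t(3) by (simp add: divide_simps mult.commute)
  qed
  have apow: "a (2 ^ k) \<ge> N * (\<mu> / t) ^ (2 ^ k)" for k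
  proof (induction k)
    case 0
    show ?case using a1 by simp
  next
    case (Suc k)
    have "(N * (\<mu> / t) ^ (2 ^ k))\<^sup>2 \<le> (a (2 ^ k))\<^sup>2"
      by (rule power_mono[OF Suc]) (use N t in auto)
    also have "\<dots> \<le> N * a (2 * 2 ^ k)" by (rule dbl)
    finally have "N * (N * (\<mu> / t) ^ (2 ^ Suc k)) \<le> N * a (2 ^ Suc k)"
      by (simp add: power_mult_distrib power2_eq_square power_add mult_2 algebra_simps)
    then show ?case using N by simp
  qed
  define S where "S = (\<Sum>v\<in>?V. \<bar>y v\<bar>)"
  have bnd: "a k \<le> c * S * S" for k
  proof -
    have "\<bar>(T ^^ k) y v\<bar> \<le> c * S" if v: "v \<in> ?V" for v
    proof -
      obtain i where i: "i < ?m" "v = ?vs ! i" using v bij by (auto simp: bij_betw_def)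
      have "complex_of_real ((T ^^ k) y v) = ((B ^\<^sub>m k) *\<^sub>v vf y) $ i"
        using i by (simp add: pow) (simp add: vf_def)
      also have "\<dots> = (\<Sum>j<?m. (B ^\<^sub>m k) $$ (i, j) * complex_of_real (y (?vs ! j)))"
        using B i by (auto simp: scalar_prod_def vf_def atLeast0LessThan intro!: sum.cong)
      finally have "\<bar>(T ^^ k) y v\<bar> = norm (\<Sum>j<?m. (B ^\<^sub>m k) $$ (i, j) * complex_of_real (y (?vs ! j)))"
        by (metis norm_of_real)
      also have "\<dots> \<le> (\<Sum>j<?m. c * \<bar>y (?vs ! j)\<bar>)"
        using c[of k] B i(1) unfolding norm_bound_def
        by (intro sum_norm_le) (auto simp: norm_mult intro!: mult_right_mono)
      also have "\<dots> = c * S"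
        using sum.reindex_bij_betw[OF bij, of "\<lambda>v. \<bar>y v\<bar>"] by (simp add: S_def sum_distrib_left[symmetric])
      finally show ?thesis .
    qed
    note Tb = this
    have "y v * (T ^^ k) y v \<le> \<bar>y v\<bar> * (c * S)" if "v \<in> ?V" for v
    proof -
      have "y v * (T ^^ k) y v \<le> \<bar>y v\<bar> * \<bar>(T ^^ k) y v\<bar>"
        using abs_ge_self[of "y v * (T ^^ k) y v"] by (simp add: abs_mult)
      also have "\<dots> \<le> \<bar>y v\<bar> * (c * S)" using Tb[OF that] by (rule mult_left_mono) simp
      finally show ?thesis .
    qed
    then have "a k \<le> (\<Sum>v\<in>?V. \<bar>y v\<bar> * (c * S))"
      unfolding a_def ip_def by (rule sum_mono)
    then show ?thesis by (simp add: S_def sum_distrib_right[symmetric] mult.commute)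
  qed
  have "1 < \<mu> / t" using t by simp
  then obtain n where n: "c * S * S / N < (\<mu> / t) ^ n" using real_arch_pow by blast
  have "(\<mu> / t) ^ n \<le> (\<mu> / t) ^ (2 ^ n)"
    using t by (intro power_increasing) (auto simp: less_imp_le)
  then have "c * S * S / N < (\<mu> / t) ^ (2 ^ n)" using n by linarith
  then have "c * S * S < N * (\<mu> / t) ^ (2 ^ n)" using N by (simp only: pos_divide_less_eq mult.commute)
  then show False using apow[of n] bnd[of "2 ^ n"] by linarith
qed

text \<open>The Rayleigh quotient of y itself lies strictly above \<mu> and is bounded by the
  previous lemma.\<close>

lemma spectral_radius_gt_Rayleigh:
  assumes G: "pair_graph G" and y: "(\<Sum>v\<in>pverts G. (y v)\<^sup>2) > 0"
    and ray: "\<mu> * (\<Sum>v\<in>pverts G. (y v)\<^sup>2) < (\<Sum>v\<in>pverts G. y v * (\<Sum>w\<in>nb G v. y w))"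
  shows "\<mu> < graph_spectral_radius G"
proof -
  let ?q = "(\<Sum>v\<in>pverts G. y v * (\<Sum>w\<in>nb G v. y w)) / (\<Sum>v\<in>pverts G. (y v)\<^sup>2)"
  have "\<mu> < ?q" using ray y by (simp add: divide_simps)
  also have "?q \<le> graph_spectral_radius G"
    by (rule spectral_radius_ge_Rayleigh[OF G y]) (use y in simp)
  finally show ?thesis .
qed

section \<open>Forests and locally acyclic graphs\<close>


text \<open>Acyclicity stated as 1-degeneracy: a nonempty set without such a vertex induces minimum
  degree 2 and so contains a cycle. This form yields leaves for induction, and its negation supplies
  a small dense witness.\<close>

definition forest :: "ngraph \<Rightarrow> bool" where
  "forest F \<longleftrightarrow> (\<forall>S. S \<subseteq> pverts F \<and> S \<noteq> {} \<longrightarrow> (\<exists>v\<in>S. card (nb F v \<inter> S) \<le> 1))"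

lemma forest_embedding:
  assumes G: "pair_graph G" and F: "pair_graph F" "forest F"
    and U: "U \<subseteq> pverts G" "U \<noteq> {}" "\<And>v. v \<in> U \<Longrightarrow> card (pverts F) \<le> card (nb G v \<inter> U)"
    and S: "S \<subseteq> pverts F"
  shows "\<exists>f. inj_on f S \<and> f ` S \<subseteq> U \<and> (\<forall>u\<in>S. \<forall>v\<in>S. (u, v) \<in> parcs F \<longrightarrow> (f u, f v) \<in> parcs G)"
proof -
  have fU: "finite U" using U(1) pair_graphD(1)[OF G] by (rule finite_subset)
  have "finite S" using S pair_graphD(1)[OF F(1)] by (rule finite_subset)
  then show ?thesis using S
  proof (induction "card S" arbitrary: S)
    case 0
    then show ?case by auto
  next
    case (Suc k)
    then have "S \<noteq> {}" by auto
    then obtain v where v: "v \<in> S" "card (nb F v \<inter> S) \<le> 1"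
      using F(2) Suc.prems(2) unfolding forest_def by blast
    define S' where "S' = S - {v}"
    have S': "card S' = k" "finite S'" "S' \<subseteq> pverts F" "S = insert v S'" "v \<notin> S'"
      using Suc v by (auto simp: S'_def)
    obtain f where f: "inj_on f S'" "f ` S' \<subseteq> U"
      "\<And>a b. a \<in> S' \<Longrightarrow> b \<in> S' \<Longrightarrow> (a, b) \<in> parcs F \<Longrightarrow> (f a, f b) \<in> parcs G"
      using Suc.hyps(1)[OF S'(1)[symmetric] S'(2,3)] by blast
    have less: "card (f ` S') < card (pverts F)"
    proof -
      have "card (f ` S') \<le> card S'" by (rule card_image_le[OF S'(2)])
      also have "\<dots> < card S" using Suc.hyps(2) S'(1) by simp
      also have "\<dots> \<le> card (pverts F)"
        by (rule card_mono[OF pair_graphD(1)[OF F(1)] Suc.prems(2)])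
      finally show ?thesis .
    qed
    have ex: "\<exists>u\<in>W. u \<notin> f ` S'" if "card (pverts F) \<le> card W" "finite W" for W
    proof (rule ccontr)
      assume "\<not> ?thesis"
      then have "card W \<le> card (f ` S')" using S'(2) by (intro card_mono) auto
      then show False using that(1) less by simp
    qed
    obtain u where u: "u \<in> U" "u \<notin> f ` S'" "\<And>w. w \<in> nb F v \<inter> S \<Longrightarrow> u \<in> nb G (f w)"
    proof (cases "nb F v \<inter> S = {}")
      case True
      obtain z where "z \<in> U" using U(2) by auto
      have "card (pverts F) \<le> card (nb G z \<inter> U)" using U(3) \<open>z \<in> U\<close> .
      also have "\<dots> \<le> card U" using fU by (intro card_mono) auto
      finally show ?thesis using ex[OF _ fU] True that by auto
    next
      case False
      then have "card (nb F v \<inter> S) = 1"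
        using v(2) nb_graph(1)[OF F(1)] by (metis One_nat_def card_0_eq finite_Int le_Suc_eq le_zero_eq)
      then obtain w where w: "nb F v \<inter> S = {w}" by (auto simp: card_1_singleton_iff)
      then have "w \<in> S'" using nb_graph(3)[OF F(1), of v] by (auto simp: S'_def)
      then have "f w \<in> U" using f(2) by auto
      then have "\<exists>u\<in>nb G (f w) \<inter> U. u \<notin> f ` S'" by (intro ex U(3)) (simp_all add: fU)
      then show ?thesis using w that by auto
    qed
    let ?f = "f(v := u)"
    have "inj_on ?f S" unfolding S'(4) using f(1) u(2) S'(5)
      by (auto simp: inj_on_def)
    moreover have "?f ` S \<subseteq> U" using f(2) u(1) S'(4,5) by auto
    moreover have "(?f a, ?f b) \<in> parcs G" if ab: "a \<in> S" "b \<in> S" "(a, b) \<in> parcs F" for a b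
    proof -
      have ne: "a \<noteq> b" using ab(3) pair_graphD(4)[OF F(1)] by auto
      consider "a = v" | "b = v" | "a \<in> S'" "b \<in> S'" "a \<noteq> v" "b \<noteq> v" using ab S'(4) by auto
      then show ?thesis
      proof cases
        case 1
        then have "u \<in> nb G (f b)" using ab by (intro u(3)) (auto simp: nb_def)
        then show ?thesis using 1 ne pair_graphD(3)[OF G] by (auto simp: nb_def)
      next
        case 2
        then have "u \<in> nb G (f a)" using ab pair_graphD(3)[OF F(1)] by (intro u(3)) (auto simp: nb_def)
        then show ?thesis using 2 ne by (auto simp: nb_def)
      next
        case 3
        then show ?thesis using f(3) ab(3) by auto
      qed
    qed
    ultimately show ?case by blast
  qed
qed

text \<open>Every nonempty \<open>U\<close> has a vertex with at most \<open>c\<close> neighbours in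
  \<open>U\<close>, as otherwise the forest would embed. Deleting it lowers the degree sum by at
  most 2c, once for each end of the lost edges.\<close>

lemma forest_free_sparse:
  assumes G: "pair_graph G" and F: "pair_graph F" "forest F" "card (pverts F) \<le> c"
    and free: "\<not> contains G F" and U: "U \<subseteq> pverts G"
  shows "(\<Sum>v\<in>U. card (nb G v \<inter> U)) \<le> 2 * c * card U"
proof -
  have "finite U" using U pair_graphD(1)[OF G] by (rule finite_subset)
  then show ?thesis using U
  proof (induction "card U" arbitrary: U)
    case 0
    then show ?case by simp
  next
    case (Suc k)
    then have ne: "U \<noteq> {}" by auto
    have "\<exists>v\<in>U. card (nb G v \<inter> U) \<le> c"
    proof (rule ccontr)
      assume "\<not> ?thesis"
      then have "card (pverts F) \<le> card (nb G v \<inter> U)" if "v \<in> U" for v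
        using that F(3) by force
      from forest_embedding[OF G F(1,2) Suc.prems(2) ne this order_refl]
      obtain f where "inj_on f (pverts F)" "f ` pverts F \<subseteq> U"
        "\<forall>u\<in>pverts F. \<forall>v\<in>pverts F. (u, v) \<in> parcs F \<longrightarrow> (f u, f v) \<in> parcs G" by blast
      then have "contains G F"
        using Suc.prems(2) pair_graphD(5,6)[OF F(1)] by (intro containsI[where f = f]) blast+
      then show False using free by simp
    qed
    then obtain v where v: "v \<in> U" "card (nb G v \<inter> U) \<le> c" by auto
    define U' where "U' = U - {v}"
    have U': "U = insert v U'" "v \<notin> U'" "finite U'" "card U' = k" "U' \<subseteq> pverts G"
      using Suc v by (auto simp: U'_def)
    have nv: "nb G v \<inter> U = nb G v \<inter> U'" using nb_graph(3)[OF G, of v] U'(1) by auto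
    have split: "card (nb G w \<inter> U) = card (nb G w \<inter> U') + (if w \<in> nb G v then 1 else 0)" for w
    proof (cases "w \<in> nb G v")
      case True
      then have "nb G w \<inter> U = insert v (nb G w \<inter> U')" using U'(1) nb_graph(4)[OF G] by auto
      then show ?thesis using True U'(2,3) by simp
    next
      case False
      then have "nb G w \<inter> U = nb G w \<inter> U'" using U'(1) nb_graph(4)[OF G] by auto
      then show ?thesis using False by simp
    qed
    have "(\<Sum>w\<in>U. card (nb G w \<inter> U)) = card (nb G v \<inter> U) + (\<Sum>w\<in>U'. card (nb G w \<inter> U))"
      using U' by simp
    also have "(\<Sum>w\<in>U'. card (nb G w \<inter> U))
        = (\<Sum>w\<in>U'. card (nb G w \<inter> U')) + (\<Sum>w\<in>U'. if w \<in> nb G v then 1 else 0)"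
      by (simp only: split sum.distrib)
    also have "(\<Sum>w\<in>U'. if w \<in> nb G v then 1 else 0) = card (nb G v \<inter> U)"
      unfolding nv using U'(3) by (simp add: sum.If_cases Int_commute)
    also have "(\<Sum>w\<in>U'. card (nb G w \<inter> U')) \<le> 2 * c * card U'"
      using Suc.hyps(1)[of U'] U' by simp
    finally have "(\<Sum>w\<in>U. card (nb G w \<inter> U)) \<le> 2 * c * card U' + 2 * c" using v(2) by simp
    then show ?case using Suc.hyps(2) U'(4) by (metis mult_Suc_right add.commute)
  qed
qed

section \<open>Balls, and graphs with many edges but no small subgraph of minimum degree two\<close>

fun ball :: "ngraph \<Rightarrow> nat \<Rightarrow> nat \<Rightarrow> nat set" where
  "ball G 0 u = {u}"
| "ball G (Suc k) u = ball G k u \<union> (\<Union>v\<in>ball G k u. nb G v)"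

lemma ball_mono: "j \<le> k \<Longrightarrow> ball G j u \<subseteq> ball G k u"
  by (rule lift_Suc_mono_le[of "\<lambda>k. ball G k u"]) auto

lemma card_ball:
  assumes "pair_graph G" and "\<And>v. card (nb G v) \<le> D"
  shows "finite (ball G k u) \<and> card (ball G k u) \<le> (D + 1) ^ k"
proof (induction k)
  case 0
  show ?case by simp
next
  case (Suc k)
  have fin: "finite (\<Union>v\<in>ball G k u. nb G v)" using Suc nb_graph(1)[OF assms(1)] by auto
  have "card (ball G (Suc k) u) \<le> card (ball G k u) + card (\<Union>v\<in>ball G k u. nb G v)"
    by (simp add: card_Un_le)
  also have "card (\<Union>v\<in>ball G k u. nb G v) \<le> (\<Sum>v\<in>ball G k u. card (nb G v))"
    using Suc by (intro card_UN_le) auto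
  also have "\<dots> \<le> (\<Sum>v\<in>ball G k u. D)" by (rule sum_mono) (rule assms(2))
  also have "\<dots> = D * card (ball G k u)" by simp
  also have "card (ball G k u) + D * card (ball G k u) = (D + 1) * card (ball G k u)" by simp
  also have "\<dots> \<le> (D + 1) * (D + 1) ^ k" using Suc by (intro mult_le_mono2) auto
  finally show ?case using Suc fin by simp
qed

text \<open>One exceptional vertex \<open>u\<close> of small degree is allowed. Deleting it can only
  spoil its single neighbour, which becomes the new exceptional vertex, so the peeling continues
  until no exception is left.\<close>

lemma core_exists:
  assumes G: "pair_graph G" and fin: "finite S" and S: "2 \<le> card S"
    and u: "\<And>w. w \<in> S \<Longrightarrow> w \<noteq> u \<Longrightarrow> 2 \<le> card (nb G w \<inter> S)"
  shows "\<exists>S'\<subseteq>S. S' \<noteq> {} \<and> (\<forall>w\<in>S'. 2 \<le> card (nb G w \<inter> S'))"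
  using assms(2-4)
proof (induction "card S" arbitrary: S u)
  case 0
  then show ?case by simp
next
  case (Suc k)
  show ?case
  proof (cases "u \<in> S \<and> card (nb G u \<inter> S) < 2")
    case False
    then have "\<forall>w\<in>S. 2 \<le> card (nb G w \<inter> S)" using Suc.prems(3) by (metis not_less)
    moreover have "S \<noteq> {}" using Suc.prems(2) by auto
    ultimately show ?thesis by blast
  next
    case True
    define S' where "S' = S - {u}"
    have fS': "finite S'" "card S' = k" using Suc True by (auto simp: S'_def)
    have "S' \<noteq> {}" using Suc.prems(2) Suc.hyps(2) fS' by auto
    then obtain w where w: "w \<in> S" "w \<noteq> u" by (auto simp: S'_def)
    \<comment> \<open>Peeling cannot exhaust the set: a second vertex \<open>w\<close> has two
      neighbours in \<open>S\<close> besides itself, so \<open>S\<close> has at least three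
      vertices.\<close>
    have "2 \<le> card (nb G w \<inter> S)" by (rule Suc.prems(3)[OF w])
    also have "\<dots> \<le> card (S - {w})"
      using nb_graph(3)[OF G, of w] Suc.prems(1) by (intro card_mono) auto
    also have "\<dots> = k" using Suc.hyps(2) w(1) Suc.prems(1) by simp
    finally have k: "2 \<le> card S'" using fS' by simp
    obtain z where z: "nb G u \<inter> S \<subseteq> {z}"
    proof -
      have "finite (nb G u \<inter> S)" using Suc.prems(1) by simp
      moreover have "card (nb G u \<inter> S) \<le> 1" using True by simp
      ultimately have "\<forall>a\<in>nb G u \<inter> S. \<forall>b\<in>nb G u \<inter> S. a = b" by (simp add: card_le_Suc0_iff_eq)
      then show ?thesis using that by blast
    qed
    have rest: "2 \<le> card (nb G w \<inter> S')" if "w \<in> S'" "w \<noteq> z" for w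
    proof -
      have "u \<notin> nb G w" using that z nb_graph(4)[OF G] by (auto simp: S'_def)
      then have "nb G w \<inter> S' = nb G w \<inter> S" by (auto simp: S'_def)
      then show ?thesis using Suc.prems(3)[of w] that by (auto simp: S'_def)
    qed
    have "\<exists>T\<subseteq>S'. T \<noteq> {} \<and> (\<forall>w\<in>T. 2 \<le> card (nb G w \<inter> T))"
      by (rule Suc.hyps(1)[OF fS'(2)[symmetric] fS'(1) k rest])
    moreover have "S' \<subseteq> S" by (auto simp: S'_def)
    ultimately show ?thesis by (meson order_trans)
  qed
qed

text \<open>
  Among the graphs of maximum degree at most \<open>D\<close> without short cycles, take one with the most
  edges: two vertices of degree less than \<open>D\<close> are close to each other, so there are few of them.
\<close>

lemma ex_locally_acyclic_graph:
  "\<exists>G. pair_graph G \<and> pverts G = {..<n}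
    \<and> (\<forall>S. S \<subseteq> pverts G \<and> S \<noteq> {} \<and> card S \<le> c \<longrightarrow> (\<exists>v\<in>S. card (nb G v \<inter> S) \<le> 1))
    \<and> D * (n - (D + 1) ^ (c * c + 1)) \<le> 2 * num_edges G"
proof -
  define P where "P G \<longleftrightarrow> pair_graph G \<and> pverts G = {..<n} \<and> (\<forall>v. card (nb G v) \<le> D)
    \<and> (\<forall>S. S \<subseteq> pverts G \<and> S \<noteq> {} \<and> card S \<le> c \<longrightarrow> (\<exists>v\<in>S. card (nb G v \<inter> S) \<le> 1))" for G
  have "P (edgeless_graph n)"
    unfolding P_def
    by (auto simp: edgeless_graph_def nb_def intro!: pair_graphI)
  moreover have "\<forall>G. P G \<longrightarrow> num_edges G < n * n + 1"
  proof (intro allI impI)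
    fix G assume "P G"
    then have G: "pair_graph G" and V: "pverts G = {..<n}" by (auto simp: P_def)
    have "card (parcs G) \<le> card ({..<n} \<times> {..<n})"
      using pair_graphD(5,6)[OF G] V by (intro card_mono) auto
    then show "num_edges G < n * n + 1" using card_parcs[OF G] by simp
  qed
  ultimately obtain G where PG: "P G" and max: "\<And>H. P H \<Longrightarrow> num_edges H \<le> num_edges G"
    using ex_has_greatest_nat[of P "edgeless_graph n" num_edges] by blast
  have G: "pair_graph G" and V: "pverts G = {..<n}" and deg: "\<And>v. card (nb G v) \<le> D"
    and acyc: "\<And>S. S \<subseteq> pverts G \<Longrightarrow> S \<noteq> {} \<Longrightarrow> card S \<le> c \<Longrightarrow> \<exists>v\<in>S. card (nb G v \<inter> S) \<le> 1"
    using PG by (auto simp: P_def)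
  define Low where "Low = {v \<in> pverts G. card (nb G v) < D}"
  \<comment> \<open>A set of at most \<open>c\<close> vertices spans at most c * c arcs, which
    bounds the length of a path needed inside it; the extra 1 makes the radius positive also for c =
    0.\<close>
  let ?r = "c * c + 1"
  have near: "v \<in> ball G ?r u" if uv: "u \<in> Low" "v \<in> Low" for u v
  proof (rule ccontr)
    assume far: "v \<notin> ball G ?r u"
    have far1: "v \<notin> ball G 1 u" using far ball_mono[of 1 ?r G u] by auto
    then have vu: "v \<noteq> u" "v \<notin> nb G u" by auto
    \<comment> \<open>If two vertices of degree below \<open>D\<close> were far apart, joining them
      would respect the degree bound, so by maximality the new graph has a set of at most
      \<open>c\<close> vertices with minimum degree 2.\<close>
    define G1 where "G1 = \<lparr>pverts = pverts G, parcs = parcs G \<union> {(u, v), (v, u)}\<rparr>"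
    have nb1: "nb G1 w = nb G w \<union> (if w = u then {v} else {}) \<union> (if w = v then {u} else {})" for w
      by (auto simp: nb_def G1_def)
    have G1: "pair_graph G1"
      using vu uv G by (intro pair_graphI) (auto simp: G1_def Low_def dest: pair_graphD)
    have "num_edges G1 > num_edges G"
    proof -
      have "parcs G \<subset> parcs G1" using vu(2) by (auto simp: G1_def nb_def)
      then have "card (parcs G) < card (parcs G1)"
        by (rule psubset_card_mono[OF pair_graphD(2)[OF G1]])
      then show ?thesis using card_parcs[OF G] card_parcs[OF G1] by simp
    qed
    then have "\<not> P G1" using max[of G1] by auto
    moreover have "card (nb G1 w) \<le> D" for w
    proof -
      have "card (nb G1 w) \<le> card (nb G w) + (if w = u \<or> w = v then 1 else 0)"
        using vu nb_graph(1)[OF G, of w] by (auto simp: nb1 card_insert_if)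
      then show ?thesis using uv deg[of w] by (auto simp: Low_def split: if_splits)
    qed
    moreover have "pverts G1 = {..<n}" using V by (simp add: G1_def)
    ultimately have "\<exists>S. S \<subseteq> pverts G1 \<and> S \<noteq> {} \<and> card S \<le> c \<and> (\<forall>w\<in>S. \<not> card (nb G1 w \<inter> S) \<le> 1)"
      using G1 unfolding P_def by blast
    then obtain S where S: "S \<subseteq> pverts G" "S \<noteq> {}" "card S \<le> c"
      and core': "\<And>w. w \<in> S \<Longrightarrow> \<not> card (nb G1 w \<inter> S) \<le> 1"
      by (auto simp: G1_def)
    have core: "2 \<le> card (nb G1 w \<inter> S)" if "w \<in> S" for w using core'[OF that] by simp
    have fS: "finite S" using S(1) pair_graphD(1)[OF G] by (rule finite_subset)
    have uS: "u \<in> S"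
    proof (rule ccontr)
      assume "u \<notin> S"
      then have "nb G1 w \<inter> S = nb G w \<inter> S" if "w \<in> S" for w using that by (auto simp: nb1)
      then show False using acyc[OF S] core by fastforce
    qed
    define R where "R = {(a, b). a \<in> S \<and> b \<in> S \<and> b \<in> nb G a}"
    have fR: "finite R" using fS by (auto simp: R_def intro: finite_subset[of _ "S \<times> S"])
    have cR: "card R \<le> c * c"
    proof -
      have "card R \<le> card (S \<times> S)" using fS by (intro card_mono) (auto simp: R_def)
      also have "\<dots> \<le> c * c" using S(3) by (simp add: card_cartesian_product mult_le_mono)
      finally show ?thesis .
    qed
    have Rball: "w \<in> ball G k u" if "(u, w) \<in> R ^^ k" for k w
      using that
    proof (induction k arbitrary: w)
      case 0
      then show ?case by simp
    next
      case (Suc k)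
      then obtain z where "(u, z) \<in> R ^^ k" "(z, w) \<in> R" by auto
      then show ?case using Suc.IH[of z] by (auto simp: R_def)
    qed
    \<comment> \<open>The part of \<open>S\<close> reachable from \<open>u\<close> by old edges. It
      misses \<open>v\<close>, which is too far away, so all its vertices except possibly
      \<open>u\<close> keep degree at least 2 in the old graph. \<open>core_exists\<close> then
      yields a small set contradicting \<open>acyc\<close>.\<close>
    define C where "C = {w. (u, w) \<in> R\<^sup>*}"
    have CS: "C \<subseteq> S"
    proof
      fix w assume "w \<in> C"
      then have "(u, w) \<in> R\<^sup>*" by (simp add: C_def)
      then show "w \<in> S" using uS by (auto elim: rtranclE simp: R_def)
    qed
    have vC: "v \<notin> C"
    proof
      assume "v \<in> C"
      then obtain k where "k \<le> card R" "(u, v) \<in> R ^^ k"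
        using rtrancl_finite_eq_relpow[OF fR] by (auto simp: C_def)
      then have "v \<in> ball G k u" "k \<le> ?r" using Rball cR by auto
      then show False using far ball_mono[of k ?r G u] by auto
    qed
    have uC: "u \<in> C" by (simp add: C_def)
    have clos: "nb G w \<inter> S \<subseteq> nb G w \<inter> C" if "w \<in> C" for w
    proof
      fix z assume z: "z \<in> nb G w \<inter> S"
      then have "(w, z) \<in> R" using that CS by (auto simp: R_def)
      then show "z \<in> nb G w \<inter> C" using z that by (auto simp: C_def intro: rtrancl_into_rtrancl)
    qed
    have fC: "finite C" using CS fS by (rule finite_subset)
    have big: "2 \<le> card (nb G w \<inter> C)" if w: "w \<in> C" "w \<noteq> u" for w
    proof -
      have "nb G1 w = nb G w" using w vC by (auto simp: nb1)
      then have "2 \<le> card (nb G w \<inter> S)" using core[of w] w(1) CS by auto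
      also have "\<dots> \<le> card (nb G w \<inter> C)" using clos[OF w(1)] fC by (intro card_mono) auto
      finally show ?thesis .
    qed
    have "2 \<le> card C"
    proof -
      have "\<not> nb G1 u \<inter> S \<subseteq> {v}"
      proof
        assume "nb G1 u \<inter> S \<subseteq> {v}"
        then have "card (nb G1 u \<inter> S) \<le> card {v}" by (intro card_mono) auto
        then show False using core[OF uS] by simp
      qed
      then obtain z where "z \<in> nb G u \<inter> S" using vu by (auto simp: nb1)
      then have "z \<in> C" "z \<noteq> u" using clos[OF uC] nb_graph(3)[OF G, of u] by auto
      then have "card {u, z} \<le> card C" using uC fC by (intro card_mono) auto
      then show ?thesis using \<open>z \<noteq> u\<close> by simp
    qed
    from core_exists[OF G fC this big] obtain S' where S': "S' \<subseteq> C" "S' \<noteq> {}"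
      "\<forall>w\<in>S'. 2 \<le> card (nb G w \<inter> S')" by blast
    have "card S' \<le> card S" using S'(1) CS fS by (intro card_mono) auto
    then have "card S' \<le> c" using S(3) by linarith
    then have "\<exists>v\<in>S'. card (nb G v \<inter> S') \<le> 1" using acyc[of S'] S' CS S(1) by auto
    then show False using S'(3) by fastforce
  qed
  have fV: "finite (pverts G)" by (rule pair_graphD[OF G])
  have "card Low \<le> (D + 1) ^ ?r"
  proof (cases "Low = {}")
    case False
    then obtain u where "u \<in> Low" by auto
    then have "Low \<subseteq> ball G ?r u" using near by auto
    then have "card Low \<le> card (ball G ?r u)"
      using card_ball[OF G deg, of ?r u] by (intro card_mono) blast+
    then show ?thesis using card_ball[OF G deg, of ?r u] by linarith
  qed simp
  moreover have "card (pverts G - Low) = n - card Low"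
    using fV V by (subst card_Diff_subset) (auto simp: Low_def)
  ultimately have "D * (n - (D + 1) ^ ?r) \<le> D * card (pverts G - Low)"
    by (metis diff_le_mono2 mult_le_mono2)
  also have "\<dots> = (\<Sum>v\<in>pverts G - Low. D)" by simp
  also have "\<dots> \<le> (\<Sum>v\<in>pverts G - Low. card (nb G v))"
    by (rule sum_mono) (auto simp: Low_def not_less)
  also have "\<dots> \<le> (\<Sum>v\<in>pverts G. card (nb G v))"
    using fV by (intro sum_mono2) auto
  also have "\<dots> = 2 * num_edges G" by (rule sum_degrees[OF G])
  finally show ?thesis using G V acyc by blast
qed

section \<open>Vertices with large eigenvector entries\<close>


text \<open>The vector is scaled so that its maximum 1 is attained at \<open>t\<close>. The bound on
  \<rho>^2 is the value for the complete bipartite graph with parts of sizes s and n - s;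
  \<open>sparse\<close> records a forbidden forest and \<open>no_K\<close> a forbidden complete
  bipartite graph with parts of sizes s + 1 and c.\<close>

locale subeigenvector =
  fixes G :: ngraph and n s c :: nat and x :: "nat \<Rightarrow> real" and \<rho> :: real and t :: nat
  assumes G: "pair_graph G" and n: "card (pverts G) = n" and s: "1 \<le> s" and c: "1 \<le> c"
    and sparse: "\<And>U. U \<subseteq> pverts G \<Longrightarrow> (\<Sum>v\<in>U. card (nb G v \<inter> U)) \<le> 2 * c * card U"
    and no_K: "\<And>A B. A \<subseteq> pverts G \<Longrightarrow> B \<subseteq> pverts G \<Longrightarrow> card A = s + 1 \<Longrightarrow> card B = c \<Longrightarrow>
      A \<inter> B = {} \<Longrightarrow> \<exists>a\<in>A. \<exists>b\<in>B. b \<notin> nb G a"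
    and rho: "0 \<le> \<rho>" "real s * (real n - real s) \<le> \<rho>\<^sup>2"
    and x: "\<And>v. 0 \<le> x v" "\<And>v. v \<in> pverts G \<Longrightarrow> x v \<le> 1" "t \<in> pverts G" "x t = 1"
    and sub: "\<And>v. v \<in> pverts G \<Longrightarrow> \<rho> * x v \<le> (\<Sum>w\<in>nb G v. x w)"
begin

abbreviation "V \<equiv> pverts G"
abbreviation "N \<equiv> nb G"
abbreviation deg :: "nat \<Rightarrow> real" where "deg v \<equiv> real (card (N v))"

lemma fV: "finite V" by (rule pair_graphD[OF G])
lemma NV: "N v \<subseteq> V" and fN: "finite (N v)" and N_irrefl: "v \<notin> N v"
  and N_sym: "w \<in> N v \<longleftrightarrow> v \<in> N w"
  using nb_graph[OF G] by blast+

lemma x_le_1: "v \<in> N u \<Longrightarrow> x v \<le> 1" using x(2) NV by blast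

lemma two_step:
  assumes u: "u \<in> V"
  shows "\<rho>\<^sup>2 * x u \<le> (\<Sum>v\<in>N u. \<Sum>w\<in>N v. x w)"
proof -
  have "\<rho>\<^sup>2 * x u = \<rho> * (\<rho> * x u)" by (simp add: power2_eq_square)
  also have "\<dots> \<le> \<rho> * (\<Sum>v\<in>N u. x v)" by (rule mult_left_mono[OF sub[OF u] rho(1)])
  also have "\<dots> = (\<Sum>v\<in>N u. \<rho> * x v)" by (rule sum_distrib_left)
  also have "\<dots> \<le> (\<Sum>v\<in>N u. \<Sum>w\<in>N v. x w)" by (rule sum_mono) (use sub NV in blast)
  finally show ?thesis .
qed

lemma deg_sum_le:
  assumes "U \<subseteq> V"
  shows "(\<Sum>v\<in>U. deg v) \<le> 2 * real c * real n"
proof -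
  have "(\<Sum>v\<in>U. card (N v)) \<le> (\<Sum>v\<in>V. card (N v))" by (rule sum_mono2[OF fV assms]) simp
  also have "\<dots> = (\<Sum>v\<in>V. card (N v \<inter> V))" using NV by (simp add: Int_absorb2)
  also have "\<dots> \<le> 2 * c * n" using sparse[of V] n by simp
  finally have "real (\<Sum>v\<in>U. card (N v)) \<le> real (2 * c * n)" by (rule of_nat_mono)
  then show ?thesis by simp
qed

definition L :: "real \<Rightarrow> nat set" where "L \<alpha> = {v \<in> V. \<alpha> \<le> x v}"

lemma L_V: "L \<alpha> \<subseteq> V" and fL: "finite (L \<alpha>)"
  using fV by (auto simp: L_def)

text \<open>An entry of at least \<alpha> forces degree at least \<rho> \<alpha>, because neighbours
  weigh at most 1, while the total degree is linear. This first bound O(n/\<rho>) is improved to a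
  constant in two further steps.\<close>

lemma card_L_rho: "\<rho> * \<alpha> * real (card (L \<alpha>)) \<le> 2 * real c * real n"
proof -
  have "\<rho> * \<alpha> * real (card (L \<alpha>)) = (\<Sum>v\<in>L \<alpha>. \<rho> * \<alpha>)" by simp
  also have "\<dots> \<le> (\<Sum>v\<in>L \<alpha>. deg v)"
  proof (rule sum_mono)
    fix v assume v: "v \<in> L \<alpha>"
    then have "\<rho> * \<alpha> \<le> \<rho> * x v" using rho(1) by (intro mult_left_mono) (auto simp: L_def)
    also have "\<dots> \<le> (\<Sum>w\<in>N v. x w)" using v sub by (auto simp: L_def)
    also have "\<dots> \<le> (\<Sum>w\<in>N v. 1)" by (rule sum_mono) (rule x_le_1)
    finally show "\<rho> * \<alpha> \<le> deg v" by simp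
  qed
  also have "\<dots> \<le> 2 * real c * real n" by (rule deg_sum_le[OF L_V])
  finally show ?thesis .
qed

lemma second_neighbours_split:
  assumes u: "u \<in> V" and a: "0 \<le> \<alpha>"
  shows "\<rho>\<^sup>2 * x u \<le> (\<Sum>v\<in>N u. \<Sum>w\<in>N v \<inter> L \<alpha>. x w) + 2 * real c * \<alpha> * real n"
proof -
  have "(\<Sum>w\<in>N v. x w) \<le> (\<Sum>w\<in>N v \<inter> L \<alpha>. x w) + \<alpha> * deg v" for v
  proof -
    have "(\<Sum>w\<in>N v. x w) = (\<Sum>w\<in>N v \<inter> L \<alpha>. x w) + (\<Sum>w\<in>N v - L \<alpha>. x w)"
      using sum.Int_Diff[OF fN] .
    also have "(\<Sum>w\<in>N v - L \<alpha>. x w) \<le> (\<Sum>w\<in>N v - L \<alpha>. \<alpha>)"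
      using NV by (intro sum_mono) (force simp: L_def)
    also have "\<dots> = \<alpha> * real (card (N v - L \<alpha>))" by simp
    also have "\<dots> \<le> \<alpha> * deg v"
      using a fN by (intro mult_left_mono) (auto intro: card_mono)
    finally show ?thesis by simp
  qed
  then have "(\<Sum>v\<in>N u. \<Sum>w\<in>N v. x w) \<le> (\<Sum>v\<in>N u. (\<Sum>w\<in>N v \<inter> L \<alpha>. x w) + \<alpha> * deg v)"
    by (rule sum_mono)
  also have "\<dots> = (\<Sum>v\<in>N u. \<Sum>w\<in>N v \<inter> L \<alpha>. x w) + \<alpha> * (\<Sum>v\<in>N u. deg v)"
    by (simp add: sum.distrib sum_distrib_left)
  also have "\<alpha> * (\<Sum>v\<in>N u. deg v) \<le> \<alpha> * (2 * real c * real n)"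
    by (rule mult_left_mono[OF deg_sum_le[OF NV] a])
  finally show ?thesis using two_step[OF u] by (simp add: algebra_simps)
qed

text \<open>Walks u, v, w of length two carry total weight at least \<rho>^2 x(u), about n \<alpha>.
  Those with w below a smaller threshold \<beta> carry little, and the others are counted by edges
  inside the sparse set \<open>N u \<union> L \<beta>\<close>. As |\<open>L \<beta>\<close>| is only
  O(n/\<rho>), the degree of u must be linear in n.\<close>

lemma deg_ge:
  assumes a: "0 < \<alpha>" and n4: "4 * s \<le> n" and r: "128 * real c ^ 3 / \<alpha>\<^sup>2 \<le> \<rho>"
    and u: "u \<in> L \<alpha>"
  shows "\<alpha> * real n \<le> 8 * real c * deg u"
proof -
  \<comment> \<open>Chosen so that the light endpoints cost 2 c \<beta> n = \<alpha> n / 4.\<close>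
  define \<beta> where "\<beta> = \<alpha> / (8 * real c)"
  have b: "0 < \<beta>" using a c by (simp add: \<beta>_def)
  let ?U = "N u \<union> L \<beta>"
  have uV: "u \<in> V" and xu: "\<alpha> \<le> x u" using u by (auto simp: L_def)
  have UV: "?U \<subseteq> V" using NV L_V by auto
  have fU: "finite ?U" using UV fV by (rule finite_subset)
  have "(\<Sum>v\<in>N u. card (N v \<inter> L \<beta>)) \<le> (\<Sum>v\<in>N u. card (N v \<inter> ?U))"
    using fU by (intro sum_mono card_mono) auto
  also have "\<dots> \<le> (\<Sum>v\<in>?U. card (N v \<inter> ?U))" using fU by (intro sum_mono2) auto
  also have "\<dots> \<le> 2 * c * card ?U" by (rule sparse[OF UV])
  also have "\<dots> \<le> 2 * c * (card (N u) + card (L \<beta>))" by (intro mult_le_mono2 card_Un_le)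
  finally have e: "real (\<Sum>v\<in>N u. card (N v \<inter> L \<beta>)) \<le> real (2 * c * (card (N u) + card (L \<beta>)))"
    by (rule of_nat_mono)
  have "(\<Sum>v\<in>N u. \<Sum>w\<in>N v \<inter> L \<beta>. x w) \<le> (\<Sum>v\<in>N u. \<Sum>w\<in>N v \<inter> L \<beta>. 1)"
    using x_le_1 by (intro sum_mono) auto
  then have 1: "\<rho>\<^sup>2 * x u \<le> 2 * real c * (deg u + real (card (L \<beta>))) + 2 * real c * \<beta> * real n"
    using second_neighbours_split[OF uV, of \<beta>] b e by simp
  \<comment> \<open>The previous bound gives |\<open>L \<beta>\<close>| \<le> 16 c^2 n / (\<rho>
    \<alpha>); the threshold 128 c^3 / \<alpha>^2 for \<rho> is what makes this another \<alpha> n /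
    4. Out of 3 \<alpha> n / 4, a quarter is left for the degree term.\<close>
  have "2 * real c * real (card (L \<beta>)) \<le> \<alpha> * real n / 4"
  proof -
    have "128 * real c ^ 3 / \<alpha>\<^sup>2 * (\<beta> * real (card (L \<beta>))) \<le> \<rho> * (\<beta> * real (card (L \<beta>)))"
      using b by (intro mult_right_mono[OF r]) simp
    also have "\<dots> \<le> 2 * real c * real n" using card_L_rho[of \<beta>] by (simp add: mult.assoc)
    finally have "16 * real c ^ 2 * real (card (L \<beta>)) / \<alpha> \<le> 2 * real c * real n"
      using a c by (simp add: \<beta>_def power2_eq_square power3_eq_cube)
    then have "16 * real c ^ 2 * real (card (L \<beta>)) \<le> 2 * real c * real n * \<alpha>"
      using a by (simp add: pos_divide_le_eq)
    then have "(8 * real c) * (2 * real c * real (card (L \<beta>))) \<le> (8 * real c) * (\<alpha> * real n / 4)"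
      by (simp add: power2_eq_square algebra_simps)
    then show ?thesis using c by simp
  qed
  moreover have "2 * real c * \<beta> * real n = \<alpha> * real n / 4" using c by (simp add: \<beta>_def)
  moreover have "\<alpha> * (3 / 4 * real n) \<le> \<rho>\<^sup>2 * x u"
  proof -
    have "real s * (real n - real s) \<ge> 1 * (3 / 4 * real n)"
      using n4 s by (intro mult_mono) auto
    then have "3 / 4 * real n \<le> \<rho>\<^sup>2" using rho(2) by linarith
    then have "3 / 4 * real n * \<alpha> \<le> \<rho>\<^sup>2 * x u" using xu a by (intro mult_mono) auto
    then show ?thesis by (simp add: mult.commute)
  qed
  moreover have "\<rho>\<^sup>2 * x u \<le> 2 * real c * deg u + 2 * real c * real (card (L \<beta>)) + 2 * real c * \<beta> * real n"
    using 1 by (simp add: distrib_left)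
  ultimately show ?thesis by linarith
qed

text \<open>Members of \<open>L \<alpha>\<close> have linear degree and the degree sum is linear, so
  there are boundedly many of them, independently of n.\<close>

lemma card_L_bound:
  assumes a: "0 < \<alpha>" and n4: "4 * s \<le> n" and n0: "0 < n" and r: "128 * real c ^ 3 / \<alpha>\<^sup>2 \<le> \<rho>"
  shows "real (card (L \<alpha>)) \<le> 16 * real c ^ 2 / \<alpha>"
proof -
  have "\<alpha> * real n * real (card (L \<alpha>)) = (\<Sum>v\<in>L \<alpha>. \<alpha> * real n)" by simp
  also have "\<dots> \<le> (\<Sum>v\<in>L \<alpha>. 8 * real c * deg v)"
    by (rule sum_mono) (rule deg_ge[OF a n4 r])
  also have "\<dots> = 8 * real c * (\<Sum>v\<in>L \<alpha>. deg v)" by (simp add: sum_distrib_left)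
  also have "\<dots> \<le> 8 * real c * (2 * real c * real n)" by (rule mult_left_mono[OF deg_sum_le[OF L_V]]) simp
  finally have "real n * (\<alpha> * real (card (L \<alpha>))) \<le> real n * (16 * real c ^ 2)"
    by (simp add: power2_eq_square algebra_simps)
  then have "\<alpha> * real (card (L \<alpha>)) \<le> 16 * real c ^ 2" using n0 by simp
  then show ?thesis using a by (simp add: pos_le_divide_eq mult.commute)
qed

lemma card_common_nb:
  assumes "A \<subseteq> V" and "card A = s + 1"
  shows "card {v \<in> V. A \<subseteq> N v} < c"
proof (rule ccontr)
  assume "\<not> ?thesis"
  then have "c \<le> card {v \<in> V. A \<subseteq> N v}" by simp
  then obtain B where B: "B \<subseteq> {v \<in> V. A \<subseteq> N v}" "card B = c" by (rule obtain_subset_with_card_n)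
  have "A \<inter> B = {}" using B(1) N_irrefl by blast
  then obtain a b where "a \<in> A" "b \<in> B" "b \<notin> N a" using no_K[OF assms(1) _ assms(2) B(2)] B(1) by blast
  then show False using B(1) N_sym by blast
qed

definition Bv :: "real \<Rightarrow> nat set" where "Bv \<alpha> = {v \<in> V. s + 1 \<le> card (N v \<inter> L \<alpha>)}"

text \<open>A vertex with more than \<open>s\<close> neighbours in \<open>L \<alpha>\<close> is a
  common neighbour of some s + 1 of them. There are at most 2^|\<open>L \<alpha>\<close>| such
  choices, each with fewer than \<open>c\<close> common neighbours.\<close>

lemma card_Bv: "card (Bv \<alpha>) \<le> 2 ^ card (L \<alpha>) * c"
proof -
  let ?P = "{A. A \<subseteq> L \<alpha> \<and> card A = s + 1}"
  have fP: "finite ?P" using fL[of \<alpha>] by simp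
  have "Bv \<alpha> \<subseteq> (\<Union>A\<in>?P. {v \<in> V. A \<subseteq> N v})"
  proof
    fix v assume v: "v \<in> Bv \<alpha>"
    then have "s + 1 \<le> card (N v \<inter> L \<alpha>)" by (simp add: Bv_def)
    then obtain A where "A \<subseteq> N v \<inter> L \<alpha>" "card A = s + 1" by (rule obtain_subset_with_card_n)
    then show "v \<in> (\<Union>A\<in>?P. {v \<in> V. A \<subseteq> N v})" using v by (auto simp: Bv_def)
  qed
  then have "card (Bv \<alpha>) \<le> card (\<Union>A\<in>?P. {v \<in> V. A \<subseteq> N v})"
    using fP fV by (intro card_mono) auto
  also have "\<dots> \<le> (\<Sum>A\<in>?P. card {v \<in> V. A \<subseteq> N v})" by (rule card_UN_le[OF fP])
  also have "\<dots> \<le> (\<Sum>A\<in>?P. c)"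
  proof (rule sum_mono)
    fix A assume "A \<in> ?P"
    then show "card {v \<in> V. A \<subseteq> N v} \<le> c" using card_common_nb[of A] L_V[of \<alpha>] by (auto intro: less_imp_le)
  qed
  also have "\<dots> = card ?P * c" by simp
  also have "card ?P \<le> card (Pow (L \<alpha>))" using fL by (intro card_mono) auto
  finally show ?thesis using fL by (simp add: card_Pow)
qed

text \<open>The boundedly many middle vertices in \<open>Bv \<alpha>\<close> are paid for by a
  constant, so that only middle vertices with at most \<open>s\<close> large neighbours remain in
  the sum.\<close>

lemma second_neighbours_bound:
  assumes u: "u \<in> V" and a: "0 \<le> \<alpha>" and M: "card (L \<alpha>) \<le> M"
  shows "\<rho>\<^sup>2 * x u \<le> (\<Sum>v\<in>N u - Bv \<alpha>. \<Sum>w\<in>N v \<inter> L \<alpha>. x w) + real (2 ^ M * c * M)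
    + 2 * real c * \<alpha> * real n"
proof -
  have "(\<Sum>v\<in>N u. \<Sum>w\<in>N v \<inter> L \<alpha>. x w) = (\<Sum>v\<in>N u \<inter> Bv \<alpha>. \<Sum>w\<in>N v \<inter> L \<alpha>. x w)
      + (\<Sum>v\<in>N u - Bv \<alpha>. \<Sum>w\<in>N v \<inter> L \<alpha>. x w)"
    by (rule sum.Int_Diff[OF fN])
  moreover have "(\<Sum>v\<in>N u \<inter> Bv \<alpha>. \<Sum>w\<in>N v \<inter> L \<alpha>. x w) \<le> real (2 ^ M * c * M)"
  proof -
    have "(\<Sum>w\<in>N v \<inter> L \<alpha>. x w) \<le> real M" for v
    proof -
      have "(\<Sum>w\<in>N v \<inter> L \<alpha>. x w) \<le> (\<Sum>w\<in>N v \<inter> L \<alpha>. 1)" using x_le_1 by (intro sum_mono) auto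
      also have "\<dots> \<le> real (card (L \<alpha>))" using fL by (auto intro: card_mono)
      finally show ?thesis using M by simp
    qed
    then have "(\<Sum>v\<in>N u \<inter> Bv \<alpha>. \<Sum>w\<in>N v \<inter> L \<alpha>. x w) \<le> (\<Sum>v\<in>N u \<inter> Bv \<alpha>. real M)" by (rule sum_mono)
    also have "\<dots> = real (card (N u \<inter> Bv \<alpha>) * M)" by simp
    also have "\<dots> \<le> real (2 ^ M * c * M)"
    proof (intro of_nat_mono mult_le_mono1)
      have "card (N u \<inter> Bv \<alpha>) \<le> card (Bv \<alpha>)" using fV by (intro card_mono) (auto simp: Bv_def)
      also have "\<dots> \<le> 2 ^ card (L \<alpha>) * c" by (rule card_Bv)
      also have "\<dots> \<le> 2 ^ M * c" using M by (intro mult_le_mono1 power_increasing) auto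
      finally show "card (N u \<inter> Bv \<alpha>) \<le> 2 ^ M * c" .
    qed
    finally show ?thesis .
  qed
  ultimately show ?thesis using second_neighbours_split[OF u a] by linarith
qed

lemma large_neighbours_le:
  assumes "v \<in> V" and "v \<notin> Bv \<alpha>"
  shows "(\<Sum>w\<in>N v \<inter> L \<alpha>. x w) \<le> real s"
proof -
  have "(\<Sum>w\<in>N v \<inter> L \<alpha>. x w) \<le> (\<Sum>w\<in>N v \<inter> L \<alpha>. 1)" using x_le_1 by (intro sum_mono) auto
  then show ?thesis using assms by (simp add: Bv_def)
qed

lemma common_nb_large:
  assumes A: "A \<subseteq> V" and d: "\<And>a. a \<in> A \<Longrightarrow> real n - e \<le> deg a"
  shows "real (card (V - {v \<in> V. A \<subseteq> N v})) \<le> real (card A) * e"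
proof -
  have fA: "finite A" using A fV by (rule finite_subset)
  have "V - {v \<in> V. A \<subseteq> N v} \<subseteq> (\<Union>a\<in>A. V - N a)" using N_sym by blast
  then have "card (V - {v \<in> V. A \<subseteq> N v}) \<le> card (\<Union>a\<in>A. V - N a)"
    using fV fA by (intro card_mono) auto
  also have "\<dots> \<le> (\<Sum>a\<in>A. card (V - N a))" by (rule card_UN_le[OF fA])
  finally have "real (card (V - {v \<in> V. A \<subseteq> N v})) \<le> real (\<Sum>a\<in>A. card (V - N a))"
    by (rule of_nat_mono)
  also have "\<dots> = (\<Sum>a\<in>A. real (card (V - N a)))" by simp
  also have "\<dots> \<le> (\<Sum>a\<in>A. e)"
  proof (rule sum_mono)
    fix a assume "a \<in> A"
    have "card (N a) \<le> card V" using NV fV by (intro card_mono) auto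
    then have "real (card (V - N a)) = real n - deg a"
      using NV fN n by (simp add: card_Diff_subset of_nat_diff)
    then show "real (card (V - N a)) \<le> e" using d[OF \<open>a \<in> A\<close>] by linarith
  qed
  finally show ?thesis by simp
qed

text \<open>Outside boundedly many middle vertices, a walk of length two has at most
  \<open>s\<close> choices for a large endpoint; comparing with \<rho>^2 \<ge> s (n - s) and
  cancelling s gives (n - s) x(u) \<le> deg u + small. So an entry near 1 means almost full degree,
  and s + 1 such vertices would have too many common neighbours. Conversely the entry 1 at
  \<open>t\<close> forces \<open>s\<close> of them. Every other vertex shares few neighbours with
  them, so its degree and its entry are small.\<close>

lemma large_vertices:
  fixes \<delta> :: real
  defines "M \<equiv> nat \<lfloor>64 * real c ^ 3 / \<delta>\<rfloor>"
  assumes d: "0 < \<delta>" "4 * (real s + 1) * \<delta> \<le> 1"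
    and n4: "4 * s \<le> n" and n0: "0 < n"
    and r: "128 * real c ^ 3 / (\<delta> / (4 * real c))\<^sup>2 \<le> \<rho>"
    and big: "4 * (real s * real s + real (2 ^ M * c * M) + real s + real c) \<le> \<delta> * real n"
  shows "\<exists>L. L \<subseteq> V \<and> card L = s \<and> (\<forall>w\<in>L. 1 - \<delta> \<le> x w) \<and> (\<forall>v\<in>V - L. x v \<le> (4 * real s + 4) * \<delta>)
    \<and> (\<forall>v\<in>V - L. card (N v \<inter> {v \<in> V. L \<subseteq> N v}) < c)
    \<and> real (card (V - {v \<in> V. L \<subseteq> N v})) \<le> real n / 2"
proof -
  \<comment> \<open>With this threshold light endpoints cost 2 c \<alpha> n = \<delta> n / 2, and
    \<open>card_L_bound\<close> gives 16 c^2 / \<alpha> = 64 c^3 / \<delta>, the number whose floor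
    is \<open>M\<close>.\<close>
  define \<alpha> where "\<alpha> = \<delta> / (4 * real c)"
  define K where "K = real (2 ^ M * c * M)"
  have a: "0 < \<alpha>" using d c by (simp add: \<alpha>_def)
  have "real (card (L \<alpha>)) \<le> 16 * real c ^ 2 / \<alpha>"
    by (rule card_L_bound[OF a n4 n0]) (use r in \<open>simp add: \<alpha>_def\<close>)
  also have "\<dots> = 64 * real c ^ 3 / \<delta>"
    using d c by (simp add: \<alpha>_def power2_eq_square power3_eq_cube)
  finally have "card (L \<alpha>) \<le> M" unfolding M_def by (simp add: le_nat_iff le_floor_iff)
  note bound = second_neighbours_bound[OF _ less_imp_le[OF a] this, folded K_def]
  have can: "2 * real c * \<alpha> * real n = \<delta> * real n / 2" using c by (simp add: \<alpha>_def)
  have rs: "1 \<le> real s" and rc: "1 \<le> real c" using s c by simp_all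
  have K0: "0 \<le> K" by (simp add: K_def)
  have big': "4 * (real s * real s + K + real s + real c) \<le> \<delta> * real n" using big by (simp add: K_def)
  have bound2: "\<rho>\<^sup>2 * x u \<le> real s * (deg u + K + \<delta> * real n / 2)" if u: "u \<in> V" for u
  proof -
    have "(\<Sum>v\<in>N u - Bv \<alpha>. \<Sum>w\<in>N v \<inter> L \<alpha>. x w) \<le> (\<Sum>v\<in>N u - Bv \<alpha>. real s)"
      using NV by (intro sum_mono large_neighbours_le) auto
    also have "\<dots> = real s * real (card (N u - Bv \<alpha>))" by simp
    also have "\<dots> \<le> real s * deg u" using fN by (intro mult_left_mono) (auto intro: card_mono)
    finally have "(\<Sum>v\<in>N u - Bv \<alpha>. \<Sum>w\<in>N v \<inter> L \<alpha>. x w) \<le> real s * deg u" .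
    then have "\<rho>\<^sup>2 * x u \<le> real s * deg u + 1 * (K + \<delta> * real n / 2)"
      using bound[OF u] unfolding can by simp
    also have "1 * (K + \<delta> * real n / 2) \<le> real s * (K + \<delta> * real n / 2)"
      using s K0 d by (intro mult_right_mono) auto
    finally show ?thesis by (simp add: algebra_simps)
  qed
  have cancel_s: "(real n - real s) * x u \<le> deg u + K + \<delta> * real n / 2" if u: "u \<in> V" for u
  proof -
    have "real s * ((real n - real s) * x u) \<le> \<rho>\<^sup>2 * x u"
      using rho(2) x(1) by (simp add: mult.assoc[symmetric] mult_right_mono)
    also have "\<dots> \<le> real s * (deg u + K + \<delta> * real n / 2)" by (rule bound2[OF u])
    finally show ?thesis using s by (simp add: mult_le_cancel_left)
  qed
  define H where "H = {w \<in> V. 1 - \<delta> \<le> x w}"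
  have fH: "finite H" using fV by (simp add: H_def)
  have d1: "\<delta> \<le> 1 / 4" 
  proof -
    have "4 * \<delta> \<le> 4 * (real s + 1) * \<delta>" using d(1) by (intro mult_right_mono) auto
    then show ?thesis using d(2) by linarith
  qed
  have degH: "real n - 2 * \<delta> * real n \<le> deg w" if "w \<in> H" for w
  proof -
    have "(real n - real s) * (1 - \<delta>) \<le> (real n - real s) * x w"
      using that n4 by (intro mult_left_mono) (auto simp: H_def)
    also have "\<dots> \<le> deg w + K + \<delta> * real n / 2" using that by (intro cancel_s) (auto simp: H_def)
    finally have "real n - real s - \<delta> * real n + \<delta> * real s \<le> deg w + K + \<delta> * real n / 2"
      by (simp add: algebra_simps)
    moreover have "0 \<le> \<delta> * real s" "0 \<le> real s * real s" using d by auto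
    moreover have "2 * \<delta> * real n = 2 * (\<delta> * real n)" by simp
    ultimately show ?thesis
      using big' K0 rs rc by argo
  qed
  have sd: "2 * (real s + 1) * \<delta> * real n \<le> real n / 2"
    using mult_right_mono[OF d(2), of "real n / 2"] by (simp add: algebra_simps)
  have "card H \<le> s"
  proof (rule ccontr)
    assume "\<not> ?thesis"
    then have "s + 1 \<le> card H" by simp
    then obtain A where A: "A \<subseteq> H" "card A = s + 1" by (rule obtain_subset_with_card_n)
    have AV: "A \<subseteq> V" using A(1) by (auto simp: H_def)
    have "real (card (V - {v \<in> V. A \<subseteq> N v})) \<le> real (card A) * (2 * \<delta> * real n)"
      using A(1) degH by (intro common_nb_large[OF AV]) auto
    also have "\<dots> = 2 * (real s + 1) * \<delta> * real n" using A(2) by (simp add: algebra_simps)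
    also have "\<dots> \<le> real n / 2" by (rule sd)
    finally have "real (card (V - {v \<in> V. A \<subseteq> N v})) \<le> real n / 2" .
    moreover have "card (V - {v \<in> V. A \<subseteq> N v}) = n - card {v \<in> V. A \<subseteq> N v}"
      using fV n by (subst card_Diff_subset) auto
    moreover have "card {v \<in> V. A \<subseteq> N v} < c" by (rule card_common_nb[OF AV A(2)])
    ultimately have "real n / 2 \<le> real c" by linarith
    moreover have "\<delta> * real n \<le> 1 / 4 * real n" using d1 by (intro mult_right_mono) auto
    ultimately show False using big' K0 rs rc zero_le_square[of "real s"] by argo
  qed
  moreover have "s \<le> card H"
  proof -
    \<comment> \<open>Averaging over middle vertices: if every one had large-neighbour weight at
      most s - \<delta>, the bound at \<open>t\<close> would give \<delta> n / 2 \<le> s^2 + K,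
      against \<open>big'\<close>.\<close>
    have "\<exists>v\<in>N t - Bv \<alpha>. real s - \<delta> < (\<Sum>w\<in>N v \<inter> L \<alpha>. x w)"
    proof (rule ccontr)
      assume "\<not> ?thesis"
      then have "(\<Sum>v\<in>N t - Bv \<alpha>. \<Sum>w\<in>N v \<inter> L \<alpha>. x w) \<le> (\<Sum>v\<in>N t - Bv \<alpha>. real s - \<delta>)"
        by (intro sum_mono) (force simp: not_less)
      also have "\<dots> = (real s - \<delta>) * real (card (N t - Bv \<alpha>))" by simp
      also have "\<dots> \<le> (real s - \<delta>) * real n"
      proof (rule mult_left_mono)
        have "card (N t - Bv \<alpha>) \<le> card V" using NV fV by (intro card_mono) auto
        then show "real (card (N t - Bv \<alpha>)) \<le> real n" using n by simp
      qed (use d1 s in auto)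
      finally have "real s * (real n - real s) \<le> (real s - \<delta>) * real n + K + \<delta> * real n / 2"
        using bound[OF x(3)] can rho(2) x(4) by simp
      then have "\<delta> * real n / 2 \<le> real s * real s + K" by (simp add: algebra_simps)
      then show False using big' K0 rs rc zero_le_square[of "real s"] by argo
    qed
    then obtain v where v: "v \<in> N t" "v \<notin> Bv \<alpha>" "real s - \<delta> < (\<Sum>w\<in>N v \<inter> L \<alpha>. x w)" by auto
    let ?Y = "N v \<inter> L \<alpha>"
    have fY: "finite ?Y" using fN by simp
    have cY: "card ?Y \<le> s" using v NV by (auto simp: Bv_def)
    have sum1: "(\<Sum>w\<in>Z. x w) \<le> real (card Z)" if "Z \<subseteq> N v" for Z
    proof -
      have "(\<Sum>w\<in>Z. x w) \<le> (\<Sum>w\<in>Z. 1)" using that x_le_1 by (intro sum_mono) auto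
      then show ?thesis by simp
    qed
    \<comment> \<open>At most \<open>s\<close> entries, each at most 1, with total above s -
      \<delta>: there must be exactly \<open>s\<close> of them, and each exceeds 1 -
      \<delta>.\<close>
    have "card ?Y = s"
    proof (rule ccontr)
      assume "card ?Y \<noteq> s"
      then have "real (card ?Y) \<le> real s - 1" using cY by linarith
      then show False using sum1[of ?Y] v(3) d1 by auto
    qed
    moreover have "?Y \<subseteq> H"
    proof
      fix w assume w: "w \<in> ?Y"
      have "(\<Sum>w\<in>?Y. x w) = x w + (\<Sum>w\<in>?Y - {w}. x w)" by (rule sum.remove[OF fY w])
      also have "(\<Sum>w\<in>?Y - {w}. x w) \<le> real (card (?Y - {w}))" by (rule sum1) auto
      also have "\<dots> \<le> real s - 1"
      proof -
        have "card (?Y - {w}) + 1 \<le> s" using w cY s by (subst card_Diff_singleton) auto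
        then show ?thesis by linarith
      qed
      finally show "w \<in> H" using v(3) w L_V by (auto simp: H_def)
    qed
    ultimately show ?thesis using card_mono[OF fH] by blast
  qed
  ultimately have cH: "card H = s" by simp
  have HV: "H \<subseteq> V" by (auto simp: H_def)
  define W where "W = {v \<in> V. H \<subseteq> N v}"
  have W: "real (card (V - W)) \<le> 2 * real s * \<delta> * real n"
    using common_nb_large[OF HV degH] cH by (simp add: W_def algebra_simps)
  \<comment> \<open>Together with \<open>v\<close>, the set \<open>H\<close> has s + 1 vertices, so
    \<open>card_common_nb\<close> applies.\<close>
  have few: "card (N v \<inter> W) < c" if v: "v \<in> V - H" for v
  proof -
    have "card (insert v H) = s + 1" using v fH cH by simp
    then have "card {w \<in> V. insert v H \<subseteq> N w} < c" using v HV by (intro card_common_nb) auto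
    moreover have "N v \<inter> W = {w \<in> V. insert v H \<subseteq> N w}" using N_sym NV by (auto simp: W_def)
    ultimately show ?thesis by simp
  qed
  have small: "x v \<le> (4 * real s + 4) * \<delta>" if v: "v \<in> V - H" for v
  proof -
    have "N v \<subseteq> (N v \<inter> W) \<union> (V - W)" using NV by auto
    then have "card (N v) \<le> card ((N v \<inter> W) \<union> (V - W))" using fV fN by (intro card_mono) auto
    also have "\<dots> \<le> card (N v \<inter> W) + card (V - W)" by (rule card_Un_le)
    finally have "deg v \<le> real c + 2 * real s * \<delta> * real n" using few[OF v] W by linarith
    then have "(real n - real s) * x v \<le> real c + 2 * real s * \<delta> * real n + K + \<delta> * real n / 2"
      using cancel_s[of v] v by auto
    also have "\<dots> \<le> 2 * real s * \<delta> * real n + \<delta> * real n"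
      using big' K0 rs rc zero_le_square[of "real s"] by argo
    finally have 1: "(real n - real s) * x v \<le> (2 * real s + 1) * \<delta> * real n" by (simp add: algebra_simps)
    have "real n / 2 * x v \<le> (real n - real s) * x v"
      using n4 x(1) by (intro mult_right_mono) auto
    then have "real n * (x v / 2) \<le> real n * ((2 * real s + 1) * \<delta>)" using 1 by (simp add: algebra_simps)
    then have "x v \<le> 2 * ((2 * real s + 1) * \<delta>)" using n0 by simp
    also have "\<dots> \<le> (4 * real s + 4) * \<delta>" using d by (simp add: algebra_simps)
    finally show ?thesis .
  qed
  have "real (card (V - W)) \<le> real n / 2"
  proof -
    have "2 * real s * \<delta> * real n \<le> 2 * (real s + 1) * \<delta> * real n"
      using d by (intro mult_right_mono) auto
    then show ?thesis using W sd by linarith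
  qed
  then show ?thesis using cH HV few small by (intro exI[of _ H]) (auto simp: W_def H_def)
qed

end

section \<open>Families of forbidden graphs\<close>


text \<open>An average over the exceptional set: sparsity gives average internal degree at most 2c,
  and each vertex has at most \<open>c\<close> neighbours in \<open>W\<close>. So some vertex has at
  most 3c neighbours outside \<open>Y\<close>, each of weight at most \<eta>.\<close>

lemma (in subeigenvector) ex_light_exceptional_vertex:
  assumes Y: "Y \<subseteq> V" and small: "\<And>v. v \<in> V - Y \<Longrightarrow> x v \<le> \<eta>" and eta: "0 \<le> \<eta>"
    and few: "\<And>v. v \<in> V - Y \<Longrightarrow> card (N v \<inter> W) \<le> c"
    and ne: "V - (Y \<union> W) \<noteq> {}"
  shows "\<exists>v \<in> V - (Y \<union> W). (\<Sum>w\<in>N v - Y. x w) \<le> 3 * real c * \<eta>"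
proof (rule ccontr)
  let ?E = "V - (Y \<union> W)"
  assume "\<not> ?thesis"
  then have gt: "3 * real c * \<eta> < (\<Sum>w\<in>N v - Y. x w)" if "v \<in> ?E" for v using that by force
  have fE: "finite ?E" using fV by simp
  have "real (card ?E) * (3 * real c * \<eta>) = (\<Sum>v\<in>?E. 3 * real c * \<eta>)" by simp
  also have "\<dots> < (\<Sum>v\<in>?E. \<Sum>w\<in>N v - Y. x w)" by (rule sum_strict_mono[OF fE ne gt])
  also have "\<dots> \<le> (\<Sum>v\<in>?E. \<eta> * real (c + card (N v \<inter> ?E)))"
  proof (rule sum_mono)
    fix v assume v: "v \<in> ?E"
    have "(\<Sum>w\<in>N v - Y. x w) \<le> (\<Sum>w\<in>N v - Y. \<eta>)" using NV by (intro sum_mono small) auto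
    also have "\<dots> = \<eta> * real (card (N v - Y))" by simp
    also have "\<dots> \<le> \<eta> * real (c + card (N v \<inter> ?E))"
    proof (intro mult_left_mono of_nat_mono)
      have "N v - Y \<subseteq> (N v \<inter> W) \<union> (N v \<inter> ?E)" using NV by auto
      then have "card (N v - Y) \<le> card ((N v \<inter> W) \<union> (N v \<inter> ?E))" using fN by (intro card_mono) auto
      also have "\<dots> \<le> card (N v \<inter> W) + card (N v \<inter> ?E)" by (rule card_Un_le)
      finally show "card (N v - Y) \<le> c + card (N v \<inter> ?E)" using few[of v] v by auto
    qed (rule eta)
    finally show "(\<Sum>w\<in>N v - Y. x w) \<le> \<eta> * real (c + card (N v \<inter> ?E))" .
  qed
  also have "\<dots> = \<eta> * real (\<Sum>v\<in>?E. c + card (N v \<inter> ?E))"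
    unfolding of_nat_sum sum_distrib_left ..
  also have "\<dots> \<le> \<eta> * real (3 * c * card ?E)"
  proof (intro mult_left_mono of_nat_mono)
    have "(\<Sum>v\<in>?E. card (N v \<inter> ?E)) \<le> 2 * c * card ?E" by (rule sparse) auto
    then show "(\<Sum>v\<in>?E. c + card (N v \<inter> ?E)) \<le> 3 * c * card ?E" by (simp add: sum.distrib)
  qed (rule eta)
  finally show False by (simp add: algebra_simps)
qed

lemma num_edges_le_square:
  assumes "pair_graph G" and "card (pverts G) = k"
  shows "num_edges G \<le> k * k"
proof -
  have "card (parcs G) \<le> card (pverts G \<times> pverts G)"
    using pair_graphD[OF assms(1)] by (intro card_mono) auto
  then show ?thesis using card_parcs[OF assms(1)] assms(2) by (simp add: card_cartesian_product)
qed

lemma extremalD: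
  assumes "G \<in> extremal n \<F>'"
  shows "pair_graph G" and "card (pverts G) = n" and "free_of \<F>' G"
    and "\<And>G'. G' \<in> free_graphs n \<F>' \<Longrightarrow> num_edges G' \<le> num_edges G"
  using assms by (auto simp: extremal_def is_arg_max_def free_graphs_def not_less)

locale graph_family =
  fixes \<F> :: "ngraph set" and s c :: nat
  assumes fam: "\<And>F. F \<in> \<F> \<Longrightarrow> pair_graph F" and fam_card: "\<And>F. F \<in> \<F> \<Longrightarrow> card (pverts F) \<le> c"
    and beta': "\<beta>'_fam \<F> = enat (s + 1)" and s: "1 \<le> s" and c: "1 \<le> c"
begin

lemma independent_covering_card:
  assumes "F \<in> \<F>" and "covering F S" and "independent_set F S"
  shows "s + 1 \<le> card S"
proof -
  have "\<beta>'_fam \<F> \<le> \<beta>' F" unfolding \<beta>'_fam_def by (rule INF_lower[OF assms(1)])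
  also have "\<dots> \<le> enat (card S)" unfolding \<beta>'_def by (rule INF_lower) (use assms in simp)
  finally show ?thesis by (simp add: beta')
qed

lemma ex_minimum_independent_covering:
  "\<exists>F\<in>\<F>. \<exists>S. covering F S \<and> independent_set F S \<and> card S = s + 1"
proof -
  have "\<F> \<noteq> {}" using beta' by (auto simp: \<beta>'_fam_def top_enat_def)
  then obtain F\<^sub>1 where "\<beta>' F\<^sub>1 \<in> \<beta>' ` \<F>" by auto
  then have "Inf (\<beta>' ` \<F>) \<in> \<beta>' ` \<F>" by (rule wellorder_InfI)
  then obtain F where F: "F \<in> \<F>" "\<beta>' F = enat (s + 1)" using beta' by (auto simp: \<beta>'_fam_def)
  let ?A = "(\<lambda>S. enat (card S)) ` {S. covering F S \<and> independent_set F S}"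
  have "?A \<noteq> {}"
  proof
    assume e: "?A = {}"
    have "\<beta>' F = Inf ?A" unfolding \<beta>'_def ..
    also have "\<dots> = \<infinity>" unfolding e by (simp add: top_enat_def)
    finally show False using F(2) by simp
  qed
  then obtain a where "a \<in> ?A" by auto
  then have "Inf ?A \<in> ?A" by (rule wellorder_InfI)
  then obtain S where S: "covering F S" "independent_set F S" "Inf ?A = enat (card S)" by auto
  then have "card S = s + 1" using F(2) unfolding \<beta>'_def by simp
  then show ?thesis using F(1) S by blast
qed

text \<open>A member attaining \<open>\<beta>'_fam\<close> has an independent covering of s + 1
  vertices, so it is bipartite between this covering and at most \<open>c\<close> further vertices,
  and embeds in a complete bipartite graph with parts \<open>A\<close> and \<open>B\<close>.\<close>

lemma free_no_complete_bipartite: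
  assumes G: "pair_graph G" "free_of \<F> G" and A: "A \<subseteq> pverts G" and B: "B \<subseteq> pverts G"
    and card: "card A = s + 1" "card B = c" and AB: "A \<inter> B = {}"
  shows "\<exists>a\<in>A. \<exists>b\<in>B. b \<notin> nb G a"
proof (rule ccontr)
  assume "\<not> ?thesis"
  then have arc: "(a, b) \<in> parcs G" "(b, a) \<in> parcs G" if "a \<in> A" "b \<in> B" for a b
    using that pair_graphD(3)[OF G(1)] by (auto simp: nb_def)
  obtain F S where F: "F \<in> \<F>" and S: "covering F S" "independent_set F S" "card S = s + 1"
    using ex_minimum_independent_covering by blast
  have SV: "S \<subseteq> pverts F" using S(1) by (simp add: covering_def)
  have fF: "finite (pverts F)" by (rule pair_graphD[OF fam[OF F]])
  have fA: "finite A" "finite B" using A B pair_graphD(1)[OF G(1)] finite_subset by blast+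
  obtain g where g: "g ` S \<subseteq> A" "inj_on g S"
    using card_le_inj[of S A] S(3) card fA SV fF finite_subset by (metis order_refl)
  have "card (pverts F - S) \<le> card B"
    using fam_card[OF F] card(2) card_mono[OF fF, of "pverts F - S"] by auto
  then obtain h where h: "h ` (pverts F - S) \<subseteq> B" "inj_on h (pverts F - S)"
    using card_le_inj[of "pverts F - S" B] fA fF by (metis finite_Diff)
  define f where "f v = (if v \<in> S then g v else h v)" for v
  have fS: "f v \<in> A" if "v \<in> S" for v using that g by (auto simp: f_def)
  have fN: "f v \<in> B" if "v \<in> pverts F - S" for v using that h by (auto simp: f_def)
  have "contains G F"
  proof (rule containsI[where f = f])
    show "inj_on f (pverts F)"
    proof (rule inj_onI)
      fix u v assume uv: "u \<in> pverts F" "v \<in> pverts F" "f u = f v"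
      have "u \<in> S \<longleftrightarrow> v \<in> S" using uv fS[of u] fS[of v] fN[of u] fN[of v] AB by auto
      then show "u = v" using uv g(2) h(2) by (cases "u \<in> S") (auto simp: f_def dest: inj_onD)
    qed
    show "f v \<in> pverts G" if "v \<in> pverts F" for v
      using that fS[of v] fN[of v] A B by (cases "v \<in> S") auto
    show "(f u, f v) \<in> parcs G" if uv: "(u, v) \<in> parcs F" for u v
    proof -
      have "u \<in> pverts F" "v \<in> pverts F" using uv pair_graphD[OF fam[OF F]] by auto
      moreover have "(u \<in> S \<and> v \<notin> S) \<or> (u \<notin> S \<and> v \<in> S)"
        using uv S by (auto simp: covering_def independent_set_def)
      ultimately show ?thesis using fS fN arc by (metis DiffI)
    qed
  qed
  then show False using G(2) F by (auto simp: free_of_def)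
qed

text \<open>Lets freeness be proved against both kinds of members at once, without deciding which
  case of the definition applies.\<close>

lemma \<H>_cases: "M \<in> \<H> \<F> \<Longrightarrow> M = complete_graph (s + 1) \<or> M \<in> \<M> \<F>"
  unfolding \<H>_def beta' the_enat.simps by (cases "enat (s + 1) = \<beta>_fam \<F>") simp_all

text \<open>If \<open>S\<close> covers F, the vertices of F outside \<open>S\<close> are
  independent. So a copy of F[S] in \<open>L\<close> extends to F by sending the rest to arbitrary
  vertices outside \<open>L\<close>, all of which are joined to \<open>L\<close>. The complete graph
  on s + 1 vertices is simply too large for \<open>L\<close>.\<close>

lemma join_free_imp_\<H>_free:
  assumes G: "pair_graph G" "free_of \<F> G" and L: "L \<subseteq> pverts G" "card L = s"
    and join: "\<And>v. v \<in> pverts G - L \<Longrightarrow> L \<subseteq> nb G v" and big: "c \<le> card (pverts G - L)"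
  shows "induced G L \<in> free_graphs s (\<H> \<F>)"
proof -
  have fL: "finite L" using L(1) pair_graphD(1)[OF G(1)] by (rule finite_subset)
  have VL: "pverts (induced G L) = L" using L by (auto simp: induced_def)
  have "\<not> contains (induced G L) (complete_graph (s + 1))"
  proof
    assume "contains (induced G L) (complete_graph (s + 1))"
    then obtain f where "inj_on f {..<s + 1}" "f ` {..<s + 1} \<subseteq> L"
      by (auto simp: contains_def VL complete_graph_def)
    then have "card {..<s + 1} \<le> card L" using fL by (metis card_inj_on_le)
    then show False using L(2) by simp
  qed
  moreover have "\<not> contains (induced G L) M" if M: "M \<in> \<M> \<F>" for M
  proof
    assume cont: "contains (induced G L) M"
    obtain F S where F: "F \<in> \<F>" and S: "covering F S" "card S < s + 1" and MS: "M = induced F S"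
      using M by (auto simp: \<M>_def beta')
    have SV: "S \<subseteq> pverts F" using S(1) by (simp add: covering_def)
    have fF: "finite (pverts F)" by (rule pair_graphD[OF fam[OF F]])
    obtain g where g: "inj_on g S" "g ` S \<subseteq> L"
      "\<And>u v. u \<in> S \<Longrightarrow> v \<in> S \<Longrightarrow> (u, v) \<in> parcs F \<Longrightarrow> (g u, g v) \<in> parcs G"
    proof -
      have "pverts M = S" using SV by (auto simp: MS induced_def)
      then obtain g where "inj_on g S" "g ` S \<subseteq> L" "\<forall>(u, v)\<in>parcs M. (g u, g v) \<in> parcs (induced G L)"
        using cont VL unfolding contains_def by auto
      then show ?thesis by (intro that[of g]) (auto simp: MS induced_def)
    qed
    have "card (pverts F - S) \<le> card (pverts G - L)"
      using fam_card[OF F] big card_mono[OF fF, of "pverts F - S"] by auto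
    then obtain h where h: "h ` (pverts F - S) \<subseteq> pverts G - L" "inj_on h (pverts F - S)"
      using card_le_inj[of "pverts F - S" "pverts G - L"] fF pair_graphD(1)[OF G(1)] by (metis finite_Diff)
    define f where "f v = (if v \<in> S then g v else h v)" for v
    have fS: "f v \<in> L" if "v \<in> S" for v using that g by (auto simp: f_def)
    have fN: "f v \<in> pverts G - L" if "v \<in> pverts F - S" for v using that h by (auto simp: f_def)
    have arc: "(a, b) \<in> parcs G" "(b, a) \<in> parcs G" if "a \<in> L" "b \<in> pverts G - L" for a b
      using that join[of b] pair_graphD(3)[OF G(1)] by (auto simp: nb_def)
    have "contains G F"
    proof (rule containsI[where f = f])
      show "inj_on f (pverts F)"
      proof (rule inj_onI)
        fix u v assume uv: "u \<in> pverts F" "v \<in> pverts F" "f u = f v"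
        have "u \<in> S \<longleftrightarrow> v \<in> S" using uv fS[of u] fS[of v] fN[of u] fN[of v] by auto
        then show "u = v" using uv g(1) h(2) by (cases "u \<in> S") (auto simp: f_def dest: inj_onD)
      qed
      show "f v \<in> pverts G" if "v \<in> pverts F" for v
        using that fS[of v] fN[of v] L(1) by (cases "v \<in> S") auto
      show "(f u, f v) \<in> parcs G" if uv: "(u, v) \<in> parcs F" for u v
      proof -
        have V: "u \<in> pverts F" "v \<in> pverts F" using uv pair_graphD[OF fam[OF F]] by auto
        have "u \<in> S \<or> v \<in> S" using uv S by (auto simp: covering_def)
        then consider "u \<in> S" "v \<in> S" | "u \<in> S" "v \<notin> S" | "u \<notin> S" "v \<in> S" by auto
        then show ?thesis
        proof cases
          case 1
          then show ?thesis using g(3) uv by (simp add: f_def)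
        next
          case 2
          then show ?thesis using fS fN arc(1) V by (metis DiffI)
        next
          case 3
          then show ?thesis using fS fN arc(2) V by (metis DiffI)
        qed
      qed
    qed
    then show False using G(2) F by (auto simp: free_of_def)
  qed
  ultimately have "free_of (\<H> \<F>) (induced G L)"
    by (auto simp: free_of_def dest!: \<H>_cases)
  then show ?thesis using VL L(2) pair_graph_induced[OF G(1)] by (simp add: free_graphs_def)
qed

text \<open>The edgeless graph is admissible: if it contained F[S], then \<open>S\<close> would be
  an independent covering with fewer than s + 1 vertices.\<close>

lemma ex_extremal_\<H>: "extremal s (\<H> \<F>) \<noteq> {}"
proof -
  let ?E = "edgeless_graph s"
  have E: "pair_graph ?E" "card (pverts ?E) = s"
    by (auto simp: edgeless_graph_def intro: pair_graphI)
  have "\<not> contains ?E (complete_graph (s + 1))"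
  proof
    assume "contains ?E (complete_graph (s + 1))"
    then obtain f where "inj_on f {..<s + 1}" "f ` {..<s + 1} \<subseteq> {..<s}"
      by (auto simp: contains_def edgeless_graph_def complete_graph_def)
    then have "card {..<s + 1} \<le> card {..<s}" by (metis card_inj_on_le finite_lessThan)
    then show False by simp
  qed
  moreover have "\<not> contains ?E M" if M: "M \<in> \<M> \<F>" for M
  proof
    assume cont: "contains ?E M"
    obtain F S where F: "F \<in> \<F>" and S: "covering F S" "card S < s + 1" and MS: "M = induced F S"
      using M by (auto simp: \<M>_def beta')
    have "parcs M = {}" using cont by (auto simp: contains_def edgeless_graph_def)
    then have "independent_set F S" using S(1) by (auto simp: MS induced_def covering_def independent_set_def)
    then show False using independent_covering_card[OF F S(1)] S(2) by simp
  qed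
  ultimately have "?E \<in> free_graphs s (\<H> \<F>)"
    using E by (auto simp: free_graphs_def free_of_def dest!: \<H>_cases)
  moreover have "\<forall>T. T \<in> free_graphs s (\<H> \<F>) \<longrightarrow> num_edges T < s * s + 1"
  proof (intro allI impI)
    fix T assume "T \<in> free_graphs s (\<H> \<F>)"
    then have "num_edges T \<le> s * s" by (intro num_edges_le_square) (auto simp: free_graphs_def)
    then show "num_edges T < s * s + 1" by simp
  qed
  ultimately obtain T where "T \<in> free_graphs s (\<H> \<F>)"
    "\<forall>T'. T' \<in> free_graphs s (\<H> \<F>) \<longrightarrow> num_edges T' \<le> num_edges T"
    using ex_has_greatest_nat[of "\<lambda>T. T \<in> free_graphs s (\<H> \<F>)" ?E num_edges] by blast
  then have "T \<in> extremal s (\<H> \<F>)" by (auto simp: extremal_def is_arg_max_def not_less)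
  then show ?thesis by auto
qed

text \<open>The slope is relaxed from r to 1, which is enough to obtain the core; the sharper slope
  enters only when small components are counted. The bound 2 * s \<le> n keeps n - s a genuine
  difference.\<close>

definition hyp :: "real \<Rightarrow> nat \<Rightarrow> ngraph \<Rightarrow> bool" where
  "hyp C n H \<longleftrightarrow> pair_graph H \<and> card (pverts H) = n - s \<and> 2 * s \<le> n
     \<and> (\<forall>T\<in>extremal s (\<H> \<F>). T \<^bold>\<or> H \<in> extremal n \<F>)
     \<and> real (num_edges H) \<le> real n + C"

lemma hyp_num_edges_le:
  assumes "hyp C n H" and "T \<in> extremal s (\<H> \<F>)" and "G \<in> free_graphs n \<F>"
  shows "num_edges G \<le> num_edges T + num_edges H + s * (n - s)"
proof -
  have H: "pair_graph H" "card (pverts H) = n - s" "T \<^bold>\<or> H \<in> extremal n \<F>"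
    using assms by (auto simp: hyp_def)
  note T = extremalD[OF assms(2)]
  show ?thesis using extremalD(4)[OF H(3) assms(3)] num_edges_join[OF T(1) H(1)] T(2) H(2) by simp
qed

text \<open>If no member were a forest, each would contain a set of at most \<open>c\<close>
  vertices inducing minimum degree 2, so a graph without such sets would be free. That graph can
  have about (s + 2) n edges, whereas the hypothesis allows only (s + 1) n + O(1).\<close>

lemma hyp_imp_forest:
  "\<exists>N. \<forall>n\<ge>N. \<forall>H. hyp C n H \<longrightarrow> (\<exists>F\<in>\<F>. forest F)"
proof -
  \<comment> \<open>Half of this degree, s + 2, must exceed the slope s + 1 coming from s(n - s) and
    e(H).\<close>
  define D where "D = 2 * (s + 2)"
  define K where "K = (D + 1) ^ (c * c + 1)"
  define N where "N = nat \<lceil>real (s * s) + C + real ((s + 2) * K)\<rceil> + 1"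
  have "\<exists>F\<in>\<F>. forest F" if n: "n \<ge> N" and H: "hyp C n H" for n H
  proof (rule ccontr)
    assume no: "\<not> ?thesis"
    obtain G where G0: "pair_graph G \<and> pverts G = {..<n}
      \<and> (\<forall>S. S \<subseteq> pverts G \<and> S \<noteq> {} \<and> card S \<le> c \<longrightarrow> (\<exists>v\<in>S. card (nb G v \<inter> S) \<le> 1))
      \<and> D * (n - K) \<le> 2 * num_edges G"
      using ex_locally_acyclic_graph[of n c D, folded K_def] ..
    then have G: "pair_graph G" "pverts G = {..<n}"
      and acyc: "\<And>S. S \<subseteq> pverts G \<Longrightarrow> S \<noteq> {} \<Longrightarrow> card S \<le> c \<Longrightarrow> \<exists>v\<in>S. card (nb G v \<inter> S) \<le> 1"
      and edges: "D * (n - K) \<le> 2 * num_edges G"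
      by auto
    have "\<not> contains G F" if F: "F \<in> \<F>" for F
    proof
      assume "contains G F"
      then obtain f where f: "inj_on f (pverts F)" "f ` pverts F \<subseteq> pverts G"
        "\<forall>(u, v)\<in>parcs F. (f u, f v) \<in> parcs G" unfolding contains_def by blast
      have "\<not> forest F" using no F by blast
      then obtain S where S: "S \<subseteq> pverts F" "S \<noteq> {}" "\<forall>v\<in>S. \<not> card (nb F v \<inter> S) \<le> 1"
        unfolding forest_def by meson
      have fF: "finite (pverts F)" by (rule pair_graphD[OF fam[OF F]])
      have injS: "inj_on f S" using f(1) S(1) by (rule inj_on_subset)
      have "card (f ` S) \<le> c"
        using card_mono[OF fF S(1)] fam_card[OF F] card_image[OF injS] by simp
      then obtain v where v: "v \<in> S" "card (nb G (f v) \<inter> f ` S) \<le> 1"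
        using acyc[of "f ` S"] S(1,2) f(2) by blast
      have "card (nb F v \<inter> S) = card (f ` (nb F v \<inter> S))"
        by (rule card_image[symmetric]) (rule inj_on_subset[OF injS], simp)
      also have "\<dots> \<le> card (nb G (f v) \<inter> f ` S)"
        using f(3) by (intro card_mono finite_Int disjI1 nb_graph(1)[OF G(1)]) (auto simp: nb_def)
      finally show False using S(3) v by fastforce
    qed
    then have "G \<in> free_graphs n \<F>" using G by (auto simp: free_graphs_def free_of_def)
    moreover obtain T where T: "T \<in> extremal s (\<H> \<F>)" using ex_extremal_\<H> by auto
    ultimately have "num_edges G \<le> num_edges T + num_edges H + s * (n - s)" using hyp_num_edges_le[OF H] by blast
    moreover have "num_edges T \<le> s * s" using num_edges_le_square extremalD[OF T] by blast
    moreover have "s * (n - s) \<le> s * n" by simp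
    ultimately have "num_edges G \<le> s * s + num_edges H + s * n" by linarith
    moreover have "(s + 2) * n \<le> (s + 2) * K + num_edges G"
    proof -
      have "(s + 2) * (n - K) \<le> num_edges G" using edges by (simp add: D_def)
      then have "(s + 2) * n - (s + 2) * K \<le> num_edges G" by (metis diff_mult_distrib2)
      then show ?thesis by linarith
    qed
    ultimately have "2 * n \<le> (s + 2) * K + s * s + num_edges H" by (simp add: algebra_simps)
    then have "real (2 * n) \<le> real ((s + 2) * K + s * s + num_edges H)" by (rule of_nat_mono)
    moreover have "real (num_edges H) \<le> real n + C" using H by (simp add: hyp_def)
    ultimately have "real n \<le> real (s * s) + C + real ((s + 2) * K)" by simp
    moreover have "real (s * s) + C + real ((s + 2) * K) < real N" unfolding N_def by linarith
    moreover have "real N \<le> real n" using n by simp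
    ultimately show False by linarith
  qed
  then show ?thesis by blast
qed

text \<open>The test vector is the Perron vector of the complete bipartite graph between the two
  sides; edges inside the sides can only help.\<close>

lemma join_spectral_radius_ge:
  assumes T: "pair_graph T" "card (pverts T) = s" and H: "pair_graph H" "card (pverts H) = m" and m: "0 < m"
  shows "sqrt (real s * real m) \<le> graph_spectral_radius (T \<^bold>\<or> H)"
proof -
  let ?J = "T \<^bold>\<or> H"
  note fin = pair_graphD(1)[OF T(1)] pair_graphD(1)[OF H(1)] nb_graph(1)[OF T(1)] nb_graph(1)[OF H(1)]
  define y where "y v = (if v \<in> range inl then sqrt (real m) else sqrt (real s))" for v
  have y: "y (inl u) = sqrt (real m)" "y (inr u) = sqrt (real s)" for u
    by (auto simp: y_def sum_encode_eq)
  have y0: "0 \<le> y v" for v by (simp add: y_def)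
  have sq: "(\<Sum>v\<in>pverts ?J. (y v)\<^sup>2) = 2 * (real s * real m)"
    unfolding pverts_join sum_join[OF fin(1,2)] by (simp add: y T(2) H(2))
  show ?thesis
  proof (rule spectral_radius_ge_Rayleigh[OF pair_graph_join[OF T(1) H(1)], of y])
    show "0 < (\<Sum>v\<in>pverts ?J. (y v)\<^sup>2)" unfolding sq using s m by simp
    have 1: "real m * sqrt (real s) \<le> (\<Sum>w\<in>nb ?J (inl u). y w)" if "u \<in> pverts T" for u
      unfolding nb_join(1)[OF that] sum_join[OF fin(3,2)]
      by (simp add: y H(2))
    have 2: "real s * sqrt (real m) \<le> (\<Sum>w\<in>nb ?J (inr u). y w)" if "u \<in> pverts H" for u
      unfolding nb_join(2)[OF that] sum_join[OF fin(1,4)]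
      by (simp add: y T(2))
    have "sqrt (real s * real m) * (2 * (real s * real m))
        = (\<Sum>u\<in>pverts T. y (inl u) * (real m * sqrt (real s))) + (\<Sum>u\<in>pverts H. y (inr u) * (real s * sqrt (real m)))"
      by (simp add: y T(2) H(2) real_sqrt_mult algebra_simps)
    also have "\<dots> \<le> (\<Sum>u\<in>pverts T. y (inl u) * (\<Sum>w\<in>nb ?J (inl u). y w))
        + (\<Sum>u\<in>pverts H. y (inr u) * (\<Sum>w\<in>nb ?J (inr u). y w))"
      by (intro add_mono sum_mono mult_left_mono 1 2 y0)
    also have "\<dots> = (\<Sum>v\<in>pverts ?J. y v * (\<Sum>w\<in>nb ?J v. y w))"
      unfolding pverts_join sum_join[OF fin(1,2)] ..
    finally show "sqrt (real s * real m) * (\<Sum>v\<in>pverts ?J. (y v)\<^sup>2)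
        \<le> (\<Sum>v\<in>pverts ?J. y v * (\<Sum>w\<in>nb ?J v. y w))"
      unfolding sq .
  qed
qed

end

section \<open>The core of a spectral extremal graph\<close>


text \<open>Isolates everything that depends on \<open>v\<close>, so that rewiring \<open>v\<close>
  changes only the first term.\<close>

lemma quadratic_form_split:
  fixes y :: "nat \<Rightarrow> real"
  assumes G: "pair_graph G" and v: "v \<in> pverts G"
  shows "(\<Sum>u\<in>pverts G. y u * (\<Sum>w\<in>nb G u. y w))
    = 2 * y v * (\<Sum>w\<in>nb G v. y w) + (\<Sum>u\<in>pverts G - {v}. y u * (\<Sum>w\<in>nb G u - {v}. y w))"
proof -
  let ?V = "pverts G"
  have fV: "finite ?V" by (rule pair_graphD[OF G])
  have in_nb: "(\<Sum>w\<in>nb G u. y w) = (\<Sum>w\<in>nb G u - {v}. y w) + (if u \<in> nb G v then y v else 0)" for u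
    using sum.remove[OF nb_graph(1)[OF G], of v u y] nb_graph(4)[OF G, of u v] by (auto simp: insert_absorb)
  have "(\<Sum>u\<in>?V - {v}. if u \<in> nb G v then y u * y v else 0) = (\<Sum>u\<in>nb G v. y u * y v)"
    using fV nb_graph(2,3)[OF G, of v]
    by (subst sum.inter_restrict[symmetric]) (auto intro!: sum.cong)
  then have cross: "(\<Sum>u\<in>?V - {v}. y u * (if u \<in> nb G v then y v else 0)) = y v * (\<Sum>u\<in>nb G v. y u)"
    by (simp add: if_distrib sum_distrib_left mult.commute cong: if_cong)
  have "(\<Sum>u\<in>?V. y u * (\<Sum>w\<in>nb G u. y w))
      = y v * (\<Sum>w\<in>nb G v. y w) + (\<Sum>u\<in>?V - {v}. y u * (\<Sum>w\<in>nb G u. y w))"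
    by (rule sum.remove[OF fV v])
  also have "(\<Sum>u\<in>?V - {v}. y u * (\<Sum>w\<in>nb G u. y w))
      = (\<Sum>u\<in>?V - {v}. y u * (\<Sum>w\<in>nb G u - {v}. y w)) + y v * (\<Sum>u\<in>nb G v. y u)"
    unfolding in_nb distrib_left sum.distrib cross ..
  finally show ?thesis by simp
qed

context graph_family
begin

lemma extremal_spD:
  assumes "G \<in> extremal_sp n \<F>"
  shows "pair_graph G" and "card (pverts G) = n" and "free_of \<F> G"
    and "\<And>G'. G' \<in> free_graphs n \<F> \<Longrightarrow> graph_spectral_radius G' \<le> graph_spectral_radius G"
  using assms by (auto simp: extremal_sp_def is_arg_max_def free_graphs_def not_less)

text \<open>
  Replacing the neighbourhood of \<open>v\<close> by \<open>L\<close> preserves freeness, since a copy using \<open>v\<close> may use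
  another common neighbour of \<open>L\<close> instead.
\<close>

lemma neighbourhood_weight_ge:
  fixes x :: "nat \<Rightarrow> real"
  assumes G: "G \<in> extremal_sp n \<F>" and rho: "0 < graph_spectral_radius G"
    and sub: "\<And>v. v \<in> pverts G \<Longrightarrow> graph_spectral_radius G * x v \<le> (\<Sum>w\<in>nb G v. x w)"
    and x: "\<And>v. 0 \<le> x v"
    and L: "L \<subseteq> pverts G" and v: "v \<in> pverts G - L" and pos: "0 < (\<Sum>w\<in>L. x w)"
    and W: "c < card {w \<in> pverts G. L \<subseteq> nb G w}"
  shows "(\<Sum>w\<in>L. x w) \<le> (\<Sum>w\<in>nb G v. x w)"
proof (rule ccontr)
  assume "\<not> ?thesis"
  then have light: "(\<Sum>w\<in>nb G v. x w) < (\<Sum>w\<in>L. x w)" by simp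
  let ?V = "pverts G" and ?\<rho> = "graph_spectral_radius G" and ?W = "{w \<in> pverts G. L \<subseteq> nb G w}"
  note D = extremal_spD[OF G]
  have fV: "finite ?V" by (rule pair_graphD[OF D(1)])
  have fL: "finite L" using L fV by (rule finite_subset)
  have vW: "v \<notin> ?W"
  proof
    assume "v \<in> ?W"
    then have "(\<Sum>w\<in>L. x w) \<le> (\<Sum>w\<in>nb G v. x w)"
      using nb_graph(1)[OF D(1)] x by (intro sum_mono2) auto
    then show False using light by simp
  qed
  define G' where "G' = \<lparr>pverts = ?V,
    parcs = {(a, b). (a, b) \<in> parcs G \<and> a \<noteq> v \<and> b \<noteq> v} \<union> {v} \<times> L \<union> L \<times> {v}\<rparr>"
  have V': "pverts G' = ?V" by (simp add: G'_def)
  have G': "pair_graph G'"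
    using L v by (intro pair_graphI) (auto simp: G'_def fV dest: pair_graphD(3,5,6)[OF D(1)] simp: pair_graphD(4)[OF D(1)])
  have nbv: "nb G' v = L" using v by (auto simp: nb_def G'_def)
  have nbu: "nb G' u - {v} = nb G u - {v}" if "u \<noteq> v" for u using that by (auto simp: nb_def G'_def)
  have "\<not> contains G' F" if F: "F \<in> \<F>" for F
  proof
    assume "contains G' F"
    then obtain f where f: "inj_on f (pverts F)" "f ` pverts F \<subseteq> ?V"
      "\<forall>(a, b)\<in>parcs F. (f a, f b) \<in> parcs G'" unfolding contains_def V' by blast
    have fF: "finite (pverts F)" by (rule pair_graphD[OF fam[OF F]])
    have "card (f ` pverts F) < card ?W"
      using card_image_le[OF fF, of f] fam_card[OF F] W by linarith
    then have "\<not> ?W \<subseteq> f ` pverts F" using card_mono[of "f ` pverts F" ?W] fF by auto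
    then obtain w where w: "w \<in> ?W" "w \<notin> f ` pverts F" by blast
    define g where "g a = (if f a = v then w else f a)" for a
    have "contains G F"
    proof (rule containsI[where f = g])
      show "inj_on g (pverts F)"
      proof (rule inj_onI)
        fix a b assume ab: "a \<in> pverts F" "b \<in> pverts F" "g a = g b"
        then have "f a = f b" using w(2) by (auto simp: g_def split: if_splits)
        then show "a = b" using f(1) ab by (auto dest: inj_onD)
      qed
      show "g a \<in> ?V" if "a \<in> pverts F" for a using that f(2) w(1) by (auto simp: g_def)
      show "(g a, g b) \<in> parcs G" if ab: "(a, b) \<in> parcs F" for a b
      proof -
        have "(f a, f b) \<in> parcs G'" using f(3) ab by auto
        moreover have "(w, z) \<in> parcs G" "(z, w) \<in> parcs G" if "z \<in> L" for z
          using that w(1) pair_graphD(3)[OF D(1)] by (auto simp: nb_def)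
        ultimately show ?thesis using v by (auto simp: g_def G'_def)
      qed
    qed
    then show False using D(3) F by (auto simp: free_of_def)
  qed
  then have "G' \<in> free_graphs n \<F>" using G' D(2) V' by (auto simp: free_graphs_def free_of_def)
  then have le: "graph_spectral_radius G' \<le> ?\<rho>" by (rule D(4))
  let ?S = "\<Sum>w\<in>L. x w"
  \<comment> \<open>If x(v) = 0, rewiring alone gains nothing. The entry is then raised to the value
    that the eigenvalue equation prescribes for a vertex joined to \<open>L\<close>, which makes the
    gain strict.\<close>
  define z where "z = (if x v = 0 then ?S / ?\<rho> else x v)"
  define y where "y = x(v := z)"
  have vV: "v \<in> ?V" using v by simp
  have ySq: "(\<Sum>u\<in>?V. (y u)\<^sup>2) = (\<Sum>u\<in>?V. (x u)\<^sup>2) - (x v)\<^sup>2 + z\<^sup>2"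
  proof -
    have "(\<Sum>u\<in>?V - {v}. (y u)\<^sup>2) = (\<Sum>u\<in>?V - {v}. (x u)\<^sup>2)" by (rule sum.cong) (auto simp: y_def)
    then show ?thesis
      using sum.remove[OF fV vV, of "\<lambda>u. (y u)\<^sup>2"] sum.remove[OF fV vV, of "\<lambda>u. (x u)\<^sup>2"]
      by (simp add: y_def)
  qed
  have z0: "0 < z" using pos rho x[of v] by (auto simp: z_def less_le)
  have rest: "(\<Sum>u\<in>?V - {v}. y u * (\<Sum>w\<in>nb G' u - {v}. y w))
      = (\<Sum>u\<in>?V - {v}. x u * (\<Sum>w\<in>nb G u - {v}. x w))"
  proof (rule sum.cong[OF refl])
    fix u assume u: "u \<in> ?V - {v}"
    then have "(\<Sum>w\<in>nb G' u - {v}. y w) = (\<Sum>w\<in>nb G u - {v}. x w)"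
      by (intro sum.cong) (auto simp: nbu y_def)
    then show "y u * (\<Sum>w\<in>nb G' u - {v}. y w) = x u * (\<Sum>w\<in>nb G u - {v}. x w)"
      using u by (simp add: y_def)
  qed
  have yL: "(\<Sum>w\<in>L. y w) = ?S" using v by (intro sum.cong) (auto simp: y_def)
  have q': "(\<Sum>u\<in>?V. y u * (\<Sum>w\<in>nb G' u. y w))
      = 2 * z * ?S + (\<Sum>u\<in>?V - {v}. x u * (\<Sum>w\<in>nb G u - {v}. x w))"
    using quadratic_form_split[OF G', of v y] vV unfolding V' nbv rest yL by (simp add: y_def)
  have q: "(\<Sum>u\<in>?V. x u * (\<Sum>w\<in>nb G u. x w))
      = 2 * x v * (\<Sum>w\<in>nb G v. x w) + (\<Sum>u\<in>?V - {v}. x u * (\<Sum>w\<in>nb G u - {v}. x w))"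
    by (rule quadratic_form_split[OF D(1) vV])
  have "?\<rho> * (\<Sum>u\<in>?V. (x u)\<^sup>2) \<le> (\<Sum>u\<in>?V. x u * (\<Sum>w\<in>nb G u. x w))"
  proof -
    have "?\<rho> * (\<Sum>u\<in>?V. (x u)\<^sup>2) = (\<Sum>u\<in>?V. x u * (?\<rho> * x u))"
      by (simp add: sum_distrib_left power2_eq_square algebra_simps)
    also have "\<dots> \<le> (\<Sum>u\<in>?V. x u * (\<Sum>w\<in>nb G u. x w))"
      using x sub by (intro sum_mono mult_left_mono) auto
    finally show ?thesis .
  qed
  moreover have "2 * x v * (\<Sum>w\<in>nb G v. x w) + ?\<rho> * (z\<^sup>2 - (x v)\<^sup>2) < 2 * z * ?S"
  proof (cases "x v = 0")
    case True
    have "?\<rho> * z = ?S" using True rho by (simp add: z_def)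
    then have "?\<rho> * z\<^sup>2 = z * ?S" by (simp add: power2_eq_square mult.left_commute)
    then show ?thesis using True z0 pos by (simp add: mult_pos_pos)
  next
    case False
    then have "z = x v" "0 < x v" using z0 by (auto simp: z_def)
    then show ?thesis using light by simp
  qed
  ultimately have "?\<rho> * (\<Sum>u\<in>?V. (y u)\<^sup>2) < (\<Sum>u\<in>?V. y u * (\<Sum>w\<in>nb G' u. y w))"
    unfolding ySq q' using q by (simp add: algebra_simps)
  moreover have "0 < (\<Sum>u\<in>?V. (y u)\<^sup>2)"
    using z0 by (intro sum_pos2[OF fV vV]) (auto simp: y_def)
  ultimately have "?\<rho> < graph_spectral_radius G'"
    using spectral_radius_gt_Rayleigh[OF G', of y ?\<rho>] unfolding V' by simp
  then show False using le by simp
qed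

text \<open>\<open>large_vertices\<close> leaves an exceptional set of vertices outside
  \<open>L\<close> and not joined to all of \<open>L\<close>. A lightest member of it has a
  neighbourhood lighter than \<open>L\<close>, which maximality forbids, so the set is
  empty.\<close>

lemma spectral_extremal_structure:
  fixes \<delta> C :: real
  assumes d: "0 < \<delta>" "4 * (real s + 1) * \<delta> \<le> 1" "3 * real c * ((4 * real s + 4) * \<delta>) < 1 / 2"
  shows "\<exists>N. \<forall>n\<ge>N. \<forall>H G. hyp C n H \<longrightarrow> G \<in> extremal_sp n \<F> \<longrightarrow>
    (\<exists>x L. (\<forall>v. 0 \<le> x v) \<and> (\<forall>v\<in>pverts G. x v \<le> 1)
      \<and> (\<forall>v\<in>pverts G. graph_spectral_radius G * x v \<le> (\<Sum>w\<in>nb G v. x w))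
      \<and> L \<subseteq> pverts G \<and> card L = s \<and> (\<forall>w\<in>L. 1 - \<delta> \<le> x w) \<and> (\<forall>v\<in>pverts G - L. L \<subseteq> nb G v)
      \<and> 0 \<le> graph_spectral_radius G \<and> real s * (real n - real s) \<le> (graph_spectral_radius G)\<^sup>2)"
proof -
  obtain N1 where N1: "\<And>n H. n \<ge> N1 \<Longrightarrow> hyp C n H \<Longrightarrow> \<exists>F\<in>\<F>. forest F"
    using hyp_imp_forest by blast
  define R where "R = 128 * real c ^ 3 / (\<delta> / (4 * real c))\<^sup>2"
  define M where "M = nat \<lfloor>64 * real c ^ 3 / \<delta>\<rfloor>"
  define B where "B = 4 * (real s * real s + real (2 ^ M * c * M) + real s + real c)"
  \<comment> \<open>The term in \<open>R\<close> yields \<rho> \<ge> R through \<rho>^2 \<ge> n/2,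
    and B/\<delta> yields the last hypothesis of \<open>large_vertices\<close>.\<close>
  define N where "N = N1 + 4 * s + 2 * c + 3 + nat \<lceil>2 * R\<^sup>2\<rceil> + nat \<lceil>B / \<delta>\<rceil>"
  have "\<exists>x L. (\<forall>v. 0 \<le> x v) \<and> (\<forall>v\<in>pverts G. x v \<le> 1)
      \<and> (\<forall>v\<in>pverts G. graph_spectral_radius G * x v \<le> (\<Sum>w\<in>nb G v. x w))
      \<and> L \<subseteq> pverts G \<and> card L = s \<and> (\<forall>w\<in>L. 1 - \<delta> \<le> x w) \<and> (\<forall>v\<in>pverts G - L. L \<subseteq> nb G v)
      \<and> 0 \<le> graph_spectral_radius G \<and> real s * (real n - real s) \<le> (graph_spectral_radius G)\<^sup>2"
    if nN: "n \<ge> N" and H: "hyp C n H" and Gx: "G \<in> extremal_sp n \<F>" for n H G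
  proof -
    let ?V = "pverts G" and ?\<rho> = "graph_spectral_radius G"
    note D = extremal_spD[OF Gx]
    have n: "n \<ge> N1" "4 * s \<le> n" "0 < n" "2 * c + 3 \<le> n" "2 * s \<le> n" using nN by (auto simp: N_def)
    have nR: "2 * R\<^sup>2 \<le> real n" using nN unfolding N_def by linarith
    have "B / \<delta> \<le> real n" using nN unfolding N_def by linarith
    then have nB: "B \<le> \<delta> * real n" using d(1) by (simp add: pos_divide_le_eq mult.commute)
    obtain T where T: "T \<in> extremal s (\<H> \<F>)" using ex_extremal_\<H> by auto
    note TD = extremalD[OF T]
    have HD: "pair_graph H" "card (pverts H) = n - s" "T \<^bold>\<or> H \<in> extremal n \<F>"
      using H T by (auto simp: hyp_def)
    have "T \<^bold>\<or> H \<in> free_graphs n \<F>" using extremalD[OF HD(3)] by (auto simp: free_graphs_def)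
    then have "graph_spectral_radius (T \<^bold>\<or> H) \<le> ?\<rho>" by (rule D(4))
    moreover have "sqrt (real s * real (n - s)) \<le> graph_spectral_radius (T \<^bold>\<or> H)"
      using n s by (intro join_spectral_radius_ge TD HD) auto
    ultimately have sq: "sqrt (real s * real (n - s)) \<le> ?\<rho>" by linarith
    have rho0: "0 \<le> ?\<rho>" using order_trans[OF real_sqrt_ge_zero sq] by simp
    have "(sqrt (real s * real (n - s)))\<^sup>2 \<le> ?\<rho>\<^sup>2" by (rule power_mono[OF sq]) simp
    then have rho2: "real s * (real n - real s) \<le> ?\<rho>\<^sup>2" using n by (simp add: of_nat_diff)
    have fV: "finite ?V" by (rule pair_graphD[OF D(1)])
    have neV: "?V \<noteq> {}" using D(2) n(3) by auto
    obtain x' where x': "\<And>v. 0 \<le> x' v" "\<exists>v\<in>?V. x' v \<noteq> 0"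
      "\<And>v. v \<in> ?V \<Longrightarrow> ?\<rho> * x' v \<le> (\<Sum>w\<in>nb G v. x' w)"
      using ex_subeigenvector[OF D(1) neV] by auto
    define m where "m = Max (x' ` ?V)"
    have mx: "x' v \<le> m" if "v \<in> ?V" for v using that fV by (simp add: m_def)
    have "m \<in> x' ` ?V" unfolding m_def using fV neV by (intro Max_in) auto
    then obtain t where t: "t \<in> ?V" "x' t = m" by auto
    have m0: "0 < m" using x'(1,2) mx by (metis less_eq_real_def order_trans order_antisym)
    define x where "x v = x' v / m" for v
    have subx: "?\<rho> * x v \<le> (\<Sum>w\<in>nb G v. x w)" if "v \<in> ?V" for v
      using divide_right_mono[OF x'(3)[OF that], of m] m0 by (simp add: x_def sum_divide_distrib)
    obtain F where F: "F \<in> \<F>" "forest F" using N1[OF n(1) H] by blast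
    interpret E: subeigenvector G n s c x ?\<rho> t
    proof (rule subeigenvector.intro)
      show "pair_graph G" "card ?V = n" "1 \<le> s" "1 \<le> c" "0 \<le> ?\<rho>" "real s * (real n - real s) \<le> ?\<rho>\<^sup>2"
        "t \<in> ?V" using D s c rho0 rho2 t by auto
      show "0 \<le> x v" for v using x'(1) m0 by (simp add: x_def)
      show "x v \<le> 1" if "v \<in> ?V" for v using mx[OF that] m0 by (simp add: x_def)
      show "x t = 1" using t m0 by (simp add: x_def)
      show "?\<rho> * x v \<le> (\<Sum>w\<in>nb G v. x w)" if "v \<in> ?V" for v by (rule subx[OF that])
      show "(\<Sum>v\<in>U. card (nb G v \<inter> U)) \<le> 2 * c * card U" if "U \<subseteq> ?V" for U
        by (rule forest_free_sparse[OF D(1) fam[OF F(1)] F(2) fam_card[OF F(1)] _ that])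
          (use D(3) F(1) in \<open>auto simp: free_of_def\<close>)
      show "\<exists>a\<in>A. \<exists>b\<in>B. b \<notin> nb G a" if "A \<subseteq> ?V" "B \<subseteq> ?V" "card A = s + 1" "card B = c" "A \<inter> B = {}" for A B
        by (rule free_no_complete_bipartite[OF D(1,3) that])
    qed
    have R0: "0 < R" using d(1) c by (simp add: R_def)
    have rho_R: "R \<le> ?\<rho>"
    proof (rule power2_le_imp_le[OF _ rho0])
      have "1 * (real n / 2) \<le> real s * (real n - real s)" using s n by (intro mult_mono) auto
      then show "R\<^sup>2 \<le> ?\<rho>\<^sup>2" using nR rho2 by linarith
    qed
    obtain L where L: "L \<subseteq> ?V" "card L = s" "\<And>w. w \<in> L \<Longrightarrow> 1 - \<delta> \<le> x w"
      and small: "\<And>v. v \<in> ?V - L \<Longrightarrow> x v \<le> (4 * real s + 4) * \<delta>"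
      and few: "\<And>v. v \<in> ?V - L \<Longrightarrow> card (nb G v \<inter> {v \<in> ?V. L \<subseteq> nb G v}) < c"
      and half: "real (card (?V - {v \<in> ?V. L \<subseteq> nb G v})) \<le> real n / 2"
      using E.large_vertices[OF d(1,2) n(2,3)] rho_R nB unfolding R_def B_def M_def by auto
    let ?W = "{v \<in> ?V. L \<subseteq> nb G v}"
    have d1: "\<delta> \<le> 1 / 4"
    proof -
      have "4 * \<delta> \<le> 4 * (real s + 1) * \<delta>" using d(1) by (intro mult_right_mono) auto
      then show ?thesis using d(2) by linarith
    qed
    have cardW: "c < card ?W"
    proof -
      have "card (?V - ?W) = n - card ?W" using fV D(2) by (subst card_Diff_subset) auto
      then show ?thesis using half n(4) by linarith
    qed
    \<comment> \<open>The chosen \<open>v\<close> misses some vertex of \<open>L\<close>, losing at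
      least 1 - \<delta> \<ge> 3/4, and gains less than 1/2 outside \<open>L\<close>; this
      contradicts \<open>neighbourhood_weight_ge\<close>.\<close>
    have "?V - (L \<union> ?W) = {}"
    proof (rule ccontr)
      assume ne: "?V - (L \<union> ?W) \<noteq> {}"
      have fL: "finite L" using L(1) fV by (rule finite_subset)
      obtain v where v: "v \<in> ?V - (L \<union> ?W)"
        and vs: "(\<Sum>w\<in>nb G v - L. x w) \<le> 3 * real c * ((4 * real s + 4) * \<delta>)"
        using E.ex_light_exceptional_vertex[OF L(1) small _ less_imp_le[OF few] ne] d(1) by auto
      obtain w where w: "w \<in> L" "w \<notin> nb G v" using v by auto
      have "(\<Sum>w\<in>nb G v. x w) = (\<Sum>w\<in>nb G v \<inter> L. x w) + (\<Sum>w\<in>nb G v - L. x w)"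
        by (rule sum.Int_Diff[OF E.fN])
      also have "(\<Sum>w\<in>nb G v \<inter> L. x w) \<le> (\<Sum>w\<in>L - {w}. x w)"
        using fL w x'(1) m0 by (intro sum_mono2) (auto simp: x_def)
      also have "(\<Sum>w\<in>L - {w}. x w) = (\<Sum>w\<in>L. x w) - x w" using fL w by (simp add: sum_diff1)
      finally have light: "(\<Sum>w\<in>nb G v. x w) < (\<Sum>w\<in>L. x w)"
        using vs L(3)[OF w(1)] d(3) d1 by linarith
      have "0 < (\<Sum>w\<in>L. x w)"
        using light sum_nonneg[of "nb G v" x] x'(1) m0 by (simp add: x_def order.strict_trans1)
      then have "(\<Sum>w\<in>L. x w) \<le> (\<Sum>w\<in>nb G v. x w)"
        using R0 rho_R v x'(1) m0
        by (intro neighbourhood_weight_ge[OF Gx _ subx _ L(1) _ _ cardW]) (auto simp: x_def)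
      then show False using light by simp
    qed
    then have "\<forall>v\<in>?V - L. L \<subseteq> nb G v" by auto
    moreover have "\<forall>v. 0 \<le> x v" "\<forall>v\<in>?V. x v \<le> 1" using x'(1) m0 mx by (auto simp: x_def)
    ultimately show ?thesis using L rho0 rho2 subx by (intro exI[of _ x] exI[of _ L]) auto
  qed
  then show ?thesis by blast
qed

end

section \<open>Joins with the core\<close>


text \<open>The test vector is a on T and z on H. The inequality on H already secures a Rayleigh
  contribution of at least \<rho> there, so only the strict inequality summed over T has to be
  checked.\<close>

lemma join_spectral_radius_gt:
  fixes a z :: "nat \<Rightarrow> real"
  assumes T: "pair_graph T" and H: "pair_graph H"
    and z0: "\<And>v. v \<in> pverts H \<Longrightarrow> 0 \<le> z v"
    and z: "\<And>v. v \<in> pverts H \<Longrightarrow> \<rho> * z v \<le> (\<Sum>u\<in>pverts T. a u) + (\<Sum>w\<in>nb H v. z w)"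
    and a0: "0 < (\<Sum>u\<in>pverts T. (a u)\<^sup>2)"
    and a: "\<rho> * (\<Sum>u\<in>pverts T. (a u)\<^sup>2)
      < (\<Sum>u\<in>pverts T. a u * ((\<Sum>w\<in>nb T u. a w) + (\<Sum>v\<in>pverts H. z v)))"
  shows "\<rho> < graph_spectral_radius (T \<^bold>\<or> H)"
proof -
  let ?J = "T \<^bold>\<or> H"
  note fin = pair_graphD(1)[OF T] pair_graphD(1)[OF H] nb_graph(1)[OF T] nb_graph(1)[OF H]
  define y where "y v = (case sum_decode v of Inl u \<Rightarrow> a u | Inr u \<Rightarrow> z u)" for v
  have y: "y (inl u) = a u" "y (inr u) = z u" for u by (simp_all add: y_def)
  have sq: "(\<Sum>v\<in>pverts ?J. (y v)\<^sup>2) = (\<Sum>u\<in>pverts T. (a u)\<^sup>2) + (\<Sum>v\<in>pverts H. (z v)\<^sup>2)"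
    unfolding pverts_join sum_join[OF fin(1,2)] by (simp add: y)
  have 1: "(\<Sum>w\<in>nb ?J (inl u). y w) = (\<Sum>w\<in>nb T u. a w) + (\<Sum>v\<in>pverts H. z v)" if "u \<in> pverts T" for u
    unfolding nb_join(1)[OF that] sum_join[OF fin(3,2)] by (simp add: y)
  have 2: "(\<Sum>w\<in>nb ?J (inr v). y w) = (\<Sum>u\<in>pverts T. a u) + (\<Sum>w\<in>nb H v. z w)" if "v \<in> pverts H" for v
    unfolding nb_join(2)[OF that] sum_join[OF fin(1,4)] by (simp add: y)
  have q: "(\<Sum>v\<in>pverts ?J. y v * (\<Sum>w\<in>nb ?J v. y w))
      = (\<Sum>u\<in>pverts T. a u * ((\<Sum>w\<in>nb T u. a w) + (\<Sum>v\<in>pverts H. z v)))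
        + (\<Sum>v\<in>pverts H. z v * ((\<Sum>u\<in>pverts T. a u) + (\<Sum>w\<in>nb H v. z w)))"
    unfolding pverts_join sum_join[OF fin(1,2)] using 1 2 by (simp add: y)
  have "\<rho> * (\<Sum>v\<in>pverts H. (z v)\<^sup>2) = (\<Sum>v\<in>pverts H. z v * (\<rho> * z v))"
    by (simp add: sum_distrib_left power2_eq_square algebra_simps)
  also have "\<dots> \<le> (\<Sum>v\<in>pverts H. z v * ((\<Sum>u\<in>pverts T. a u) + (\<Sum>w\<in>nb H v. z w)))"
    by (intro sum_mono mult_left_mono z z0)
  finally have "\<rho> * (\<Sum>v\<in>pverts ?J. (y v)\<^sup>2) < (\<Sum>v\<in>pverts ?J. y v * (\<Sum>w\<in>nb ?J v. y w))"
    unfolding sq q distrib_left using a by (simp add: distrib_left)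
  moreover have "0 < (\<Sum>v\<in>pverts ?J. (y v)\<^sup>2)"
    unfolding sq using a0 by (intro add_pos_nonneg) (auto intro: sum_nonneg)
  ultimately show ?thesis by (intro spectral_radius_gt_Rayleigh[OF pair_graph_join[OF T H]])
qed

text \<open>The situation after the core is found: G is the join of \<open>T\<close> = G[L] and
  \<open>R\<close> = G - L up to isomorphism, and x and \<rho> enter only through
  inequalities.\<close>

locale joined =
  fixes G :: ngraph and n s c :: nat and x :: "nat \<Rightarrow> real" and \<rho> :: real and L :: "nat set" and \<delta> :: real
  assumes G: "pair_graph G" and n: "card (pverts G) = n" and s: "1 \<le> s"
    and L: "L \<subseteq> pverts G" "card L = s" and join: "\<And>v. v \<in> pverts G - L \<Longrightarrow> L \<subseteq> nb G v"
    and x: "\<And>v. 0 \<le> x v" "\<And>v. v \<in> pverts G \<Longrightarrow> x v \<le> 1" "\<And>w. w \<in> L \<Longrightarrow> 1 - \<delta> \<le> x w"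
    and sub: "\<And>v. v \<in> pverts G \<Longrightarrow> \<rho> * x v \<le> (\<Sum>w\<in>nb G v. x w)"
    and deg: "\<And>v. v \<in> pverts G - L \<Longrightarrow> card (nb G v - L) \<le> c"
    and delta: "0 < \<delta>" "\<delta> < 1"
begin

definition "T = induced G L"
definition "R = induced G (pverts G - L)"
definition "\<sigma> = (\<Sum>w\<in>L. x w)"

lemma T: "pair_graph T" "pverts T = L" and R: "pair_graph R" "pverts R = pverts G - L"
  using pair_graph_induced[OF G] L(1) by (auto simp: T_def R_def induced_def)

lemma fin: "finite (pverts G)" "finite L"
  using pair_graphD(1)[OF G] L(1) finite_subset by blast+

lemma card_R: "card (pverts R) = n - s" and s_le_n: "s \<le> n"
  using L n fin card_mono[OF fin(1) L(1)] by (auto simp: R card_Diff_subset)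

lemma nb_T: "w \<in> L \<Longrightarrow> nb T w = nb G w \<inter> L" by (simp add: T_def nb_induced)

lemma nb_R: "v \<in> pverts R \<Longrightarrow> nb R v = nb G v - L"
  using nb_graph(2)[OF G, of v] unfolding R(2) by (auto simp: R_def nb_induced)

lemma nb_L: "w \<in> L \<Longrightarrow> nb G w = nb T w \<union> pverts R" "w \<in> L \<Longrightarrow> nb T w \<inter> pverts R = {}"
proof -
  assume w: "w \<in> L"
  have "v \<in> nb G w" if "v \<in> pverts G - L" for v
    using join[OF that] w nb_graph(4)[OF G, of v w] by blast
  then show "nb G w = nb T w \<union> pverts R" "nb T w \<inter> pverts R = {}"
    using w nb_graph(2)[OF G, of w] by (auto simp: nb_T R(2))
qed

lemma nb_not_L: "v \<in> pverts R \<Longrightarrow> nb G v = L \<union> nb R v" "v \<in> pverts R \<Longrightarrow> L \<inter> nb R v = {}"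
  using join[of v] by (auto simp: nb_R R)

lemma card_nb_R: "card (nb R v) \<le> c"
proof (cases "v \<in> pverts R")
  case True
  then show ?thesis using deg[of v] by (simp add: nb_R R(2))
next
  case False
  then show ?thesis using nb_graph(5)[OF R(1)] by simp
qed

lemma sub_R: "v \<in> pverts R \<Longrightarrow> \<rho> * x v \<le> \<sigma> + (\<Sum>w\<in>nb R v. x w)"
  using sub[of v] fin(2) nb_graph(1)[OF R(1), of v] R(2)
  by (simp add: nb_not_L sum.union_disjoint \<sigma>_def)

lemma sub_L: "w \<in> L \<Longrightarrow> \<rho> * x w \<le> (\<Sum>u\<in>nb T w. x u) + (\<Sum>v\<in>pverts R. x v)"
  using sub[of w] L(1) nb_graph(1)[OF T(1), of w] pair_graphD(1)[OF R(1)]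
  by (auto simp: nb_L sum.union_disjoint)

lemma sigma: "real s * (1 - \<delta>) \<le> \<sigma>" "\<sigma> \<le> real s" "0 < \<sigma>"
proof -
  have "(\<Sum>w\<in>L. 1 - \<delta>) \<le> \<sigma>" unfolding \<sigma>_def by (rule sum_mono) (rule x(3))
  then show 1: "real s * (1 - \<delta>) \<le> \<sigma>" using L(2) by simp
  have "\<sigma> \<le> (\<Sum>w\<in>L. 1)" unfolding \<sigma>_def by (rule sum_mono) (use x(2) L(1) in blast)
  then show "\<sigma> \<le> real s" using L(2) by simp
  have "0 < real s * (1 - \<delta>)" using s delta by simp
  then show "0 < \<sigma>" using 1 by linarith
qed

lemma num_edges_G: "num_edges G = num_edges T + num_edges R + s * (n - s)"
proof -
  have V: "pverts G = L \<union> pverts R" "L \<inter> pverts R = {}" using L(1) R(2) by auto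
  have fR: "finite (pverts R)" by (rule pair_graphD[OF R(1)])
  have "2 * num_edges G = (\<Sum>w\<in>L. card (nb G w)) + (\<Sum>v\<in>pverts R. card (nb G v))"
    unfolding sum_degrees[OF G, symmetric] V(1) by (rule sum.union_disjoint[OF fin(2) fR V(2)])
  also have "(\<Sum>w\<in>L. card (nb G w)) = (\<Sum>w\<in>L. card (nb T w) + (n - s))"
    using nb_graph(1)[OF T(1)] fR
    by (intro sum.cong) (simp_all add: nb_L card_Un_disjoint card_R[symmetric])
  also have "(\<Sum>v\<in>pverts R. card (nb G v)) = (\<Sum>v\<in>pverts R. s + card (nb R v))"
    using nb_graph(1)[OF R(1)] fin(2)
    by (intro sum.cong) (simp_all add: nb_not_L card_Un_disjoint L(2))
  finally have "2 * num_edges G = 2 * (num_edges T + num_edges R + s * (n - s))"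
    using sum_degrees[OF T(1)] sum_degrees[OF R(1)]
    by (simp add: sum.distrib T(2) L(2) card_R)
  then show ?thesis by simp
qed

lemma contains_join: "contains G (T \<^bold>\<or> R)"
proof (rule containsI[where f = "\<lambda>v. case sum_decode v of Inl u \<Rightarrow> u | Inr u \<Rightarrow> u"])
  show "inj_on (\<lambda>v. case sum_decode v of Inl u \<Rightarrow> u | Inr u \<Rightarrow> u) (pverts (T \<^bold>\<or> R))"
    by (auto simp: inj_on_def pverts_join T(2) R(2))
  have arc: "(u, v) \<in> parcs G" "(v, u) \<in> parcs G" if "u \<in> L" "v \<in> pverts G - L" for u v
    using join[of v] that pair_graphD(3)[OF G] by (auto simp: nb_def)
  show "(case sum_decode u of Inl u \<Rightarrow> u | Inr u \<Rightarrow> u, case sum_decode v of Inl u \<Rightarrow> u | Inr u \<Rightarrow> u) \<in> parcs G"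
    if "(u, v) \<in> parcs (T \<^bold>\<or> R)" for u v
    using that arc by (auto simp: graph_join_eq T(2) R(2)) (auto simp: T_def R_def induced_def)
qed (use L(1) in \<open>auto simp: pverts_join T(2) R(2)\<close>)

text \<open>At a vertex of \<open>R\<close> with the largest entry m, the inequality reads \<rho> m
  \<le> \<sigma> + c m.\<close>

lemma x_R_le:
  assumes "real c < \<rho>" and "v \<in> pverts R"
  shows "x v \<le> \<sigma> / (\<rho> - real c)"
proof -
  let ?m = "Max (x ` pverts R)"
  have fR: "finite (pverts R)" by (rule pair_graphD[OF R(1)])
  have "?m \<in> x ` pverts R" using fR assms(2) by (intro Max_in) auto
  then obtain u where u: "u \<in> pverts R" "x u = ?m" by auto
  have le: "x w \<le> x u" if "w \<in> pverts R" for w using that fR u by simp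
  have "\<rho> * x u \<le> \<sigma> + (\<Sum>w\<in>nb R u. x w)" by (rule sub_R[OF u(1)])
  also have "(\<Sum>w\<in>nb R u. x w) \<le> (\<Sum>w\<in>nb R u. x u)"
    using nb_graph(2)[OF R(1)] by (intro sum_mono le) auto
  also have "\<dots> = real (card (nb R u)) * x u" by simp
  also have "\<dots> \<le> real c * x u" using card_nb_R x(1) by (intro mult_right_mono) auto
  finally have "x u * (\<rho> - real c) \<le> \<sigma>" by (simp add: algebra_simps)
  then have "x u \<le> \<sigma> / (\<rho> - real c)" using assms(1) by (simp add: pos_le_divide_eq)
  then show ?thesis using le[OF assms(2)] by linarith
qed

text \<open>Sum the inequalities over \<open>R\<close>, insert the result into those summed over
  \<open>L\<close>, and divide by \<sigma>. The leading term s(n - s) has order \<rho>^2 and the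
  other two have order at most \<rho>.\<close>

lemma rho_square_le:
  assumes "real c < \<rho>"
  shows "\<rho>\<^sup>2 \<le> 2 * \<rho> * real (num_edges T) / \<sigma> + real s * real (n - s) + 2 * real s * real (num_edges R) / (\<rho> - real c)"
proof -
  let ?S = "\<Sum>v\<in>pverts R. x v"
  have rho0: "0 < \<rho>" using assms by linarith
  have "\<rho> * ?S = (\<Sum>v\<in>pverts R. \<rho> * x v)" by (rule sum_distrib_left)
  also have "\<dots> \<le> (\<Sum>v\<in>pverts R. \<sigma> + (\<Sum>w\<in>nb R v. x w))" by (rule sum_mono) (rule sub_R)
  also have "\<dots> \<le> (\<Sum>v\<in>pverts R. \<sigma> + (\<Sum>w\<in>nb R v. \<sigma> / (\<rho> - real c)))"
    using nb_graph(2)[OF R(1)] by (intro sum_mono add_left_mono x_R_le assms) auto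
  also have "\<dots> = real (n - s) * \<sigma> + real (\<Sum>v\<in>pverts R. card (nb R v)) * (\<sigma> / (\<rho> - real c))"
    by (simp add: sum.distrib card_R sum_distrib_right sum_divide_distrib)
  also have "\<dots> = \<sigma> * (real (n - s) + 2 * real (num_edges R) / (\<rho> - real c))"
    unfolding sum_degrees[OF R(1)] by (simp add: algebra_simps)
  finally have S: "\<rho> * ?S \<le> \<sigma> * (real (n - s) + 2 * real (num_edges R) / (\<rho> - real c))" .
  have "\<rho> * \<sigma> = (\<Sum>w\<in>L. \<rho> * x w)" unfolding \<sigma>_def by (rule sum_distrib_left)
  also have "\<dots> \<le> (\<Sum>w\<in>L. (\<Sum>u\<in>nb T w. x u) + ?S)" by (rule sum_mono) (rule sub_L)
  also have "\<dots> \<le> (\<Sum>w\<in>L. (\<Sum>u\<in>nb T w. 1) + ?S)"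
    using nb_graph(2)[OF T(1)] T(2) L(1) by (intro sum_mono add_right_mono x(2)) auto
  also have "\<dots> = real (\<Sum>w\<in>pverts T. card (nb T w)) + real s * ?S"
    by (simp add: sum.distrib L(2) T(2))
  also have "\<dots> = 2 * real (num_edges T) + real s * ?S" unfolding sum_degrees[OF T(1)] by simp
  finally have "\<rho> * (\<rho> * \<sigma>) \<le> \<rho> * (2 * real (num_edges T) + real s * ?S)"
    using rho0 by (intro mult_left_mono) auto
  also have "\<dots> = 2 * \<rho> * real (num_edges T) + real s * (\<rho> * ?S)" by (simp add: algebra_simps)
  also have "\<dots> \<le> 2 * \<rho> * real (num_edges T)
      + real s * (\<sigma> * (real (n - s) + 2 * real (num_edges R) / (\<rho> - real c)))"
    using S by (intro add_left_mono mult_left_mono) auto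
  finally have "\<rho>\<^sup>2 * \<sigma> \<le> (2 * \<rho> * real (num_edges T) / \<sigma> + real s * real (n - s)
      + 2 * real s * real (num_edges R) / (\<rho> - real c)) * \<sigma>"
    using sigma(3) by (simp add: power2_eq_square algebra_simps)
  then show ?thesis using sigma(3) by simp
qed

text \<open>One edge missing in the core costs 2 \<rho>/s in the bound for \<rho>^2. Replacing
  \<sigma> by s gives back at most half of this by \<open>d\<close>, and exchanging e(R) for e(H)
  costs only O(1), since e(R) \<le> e(H) + s^2. So T0 joined with H wins by order \<rho>.\<close>

lemma fewer_core_edges_imp_not_maximal:
  fixes C :: real
  assumes T0: "pair_graph T0" "card (pverts T0) = s" and H: "pair_graph H" "card (pverts H) = n - s"
    and less: "num_edges T < num_edges T0" and total: "num_edges G \<le> num_edges T0 + num_edges H + s * (n - s)"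
    and t0: "num_edges T0 \<le> s * s" and d: "\<delta> * real (s * s) \<le> 1 / 2"
    and H_le: "real (num_edges H) \<le> real n + C" and n_le: "real n \<le> 2 * \<rho>\<^sup>2" and c1: "1 \<le> c"
    and rho: "2 * real c \<le> \<rho>" "2 * real s ^ 2 * (2 * real s ^ 2 + 4 * real c + 2 * real c * \<bar>C\<bar>) < \<rho>"
  shows "\<rho> < graph_spectral_radius (T0 \<^bold>\<or> H)"
proof -
  have rs: "1 \<le> real s" and rc: "1 \<le> real c" using s c1 by simp_all
  have rho1: "1 \<le> \<rho>" "real c < \<rho>" "0 < \<rho>" using rho(1) rc by linarith+
  let ?m = "real (n - s)" and ?eH = "real (num_edges H)" and ?t0 = "real (num_edges T0)"
  \<comment> \<open>The first two terms of the series for s (\<rho> - A)^-1 1 on H; truncation makes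
    it a subsolution.\<close>
  define z where "z v = real s / \<rho> + real s * real (card (nb H v)) / \<rho>\<^sup>2" for v
  have z0: "0 \<le> z v" for v using rho1 by (simp add: z_def)
  have zge: "real s / \<rho> \<le> z v" for v using rho1 by (simp add: z_def)
  have zsum: "(\<Sum>v\<in>pverts H. z v) = real s * ?m / \<rho> + 2 * real s * ?eH / \<rho>\<^sup>2"
  proof -
    have "(\<Sum>v\<in>pverts H. z v) = real s * ?m / \<rho> + real s / \<rho>\<^sup>2 * real (\<Sum>v\<in>pverts H. card (nb H v))"
      by (simp add: z_def sum.distrib H(2) sum_distrib_left)
    then show ?thesis unfolding sum_degrees[OF H(1)] by simp
  qed
  have "\<rho>\<^sup>2 < 2 * \<rho> * ?t0 / real s + real s * ?m + 2 * real s * ?eH / \<rho>"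
  proof -
    have t1: "real (num_edges T) \<le> ?t0 - 1" using less by linarith
    have "2 * \<rho> * real (num_edges T) / \<sigma> \<le> 2 * \<rho> * (?t0 - 1) / (real s * (1 - \<delta>))"
      using t1 sigma rho1 rs delta by (intro frac_le mult_left_mono) auto
    also have "\<dots> \<le> 2 * \<rho> * (?t0 - 1 / 2) / real s"
    proof -
      have "\<delta> * ?t0 \<le> \<delta> * real (s * s)" using t0 delta by (intro mult_left_mono of_nat_mono) auto
      then have "\<delta> * ?t0 \<le> 1 / 2" using d by linarith
      moreover have "(?t0 - 1 / 2) * (1 - \<delta>) = ?t0 - 1 / 2 - \<delta> * ?t0 + \<delta> / 2" by (simp add: field_simps)
      ultimately have "?t0 - 1 \<le> (?t0 - 1 / 2) * (1 - \<delta>)" using delta by linarith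
      then have "(?t0 - 1) / (1 - \<delta>) \<le> ?t0 - 1 / 2" using delta by (simp add: pos_divide_le_eq)
      then have "2 * \<rho> / real s * ((?t0 - 1) / (1 - \<delta>)) \<le> 2 * \<rho> / real s * (?t0 - 1 / 2)"
        using rho1 by (intro mult_left_mono) auto
      then show ?thesis by simp
    qed
    also have "\<dots> = 2 * \<rho> * ?t0 / real s - \<rho> / real s" using rs by (simp add: field_simps)
    finally have 1: "2 * \<rho> * real (num_edges T) / \<sigma> \<le> 2 * \<rho> * ?t0 / real s - \<rho> / real s" .
    have "num_edges R \<le> num_edges H + s * s" using total t0 unfolding num_edges_G by linarith
    then have "real (num_edges R) \<le> real (num_edges H + s * s)" by (rule of_nat_mono)
    then have eR: "real (num_edges R) \<le> ?eH + real s ^ 2" by (simp add: power2_eq_square)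
    have "2 * real s * real (num_edges R) / (\<rho> - real c) \<le> 2 * real s * (?eH + real s ^ 2) / (\<rho> - real c)"
      using eR rho1 by (intro divide_right_mono mult_left_mono) auto
    also have "\<dots> = 2 * real s * ?eH / \<rho> + 2 * real s * ((real s ^ 2 * \<rho> + real c * ?eH) / (\<rho> * (\<rho> - real c)))"
      using rho1 by (simp add: field_simps)
    also have "(real s ^ 2 * \<rho> + real c * ?eH) / (\<rho> * (\<rho> - real c)) \<le> 2 * real s ^ 2 + 4 * real c + 2 * real c * \<bar>C\<bar>"
    proof -
      have "\<rho> * (\<rho> / 2) \<le> \<rho> * (\<rho> - real c)" using rho(1) rho1 by (intro mult_left_mono) auto
      then have half: "\<rho>\<^sup>2 / 2 \<le> \<rho> * (\<rho> - real c)" by (simp add: power2_eq_square)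
      have r12: "\<rho> \<le> \<rho>\<^sup>2" "1 \<le> \<rho>\<^sup>2" using rho1 by (auto simp: power2_eq_square mult_ge1_I)
      have "?eH \<le> 2 * \<rho>\<^sup>2 + \<bar>C\<bar> * \<rho>\<^sup>2"
      proof -
        have "\<bar>C\<bar> * 1 \<le> \<bar>C\<bar> * \<rho>\<^sup>2" using r12 by (intro mult_left_mono) auto
        then show ?thesis using H_le n_le by linarith
      qed
      then have "real s ^ 2 * \<rho> + real c * ?eH \<le> real s ^ 2 * \<rho>\<^sup>2 + real c * (2 * \<rho>\<^sup>2 + \<bar>C\<bar> * \<rho>\<^sup>2)"
        using r12 by (intro add_mono mult_left_mono) auto
      \<comment> \<open>The factor 1/2 is absorbed because \<rho> - c \<ge> \<rho>/2 by the first
        bound in \<open>rho\<close>.\<close>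
      also have "\<dots> = (2 * real s ^ 2 + 4 * real c + 2 * real c * \<bar>C\<bar>) * (\<rho>\<^sup>2 / 2)" by (simp add: algebra_simps)
      also have "\<dots> \<le> (2 * real s ^ 2 + 4 * real c + 2 * real c * \<bar>C\<bar>) * (\<rho> * (\<rho> - real c))"
        using half by (intro mult_left_mono) auto
      finally show ?thesis using rho1 by (simp add: pos_divide_le_eq)
    qed
    finally have 2: "2 * real s * real (num_edges R) / (\<rho> - real c)
        \<le> 2 * real s * ?eH / \<rho> + 2 * real s * (2 * real s ^ 2 + 4 * real c + 2 * real c * \<bar>C\<bar>)"
      using rs by simp
    have "2 * real s * (2 * real s ^ 2 + 4 * real c + 2 * real c * \<bar>C\<bar>) * real s < \<rho>"
      using rho(2) by (simp add: power2_eq_square algebra_simps)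
    then have 3: "2 * real s * (2 * real s ^ 2 + 4 * real c + 2 * real c * \<bar>C\<bar>) < \<rho> / real s"
      using rs by (simp add: pos_less_divide_eq)
    show ?thesis using rho_square_le[OF rho1(2)] 1 2 3 by linarith
  qed
  then have main: "\<rho> * real s < 2 * ?t0 + real s * (\<Sum>v\<in>pverts H. z v)"
  proof -
    assume "\<rho>\<^sup>2 < 2 * \<rho> * ?t0 / real s + real s * ?m + 2 * real s * ?eH / \<rho>"
    then have "real s / \<rho> * \<rho>\<^sup>2 < real s / \<rho> * (2 * \<rho> * ?t0 / real s + real s * ?m + 2 * real s * ?eH / \<rho>)"
      using rs rho1 by (intro mult_strict_left_mono) auto
    also have "\<dots> = 2 * ?t0 + real s * (real s * ?m / \<rho> + 2 * real s * ?eH / \<rho>\<^sup>2)"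
      using rs rho1 by (simp add: field_simps power2_eq_square)
    finally show ?thesis unfolding zsum using rho1 by (simp add: power2_eq_square algebra_simps)
  qed
  show ?thesis
  proof (rule join_spectral_radius_gt[OF T0(1) H(1), where a = "\<lambda>_. 1" and z = z])
    show "\<rho> * z v \<le> (\<Sum>u\<in>pverts T0. 1) + (\<Sum>w\<in>nb H v. z w)" for v
    proof -
      have "\<rho> * z v = real s + (\<Sum>w\<in>nb H v. real s / \<rho>)"
        using rho1 by (simp add: z_def field_simps power2_eq_square)
      also have "\<dots> \<le> real s + (\<Sum>w\<in>nb H v. z w)" using zge by (intro add_left_mono sum_mono) auto
      finally show ?thesis using T0(2) by simp
    qed
    have "(\<Sum>u\<in>pverts T0. 1 * ((\<Sum>w\<in>nb T0 u. 1) + (\<Sum>v\<in>pverts H. z v)))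
        = real (\<Sum>u\<in>pverts T0. card (nb T0 u)) + real s * (\<Sum>v\<in>pverts H. z v)"
      by (simp add: sum.distrib T0(2))
    also have "\<dots> = 2 * ?t0 + real s * (\<Sum>v\<in>pverts H. z v)" unfolding sum_degrees[OF T0(1)] by simp
    finally show "\<rho> * (\<Sum>u\<in>pverts T0. 1\<^sup>2) < (\<Sum>u\<in>pverts T0. 1 * ((\<Sum>w\<in>nb T0 u. 1) + (\<Sum>v\<in>pverts H. z v)))"
      using main T0(2) by simp
  qed (use z0 T0(2) s in auto)
qed

section \<open>Comparing the remainders R and H through super- and subsolutions\<close>

text \<open>Duality: weight x with (\<rho> - A) \<phi> \<ge> 1, move \<rho> - A to x by symmetry,
  and use (\<rho> - A) x \<le> \<sigma> on \<open>R\<close>.\<close>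

lemma sum_le_supersolution:
  assumes phi: "\<And>v. v \<in> pverts R \<Longrightarrow> 0 \<le> \<phi> v"
    and super: "\<And>v. v \<in> pverts R \<Longrightarrow> 1 + (\<Sum>w\<in>nb R v. \<phi> w) \<le> \<rho> * \<phi> v"
  shows "(\<Sum>v\<in>pverts R. x v) \<le> \<sigma> * (\<Sum>v\<in>pverts R. \<phi> v)"
proof -
  have "(\<Sum>v\<in>pverts R. x v) \<le> (\<Sum>v\<in>pverts R. x v * (\<rho> * \<phi> v - (\<Sum>w\<in>nb R v. \<phi> w)))"
  proof (rule sum_mono)
    fix v assume "v \<in> pverts R"
    then have "x v * 1 \<le> x v * (\<rho> * \<phi> v - (\<Sum>w\<in>nb R v. \<phi> w))"
      using super[of v] x(1) by (intro mult_left_mono) auto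
    then show "x v \<le> x v * (\<rho> * \<phi> v - (\<Sum>w\<in>nb R v. \<phi> w))" by simp
  qed
  also have "\<dots> = (\<Sum>v\<in>pverts R. \<phi> v * (\<rho> * x v)) - (\<Sum>v\<in>pverts R. \<Sum>w\<in>nb R v. x v * \<phi> w)"
    by (simp add: right_diff_distrib sum_subtractf sum_distrib_left algebra_simps)
  also have "(\<Sum>v\<in>pverts R. \<Sum>w\<in>nb R v. x v * \<phi> w) = (\<Sum>w\<in>pverts R. \<Sum>v\<in>nb R w. x v * \<phi> w)"
    by (rule sum_sum_nb_swap[OF R(1)])
  also have "(\<Sum>v\<in>pverts R. \<phi> v * (\<rho> * x v)) - (\<Sum>w\<in>pverts R. \<Sum>v\<in>nb R w. x v * \<phi> w)
      = (\<Sum>v\<in>pverts R. \<phi> v * (\<rho> * x v - (\<Sum>w\<in>nb R v. x w)))"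
    by (simp add: right_diff_distrib sum_subtractf sum_distrib_left mult.commute)
  also have "\<dots> \<le> (\<Sum>v\<in>pverts R. \<phi> v * \<sigma>)"
  proof (intro sum_mono mult_left_mono phi)
    show "\<rho> * x v - (\<Sum>w\<in>nb R v. x w) \<le> \<sigma>" if "v \<in> pverts R" for v using sub_R[OF that] by linarith
  qed
  also have "\<dots> = \<sigma> * (\<Sum>v\<in>pverts R. \<phi> v)" by (simp add: sum_distrib_left mult.commute)
  finally show ?thesis .
qed

text \<open>Keep x on the core and put \<sigma> \<zeta> on H. By the supersolution bound, each core
  vertex then sees more total weight on H than it saw on \<open>R\<close>, which makes the Rayleigh
  quotient exceed \<rho>.\<close>

lemma subsolution_exceeds_imp_not_maximal:
  assumes H: "pair_graph H"
    and phi: "\<And>v. v \<in> pverts R \<Longrightarrow> 0 \<le> \<phi> v"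
    and super: "\<And>v. v \<in> pverts R \<Longrightarrow> 1 + (\<Sum>w\<in>nb R v. \<phi> w) \<le> \<rho> * \<phi> v"
    and zeta: "\<And>v. v \<in> pverts H \<Longrightarrow> 0 \<le> \<zeta> v"
    and subs: "\<And>v. v \<in> pverts H \<Longrightarrow> \<rho> * \<zeta> v \<le> 1 + (\<Sum>w\<in>nb H v. \<zeta> w)"
    and less: "(\<Sum>v\<in>pverts R. \<phi> v) < (\<Sum>v\<in>pverts H. \<zeta> v)"
  shows "\<rho> < graph_spectral_radius (T \<^bold>\<or> H)"
proof (rule join_spectral_radius_gt[OF T(1) H, where a = x and z = "\<lambda>v. \<sigma> * \<zeta> v"])
  show "0 \<le> \<sigma> * \<zeta> v" if "v \<in> pverts H" for v using sigma(3) zeta[OF that] by simp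
  show "\<rho> * (\<sigma> * \<zeta> v) \<le> (\<Sum>u\<in>pverts T. x u) + (\<Sum>w\<in>nb H v. \<sigma> * \<zeta> w)" if "v \<in> pverts H" for v
  proof -
    have "\<sigma> * (\<rho> * \<zeta> v) \<le> \<sigma> * (1 + (\<Sum>w\<in>nb H v. \<zeta> w))"
      using subs[OF that] sigma(3) by (intro mult_left_mono) auto
    also have "\<dots> = (\<Sum>u\<in>pverts T. x u) + (\<Sum>w\<in>nb H v. \<sigma> * \<zeta> w)"
      by (simp add: T(2) \<sigma>_def[symmetric] sum_distrib_left distrib_left)
    finally show ?thesis by (simp add: mult.left_commute)
  qed
  have xL: "0 < x w" if "w \<in> L" for w using x(3)[OF that] delta by linarith
  have neL: "L \<noteq> {}" using L(2) s by auto
  show "0 < (\<Sum>u\<in>pverts T. (x u)\<^sup>2)"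
    unfolding T(2) by (intro sum_pos fin(2) neL zero_less_power xL)
  have "\<rho> * (\<Sum>u\<in>L. (x u)\<^sup>2) = (\<Sum>u\<in>L. x u * (\<rho> * x u))"
    by (simp add: sum_distrib_left power2_eq_square algebra_simps)
  also have "\<dots> \<le> (\<Sum>u\<in>L. x u * ((\<Sum>w\<in>nb T u. x w) + (\<Sum>v\<in>pverts R. x v)))"
    by (intro sum_mono mult_left_mono sub_L x(1))
  also have "\<dots> < (\<Sum>u\<in>L. x u * ((\<Sum>w\<in>nb T u. x w) + (\<Sum>v\<in>pverts H. \<sigma> * \<zeta> v)))"
  proof (rule sum_strict_mono[OF fin(2) neL])
    fix u assume "u \<in> L"
    have "(\<Sum>v\<in>pverts R. x v) \<le> \<sigma> * (\<Sum>v\<in>pverts R. \<phi> v)"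
      by (rule sum_le_supersolution[OF phi super])
    also have "\<dots> < \<sigma> * (\<Sum>v\<in>pverts H. \<zeta> v)" using less sigma(3) by simp
    finally show "x u * ((\<Sum>w\<in>nb T u. x w) + (\<Sum>v\<in>pverts R. x v))
        < x u * ((\<Sum>w\<in>nb T u. x w) + (\<Sum>v\<in>pverts H. \<sigma> * \<zeta> v))"
      using xL[OF \<open>u \<in> L\<close>] by (simp add: sum_distrib_left[symmetric])
  qed
  finally show "\<rho> * (\<Sum>u\<in>pverts T. (x u)\<^sup>2)
      < (\<Sum>u\<in>pverts T. x u * ((\<Sum>w\<in>nb T u. x w) + (\<Sum>v\<in>pverts H. \<sigma> * \<zeta> v)))"
    unfolding T(2) .
qed

end

section \<open>Solutions on small components\<close>


text \<open>On the set \<open>A\<close> of solved components g is used unchanged; no edge leaves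
  \<open>A\<close>. The at most \<open>K\<close> other vertices receive the truncated series
  1/\<rho> + d/\<rho>^2, raised by Q/\<rho>^3 to become a supersolution. The term \<theta>/2 times
  the degree is the share of a vertex in \<theta> e(X), so only the raised vertices contribute to
  the error.\<close>

lemma ex_supersolution:
  fixes g :: "nat \<Rightarrow> real"
  assumes X: "pair_graph X" and deg: "\<And>v. card (nb X v) \<le> c"
    and A: "A \<subseteq> pverts X" "\<And>v. v \<in> A \<Longrightarrow> nb X v \<subseteq> A" "card (pverts X - A) \<le> K"
    and g: "\<And>v. v \<in> A \<Longrightarrow> \<rho> * g v = 1 + (\<Sum>w\<in>nb X v. g w)" "\<And>v. v \<in> A \<Longrightarrow> 0 \<le> g v"
      "\<And>v. v \<in> A \<Longrightarrow> g v \<le> 1 / \<rho> + 3 / \<rho>\<^sup>2"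
    and sumA: "(\<Sum>v\<in>A. g v - 1 / \<rho> - \<theta> / 2 * real (card (nb X v))) \<le> 0"
    and theta: "2 / \<rho>\<^sup>2 \<le> \<theta>" and rho: "1 \<le> \<rho>" "real c * (real c + 3) \<le> \<rho>"
  shows "\<exists>\<phi>. (\<forall>v\<in>pverts X. 0 \<le> \<phi> v \<and> 1 + (\<Sum>w\<in>nb X v. \<phi> w) \<le> \<rho> * \<phi> v)
    \<and> (\<Sum>v\<in>pverts X. \<phi> v) \<le> real (card (pverts X)) / \<rho> + \<theta> * real (num_edges X)
        + real K * (real c * (real c + 3)) / \<rho> ^ 3"
proof -
  \<comment> \<open>All values stay below 1/\<rho> + q/\<rho>^2, both on \<open>A\<close>, where 3
    suffices, and off it, where d + 1 does. Hence a vertex of degree at most c exceeds its first two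
    terms by at most Q/\<rho>^3.\<close>
  define q where "q = real c + 3"
  define Q where "Q = real c * q"
  let ?d = "\<lambda>v. real (card (nb X v))"
  define \<phi> where "\<phi> v = (if v \<in> A then g v else 1 / \<rho> + ?d v / \<rho>\<^sup>2 + Q / \<rho> ^ 3)" for v
  have r0: "0 < \<rho>" using rho by simp
  have Q: "0 \<le> Q" "Q \<le> \<rho>" using rho by (auto simp: Q_def q_def)
  have fV: "finite (pverts X)" by (rule pair_graphD[OF X])
  have Q3: "Q / \<rho> ^ 3 \<le> 1 / \<rho>\<^sup>2"
  proof -
    have "Q / \<rho> ^ 3 \<le> \<rho> / \<rho> ^ 3" using Q r0 by (intro divide_right_mono) auto
    then show ?thesis using r0 by (simp add: power2_eq_square power3_eq_cube)
  qed
  have ub: "\<phi> v \<le> 1 / \<rho> + q / \<rho>\<^sup>2" for v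
  proof (cases "v \<in> A")
    case True
    have "3 / \<rho>\<^sup>2 \<le> q / \<rho>\<^sup>2" by (intro divide_right_mono) (auto simp: q_def)
    then show ?thesis using g(3)[OF True] True by (simp add: \<phi>_def)
  next
    case False
    have "?d v / \<rho>\<^sup>2 + 1 / \<rho>\<^sup>2 = (?d v + 1) / \<rho>\<^sup>2" by (simp add: add_divide_distrib)
    also have "\<dots> \<le> q / \<rho>\<^sup>2" using deg[of v] by (intro divide_right_mono) (auto simp: q_def)
    finally show ?thesis using Q3 False by (simp add: \<phi>_def)
  qed
  have "0 \<le> \<phi> v" for v using g(2) Q r0 by (auto simp: \<phi>_def)
  moreover have "1 + (\<Sum>w\<in>nb X v. \<phi> w) \<le> \<rho> * \<phi> v" if "v \<in> pverts X" for v
  proof (cases "v \<in> A")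
    case True
    then have "(\<Sum>w\<in>nb X v. \<phi> w) = (\<Sum>w\<in>nb X v. g w)" using A(2)[OF True] by (intro sum.cong) (auto simp: \<phi>_def)
    then show ?thesis using g(1)[OF True] True by (simp add: \<phi>_def)
  next
    case False
    have "(\<Sum>w\<in>nb X v. \<phi> w) \<le> (\<Sum>w\<in>nb X v. 1 / \<rho> + q / \<rho>\<^sup>2)" by (intro sum_mono ub)
    also have "\<dots> = ?d v / \<rho> + ?d v * q / \<rho>\<^sup>2" by (simp add: distrib_left)
    also have "?d v * q / \<rho>\<^sup>2 \<le> Q / \<rho>\<^sup>2"
      using deg[of v] unfolding Q_def by (intro divide_right_mono mult_right_mono) (auto simp: q_def)
    finally have "1 + (\<Sum>w\<in>nb X v. \<phi> w) \<le> 1 + ?d v / \<rho> + Q / \<rho>\<^sup>2" by simp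
    also have "\<dots> = \<rho> * \<phi> v"
      using False r0 by (simp add: \<phi>_def field_simps power2_eq_square power3_eq_cube)
    finally show ?thesis .
  qed
  moreover have "(\<Sum>v\<in>pverts X. \<phi> v) \<le> real (card (pverts X)) / \<rho> + \<theta> * real (num_edges X) + real K * Q / \<rho> ^ 3"
  proof -
    let ?h = "\<lambda>v. \<phi> v - 1 / \<rho> - \<theta> / 2 * ?d v"
    have "(\<Sum>v\<in>pverts X. ?h v) = (\<Sum>v\<in>pverts X - A. ?h v) + (\<Sum>v\<in>A. ?h v)"
      by (rule sum.subset_diff[OF A(1) fV])
    also have "(\<Sum>v\<in>A. ?h v) \<le> 0" using sumA by (simp add: \<phi>_def cong: sum.cong)
    also have "(\<Sum>v\<in>pverts X - A. ?h v) \<le> (\<Sum>v\<in>pverts X - A. Q / \<rho> ^ 3)"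
    proof (rule sum_mono)
      fix v assume "v \<in> pverts X - A"
      moreover have "?d v / \<rho>\<^sup>2 \<le> \<theta> / 2 * ?d v"
        using mult_right_mono[OF theta, of "?d v / 2"] by simp
      moreover from calculation have "\<phi> v = 1 / \<rho> + ?d v / \<rho>\<^sup>2 + Q / \<rho> ^ 3" by (simp add: \<phi>_def)
      ultimately show "?h v \<le> Q / \<rho> ^ 3" by linarith
    qed
    also have "\<dots> = real (card (pverts X - A)) * (Q / \<rho> ^ 3)" by simp
    also have "\<dots> \<le> real K * (Q / \<rho> ^ 3)" using A(3) Q r0 by (intro mult_right_mono) auto
    finally have "(\<Sum>v\<in>pverts X. ?h v) \<le> real K * Q / \<rho> ^ 3" by simp
    moreover have "(\<Sum>v\<in>pverts X. ?h v)
        = (\<Sum>v\<in>pverts X. \<phi> v) - real (card (pverts X)) / \<rho> - \<theta> / 2 * real (\<Sum>v\<in>pverts X. card (nb X v))"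
      by (simp add: sum_subtractf sum_distrib_left sum_divide_distrib)
    moreover have "\<theta> / 2 * real (\<Sum>v\<in>pverts X. card (nb X v)) = \<theta> * real (num_edges X)"
      unfolding sum_degrees[OF X] by simp
    ultimately show ?thesis by linarith
  qed
  ultimately show ?thesis unfolding Q_def q_def by blast
qed

text \<open>Here the series 1/\<rho> + d/\<rho>^2 needs no correction: all values are at least
  1/\<rho>, which already makes it a subsolution off \<open>A\<close>. The error comes only from the
  difference between \<theta>/2 and 1/\<rho>^2 at those vertices.\<close>

lemma ex_subsolution:
  fixes g :: "nat \<Rightarrow> real"
  assumes X: "pair_graph X" and deg: "\<And>v. card (nb X v) \<le> c"
    and A: "A \<subseteq> pverts X" "\<And>v. v \<in> A \<Longrightarrow> nb X v \<subseteq> A" "card (pverts X - A) \<le> K"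
    and g: "\<And>v. v \<in> A \<Longrightarrow> \<rho> * g v = 1 + (\<Sum>w\<in>nb X v. g w)" "\<And>v. v \<in> A \<Longrightarrow> 1 / \<rho> \<le> g v"
    and sumA: "0 \<le> (\<Sum>v\<in>A. g v - 1 / \<rho> - \<theta> / 2 * real (card (nb X v)))"
    and theta: "\<theta> / 2 \<le> 1 / \<rho>\<^sup>2 + 4 / \<rho> ^ 3" and rho: "0 < \<rho>"
  shows "\<exists>\<zeta>. (\<forall>v\<in>pverts X. 0 \<le> \<zeta> v \<and> \<rho> * \<zeta> v \<le> 1 + (\<Sum>w\<in>nb X v. \<zeta> w))
    \<and> real (card (pverts X)) / \<rho> + \<theta> * real (num_edges X) - real K * (4 * real c) / \<rho> ^ 3 \<le> (\<Sum>v\<in>pverts X. \<zeta> v)"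
proof -
  let ?d = "\<lambda>v. real (card (nb X v))"
  define \<zeta> where "\<zeta> v = (if v \<in> A then g v else 1 / \<rho> + ?d v / \<rho>\<^sup>2)" for v
  have fV: "finite (pverts X)" by (rule pair_graphD[OF X])
  have lb: "1 / \<rho> \<le> \<zeta> v" for v using g(2) by (auto simp: \<zeta>_def)
  then have "0 \<le> \<zeta> v" for v using rho by (meson less_imp_le order_trans zero_le_divide_1_iff)
  moreover have "\<rho> * \<zeta> v \<le> 1 + (\<Sum>w\<in>nb X v. \<zeta> w)" if "v \<in> pverts X" for v
  proof (cases "v \<in> A")
    case True
    then have "(\<Sum>w\<in>nb X v. \<zeta> w) = (\<Sum>w\<in>nb X v. g w)" using A(2)[OF True] by (intro sum.cong) (auto simp: \<zeta>_def)
    then show ?thesis using g(1)[OF True] True by (simp add: \<zeta>_def)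
  next
    case False
    have "\<rho> * \<zeta> v = 1 + (\<Sum>w\<in>nb X v. 1 / \<rho>)"
      using False rho by (simp add: \<zeta>_def field_simps power2_eq_square)
    also have "\<dots> \<le> 1 + (\<Sum>w\<in>nb X v. \<zeta> w)" by (intro add_left_mono sum_mono lb)
    finally show ?thesis .
  qed
  moreover have "real (card (pverts X)) / \<rho> + \<theta> * real (num_edges X) - real K * (4 * real c) / \<rho> ^ 3
      \<le> (\<Sum>v\<in>pverts X. \<zeta> v)"
  proof -
    let ?h = "\<lambda>v. \<zeta> v - 1 / \<rho> - \<theta> / 2 * ?d v"
    have "(\<Sum>v\<in>pverts X - A. - (4 * real c / \<rho> ^ 3)) \<le> (\<Sum>v\<in>pverts X - A. ?h v)"
    proof (rule sum_mono)
      fix v assume "v \<in> pverts X - A"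
      moreover have "\<theta> / 2 * ?d v \<le> ?d v / \<rho>\<^sup>2 + 4 * real c / \<rho> ^ 3"
      proof -
        have "\<theta> / 2 * ?d v \<le> (1 / \<rho>\<^sup>2 + 4 / \<rho> ^ 3) * ?d v" by (rule mult_right_mono[OF theta]) simp
        also have "\<dots> = ?d v / \<rho>\<^sup>2 + 4 * ?d v / \<rho> ^ 3" by (simp add: distrib_right)
        also have "4 * ?d v / \<rho> ^ 3 \<le> 4 * real c / \<rho> ^ 3"
          using deg[of v] rho by (intro divide_right_mono) auto
        finally show ?thesis by simp
      qed
      moreover from calculation have "\<zeta> v = 1 / \<rho> + ?d v / \<rho>\<^sup>2" by (simp add: \<zeta>_def)
      ultimately show "- (4 * real c / \<rho> ^ 3) \<le> ?h v" by linarith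
    qed
    moreover have "real (card (pverts X - A)) * (4 * real c / \<rho> ^ 3) \<le> real K * (4 * real c / \<rho> ^ 3)"
      using A(3) rho by (intro mult_right_mono) auto
    ultimately have "- (real K * (4 * real c) / \<rho> ^ 3) \<le> (\<Sum>v\<in>pverts X - A. ?h v)" by simp
    moreover have "0 \<le> (\<Sum>v\<in>A. ?h v)" using sumA by (simp add: \<zeta>_def cong: sum.cong)
    moreover have "(\<Sum>v\<in>pverts X. ?h v) = (\<Sum>v\<in>pverts X - A. ?h v) + (\<Sum>v\<in>A. ?h v)"
      by (rule sum.subset_diff[OF A(1) fV])
    ultimately have "- (real K * (4 * real c) / \<rho> ^ 3) \<le> (\<Sum>v\<in>pverts X. ?h v)" by linarith
    moreover have "(\<Sum>v\<in>pverts X. ?h v)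
        = (\<Sum>v\<in>pverts X. \<zeta> v) - real (card (pverts X)) / \<rho> - \<theta> / 2 * real (\<Sum>v\<in>pverts X. card (nb X v))"
      by (simp add: sum_subtractf sum_distrib_left sum_divide_distrib)
    moreover have "\<theta> / 2 * real (\<Sum>v\<in>pverts X. card (nb X v)) = \<theta> * real (num_edges X)"
      unfolding sum_degrees[OF X] by simp
    ultimately show ?thesis by linarith
  qed
  ultimately show ?thesis by blast
qed

lemma rho_square_gt: "4 \<le> \<rho> \<Longrightarrow> 2 < \<rho>\<^sup>2" for \<rho> :: real
  using mult_mono[of 4 \<rho> 4 \<rho>] by (simp add: power2_eq_square)

text \<open>
  The vertices whose component is a single vertex, a single edge, or a path on three vertices
  (as the middle vertex or as an end vertex).
\<close>

definition K1_verts :: "ngraph \<Rightarrow> nat set" where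
  "K1_verts X = {v \<in> pverts X. nb X v = {}}"

definition K2_verts :: "ngraph \<Rightarrow> nat set" where
  "K2_verts X = {v \<in> pverts X. card (nb X v) = 1 \<and> (\<forall>w\<in>nb X v. card (nb X w) = 1)}"

definition P3_centres :: "ngraph \<Rightarrow> nat set" where
  "P3_centres X = {v \<in> pverts X. card (nb X v) = 2 \<and> (\<forall>w\<in>nb X v. card (nb X w) = 1)}"

definition P3_ends :: "ngraph \<Rightarrow> nat set" where
  "P3_ends X = {v \<in> pverts X. card (nb X v) = 1 \<and> (\<forall>w\<in>nb X v. w \<in> P3_centres X)}"

text \<open>The exact solutions of (\<rho> - A) z = 1: on an edge (\<rho> - 1) z = 1; on a path with
  centre value p and end value q, \<rho> p = 1 + 2q and \<rho> q = 1 + p. The last branch is meant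
  for \<open>P3_ends\<close>.\<close>

definition sol :: "real \<Rightarrow> ngraph \<Rightarrow> nat \<Rightarrow> real" where
  "sol \<rho> X v = (if v \<in> K1_verts X then 1 / \<rho> else if v \<in> K2_verts X then 1 / (\<rho> - 1)
     else if v \<in> P3_centres X then (\<rho> + 2) / (\<rho>\<^sup>2 - 2) else (\<rho> + 1) / (\<rho>\<^sup>2 - 2))"

context
  fixes X :: ngraph
  assumes X: "pair_graph X"
begin

lemma card_nb_1: "card (nb X v) = 1 \<Longrightarrow> u \<in> nb X v \<Longrightarrow> nb X v = {u}"
  by (auto simp: card_1_singleton_iff)

lemma K2_closed:
  assumes v: "v \<in> K2_verts X" shows "nb X v \<subseteq> K2_verts X"
proof
  fix w assume w: "w \<in> nb X v"
  then have "card (nb X w) = 1" "v \<in> nb X w" "w \<in> pverts X" using v nb_graph(4)[OF X, of v w] nb_graph(2)[OF X, of v] by (auto simp: K2_verts_def)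
  moreover from this have "nb X w = {v}" by (intro card_nb_1)
  ultimately show "w \<in> K2_verts X" using v by (auto simp: K2_verts_def)
qed

lemma P3_ends_nb: "v \<in> P3_ends X \<Longrightarrow> nb X v \<subseteq> P3_centres X"
  by (auto simp: P3_ends_def)

lemma P3_centres_nb:
  assumes v: "v \<in> P3_centres X" shows "nb X v \<subseteq> P3_ends X"
proof
  fix w assume w: "w \<in> nb X v"
  then have "card (nb X w) = 1" "v \<in> nb X w" "w \<in> pverts X" using v nb_graph(4)[OF X, of v w] nb_graph(2)[OF X, of v] by (auto simp: P3_centres_def)
  moreover from this have "nb X w = {v}" by (intro card_nb_1)
  ultimately show "w \<in> P3_ends X" using v by (auto simp: P3_ends_def)
qed

lemma types_disjoint:
  "K1_verts X \<inter> K2_verts X = {}" "K1_verts X \<inter> P3_centres X = {}" "K1_verts X \<inter> P3_ends X = {}"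
  "K2_verts X \<inter> P3_centres X = {}" "K2_verts X \<inter> P3_ends X = {}" "P3_centres X \<inter> P3_ends X = {}"
proof -
  show "K2_verts X \<inter> P3_ends X = {}"
  proof (rule ccontr)
    assume "K2_verts X \<inter> P3_ends X \<noteq> {}"
    then obtain v where v: "v \<in> K2_verts X" "v \<in> P3_ends X" by auto
    then have "nb X v \<noteq> {}" by (auto simp: K2_verts_def)
    then show False using v by (auto simp: K2_verts_def P3_ends_def P3_centres_def)
  qed
qed (auto simp: K1_verts_def K2_verts_def P3_centres_def P3_ends_def)

text \<open>Each centre owns two ends, and no end belongs to two centres because its degree is
  1.\<close>

lemma card_P3_ends: "card (P3_ends X) = 2 * card (P3_centres X)"
proof -
  have fC: "finite (P3_centres X)" using pair_graphD(1)[OF X] by (simp add: P3_centres_def)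
  have "P3_ends X = (\<Union>v\<in>P3_centres X. nb X v)"
  proof
    show "(\<Union>v\<in>P3_centres X. nb X v) \<subseteq> P3_ends X" using P3_centres_nb by blast
    show "P3_ends X \<subseteq> (\<Union>v\<in>P3_centres X. nb X v)"
    proof
      fix v assume v: "v \<in> P3_ends X"
      then have "nb X v \<noteq> {}" by (auto simp: P3_ends_def)
      then obtain w where "w \<in> nb X v" by auto
      then show "v \<in> (\<Union>v\<in>P3_centres X. nb X v)" using P3_ends_nb[OF v] nb_graph(4)[OF X, of w v] by auto
    qed
  qed
  also have "card \<dots> = (\<Sum>v\<in>P3_centres X. card (nb X v))"
  proof (rule card_UN_disjoint[OF fC])
    show "\<forall>v\<in>P3_centres X. finite (nb X v)" using nb_graph(1)[OF X] by auto
    show "\<forall>u\<in>P3_centres X. \<forall>v\<in>P3_centres X. u \<noteq> v \<longrightarrow> nb X u \<inter> nb X v = {}"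
    proof (intro ballI impI, rule ccontr)
      fix u v assume uv: "u \<in> P3_centres X" "v \<in> P3_centres X" "u \<noteq> v" "nb X u \<inter> nb X v \<noteq> {}"
      then obtain w where w: "w \<in> nb X u" "w \<in> nb X v" by auto
      then have "card (nb X w) = 1" "u \<in> nb X w" "v \<in> nb X w"
        using uv(1) nb_graph(4)[OF X] by (auto simp: P3_centres_def)
      then show False using uv(3) card_nb_1 by (metis singletonD)
    qed
  qed
  also have "\<dots> = 2 * card (P3_centres X)" by (simp add: P3_centres_def)
  finally show ?thesis .
qed

lemma sol_simps:
  "v \<in> K1_verts X \<Longrightarrow> sol \<rho> X v = 1 / \<rho>" "v \<in> K2_verts X \<Longrightarrow> sol \<rho> X v = 1 / (\<rho> - 1)"
  "v \<in> P3_centres X \<Longrightarrow> sol \<rho> X v = (\<rho> + 2) / (\<rho>\<^sup>2 - 2)"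
  "v \<in> P3_ends X \<Longrightarrow> sol \<rho> X v = (\<rho> + 1) / (\<rho>\<^sup>2 - 2)"
  using types_disjoint by (auto simp: sol_def)

lemma sol_eq:
  assumes v: "v \<in> K1_verts X \<union> K2_verts X \<union> P3_centres X \<union> P3_ends X" and rho: "4 \<le> \<rho>"
  shows "\<rho> * sol \<rho> X v = 1 + (\<Sum>w\<in>nb X v. sol \<rho> X w)"
proof -
  have p: "0 < \<rho>\<^sup>2 - 2" using rho_square_gt[OF rho] by simp
  have const: "(\<Sum>w\<in>nb X v. sol \<rho> X w) = real (card (nb X v)) * t" if "\<And>w. w \<in> nb X v \<Longrightarrow> sol \<rho> X w = t" for t
    using that by simp
  consider "v \<in> K1_verts X" | "v \<in> K2_verts X" | "v \<in> P3_centres X" | "v \<in> P3_ends X" using v by blast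
  then show ?thesis
  proof cases
    case 1
    then show ?thesis using rho by (simp add: sol_simps) (simp add: K1_verts_def)
  next
    case 2
    have "(\<Sum>w\<in>nb X v. sol \<rho> X w) = real (card (nb X v)) * (1 / (\<rho> - 1))"
      using K2_closed[OF 2] by (intro const sol_simps) auto
    moreover have "card (nb X v) = 1" using 2 by (simp add: K2_verts_def)
    ultimately show ?thesis using 2 rho by (simp add: sol_simps field_simps)
  next
    case 3
    have "(\<Sum>w\<in>nb X v. sol \<rho> X w) = real (card (nb X v)) * ((\<rho> + 1) / (\<rho>\<^sup>2 - 2))"
      using P3_centres_nb[OF 3] by (intro const sol_simps) auto
    moreover have "card (nb X v) = 2" using 3 by (simp add: P3_centres_def)
    ultimately show ?thesis using 3 p by (simp add: sol_simps field_simps power2_eq_square)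
  next
    case 4
    have "(\<Sum>w\<in>nb X v. sol \<rho> X w) = real (card (nb X v)) * ((\<rho> + 2) / (\<rho>\<^sup>2 - 2))"
      using P3_ends_nb[OF 4] by (intro const sol_simps) auto
    moreover have "card (nb X v) = 1" using 4 by (simp add: P3_ends_def)
    ultimately show ?thesis using 4 p by (simp add: sol_simps field_simps power2_eq_square)
  qed
qed

lemma sol_bounds:
  assumes v: "v \<in> K1_verts X \<union> K2_verts X \<union> P3_centres X \<union> P3_ends X" and rho: "4 \<le> \<rho>"
  shows "1 / \<rho> \<le> sol \<rho> X v" and "sol \<rho> X v \<le> 1 / \<rho> + 3 / \<rho>\<^sup>2"
proof -
  have p: "0 < \<rho>\<^sup>2 - 2" using rho_square_gt[OF rho] by simp
  have r4: "4 * \<rho> \<le> \<rho>\<^sup>2" "16 \<le> 4 * \<rho>" using rho by (auto simp: power2_eq_square)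
  have e1: "1 / (\<rho> - 1) - 1 / \<rho> = 1 / (\<rho> * (\<rho> - 1))" using rho by (simp add: field_simps)
  have e1': "1 / \<rho> + 3 / \<rho>\<^sup>2 - 1 / (\<rho> - 1) = (2 * \<rho> - 3) / (\<rho>\<^sup>2 * (\<rho> - 1))"
    using rho by (simp add: field_simps power2_eq_square)
  have e2: "(\<rho> + 2) / (\<rho>\<^sup>2 - 2) - 1 / \<rho> = (2 * \<rho> + 2) / (\<rho> * (\<rho>\<^sup>2 - 2))"
    using rho p by (simp add: field_simps power2_eq_square)
  have e2': "1 / \<rho> + 3 / \<rho>\<^sup>2 - (\<rho> + 2) / (\<rho>\<^sup>2 - 2) = (\<rho>\<^sup>2 - 2 * \<rho> - 6) / (\<rho>\<^sup>2 * (\<rho>\<^sup>2 - 2))"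
    using rho p by (simp add: field_simps power2_eq_square)
  have e3: "(\<rho> + 1) / (\<rho>\<^sup>2 - 2) - 1 / \<rho> = (\<rho> + 2) / (\<rho> * (\<rho>\<^sup>2 - 2))"
    using rho p by (simp add: field_simps power2_eq_square)
  have e3': "(\<rho> + 1) / (\<rho>\<^sup>2 - 2) \<le> (\<rho> + 2) / (\<rho>\<^sup>2 - 2)" using p by (intro divide_right_mono) auto
  have n1: "0 \<le> 1 / (\<rho> * (\<rho> - 1))" "0 \<le> (2 * \<rho> - 3) / (\<rho>\<^sup>2 * (\<rho> - 1))" using rho by auto
  have n2: "0 \<le> (2 * \<rho> + 2) / (\<rho> * (\<rho>\<^sup>2 - 2))" "0 \<le> (\<rho> + 2) / (\<rho> * (\<rho>\<^sup>2 - 2))" using rho p by auto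
  have n3: "0 \<le> (\<rho>\<^sup>2 - 2 * \<rho> - 6) / (\<rho>\<^sup>2 * (\<rho>\<^sup>2 - 2))"
  proof -
    have "0 \<le> \<rho>\<^sup>2 - 2 * \<rho> - 6" using r4 rho by linarith
    then show ?thesis using p by simp
  qed
  have n4: "0 \<le> 3 / \<rho>\<^sup>2" by simp
  consider "v \<in> K1_verts X" | "v \<in> K2_verts X" | "v \<in> P3_centres X" | "v \<in> P3_ends X" using v by blast
  then have "1 / \<rho> \<le> sol \<rho> X v \<and> sol \<rho> X v \<le> 1 / \<rho> + 3 / \<rho>\<^sup>2"
    by cases (use e1 e1' e2 e2' e3 e3' n1 n2 n3 n4 in \<open>simp only: sol_simps; linarith\<close>)+
  then show "1 / \<rho> \<le> sol \<rho> X v" "sol \<rho> X v \<le> 1 / \<rho> + 3 / \<rho>\<^sup>2" by auto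
qed

text \<open>The rate 2/(\<rho>(\<rho> - 1)) is the excess of an edge component over 2/\<rho>, so the
  balance is zero at every single vertex.\<close>

lemma sol_sum_K:
  assumes rho: "4 \<le> \<rho>"
  shows "(\<Sum>v\<in>K1_verts X \<union> K2_verts X. sol \<rho> X v - 1 / \<rho> - 2 / (\<rho> * (\<rho> - 1)) / 2 * real (card (nb X v))) = 0"
proof (rule sum.neutral, rule ballI)
  fix v assume "v \<in> K1_verts X \<union> K2_verts X"
  then show "sol \<rho> X v - 1 / \<rho> - 2 / (\<rho> * (\<rho> - 1)) / 2 * real (card (nb X v)) = 0"
  proof
    assume v: "v \<in> K1_verts X"
    then have "card (nb X v) = 0" by (simp add: K1_verts_def)
    then show ?thesis using v by (simp add: sol_simps)
  next
    assume v: "v \<in> K2_verts X"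
    then have "card (nb X v) = 1" by (simp add: K2_verts_def)
    then show ?thesis using v rho by (simp add: sol_simps field_simps)
  qed
qed

text \<open>The rate is half of (3\<rho> + 4)/(\<rho>^2 - 2) - 3/\<rho>, the excess of a path with
  two edges. The terms cancel per component only, which is where the ratio 2 of ends to centres is
  needed.\<close>

lemma sol_sum_P3:
  assumes rho: "4 \<le> \<rho>"
  shows "(\<Sum>v\<in>P3_centres X \<union> P3_ends X.
    sol \<rho> X v - 1 / \<rho> - (2 * \<rho> + 3) / (\<rho> * (\<rho>\<^sup>2 - 2)) / 2 * real (card (nb X v))) = 0"
proof -
  let ?t = "(2 * \<rho> + 3) / (\<rho> * (\<rho>\<^sup>2 - 2))"
  let ?h = "\<lambda>v. sol \<rho> X v - 1 / \<rho> - ?t / 2 * real (card (nb X v))"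
  have p: "0 < \<rho>\<^sup>2 - 2" using rho_square_gt[OF rho] by simp
  have half: "a / 2 * 2 = a" for a :: real by simp
  have fin: "finite (P3_centres X)" "finite (P3_ends X)"
    using pair_graphD(1)[OF X] by (auto simp: P3_centres_def P3_ends_def)
  have "(\<Sum>v\<in>P3_centres X \<union> P3_ends X. ?h v) = (\<Sum>v\<in>P3_centres X. ?h v) + (\<Sum>v\<in>P3_ends X. ?h v)"
    by (rule sum.union_disjoint[OF fin types_disjoint(6)])
  also have "(\<Sum>v\<in>P3_centres X. ?h v) = (\<Sum>v\<in>P3_centres X. (\<rho> + 2) / (\<rho>\<^sup>2 - 2) - 1 / \<rho> - ?t)"
  proof (rule sum.cong[OF refl])
    fix v assume v: "v \<in> P3_centres X"
    then have d: "real (card (nb X v)) = 2" by (simp add: P3_centres_def)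
    show "?h v = (\<rho> + 2) / (\<rho>\<^sup>2 - 2) - 1 / \<rho> - ?t" unfolding sol_simps(3)[OF v] d half ..
  qed
  also have "(\<Sum>v\<in>P3_ends X. ?h v) = (\<Sum>v\<in>P3_ends X. (\<rho> + 1) / (\<rho>\<^sup>2 - 2) - 1 / \<rho> - ?t / 2)"
  proof (rule sum.cong[OF refl])
    fix v assume v: "v \<in> P3_ends X"
    then have d: "real (card (nb X v)) = 1" by (simp add: P3_ends_def)
    show "?h v = (\<rho> + 1) / (\<rho>\<^sup>2 - 2) - 1 / \<rho> - ?t / 2" unfolding sol_simps(4)[OF v] d mult_1_right ..
  qed
  also have "(\<Sum>v\<in>P3_centres X. (\<rho> + 2) / (\<rho>\<^sup>2 - 2) - 1 / \<rho> - ?t)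
      + (\<Sum>v\<in>P3_ends X. (\<rho> + 1) / (\<rho>\<^sup>2 - 2) - 1 / \<rho> - ?t / 2)
      = real (card (P3_centres X)) * ((\<rho> + 2) / (\<rho>\<^sup>2 - 2) - 1 / \<rho> - ?t + 2 * ((\<rho> + 1) / (\<rho>\<^sup>2 - 2) - 1 / \<rho> - ?t / 2))"
    unfolding sum_constant card_P3_ends by (simp add: algebra_simps)
  also have "(\<rho> + 2) / (\<rho>\<^sup>2 - 2) - 1 / \<rho> - ?t + 2 * ((\<rho> + 1) / (\<rho>\<^sup>2 - 2) - 1 / \<rho> - ?t / 2) = 0"
  proof -
    have e: "(\<rho> + 2) / (\<rho>\<^sup>2 - 2) - 1 / \<rho> = (2 * \<rho> + 2) / (\<rho> * (\<rho>\<^sup>2 - 2))"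
      "(\<rho> + 1) / (\<rho>\<^sup>2 - 2) - 1 / \<rho> = (\<rho> + 2) / (\<rho> * (\<rho>\<^sup>2 - 2))"
      using rho p by (simp_all add: field_simps power2_eq_square)
    have "(2 * \<rho> + 2) / D + 2 * ((\<rho> + 2) / D) = 2 * ((2 * \<rho> + 3) / D)" for D
      by (simp add: add_divide_distrib)
    from this[of "\<rho> * (\<rho>\<^sup>2 - 2)"]
    have e': "(2 * \<rho> + 2) / (\<rho> * (\<rho>\<^sup>2 - 2)) + 2 * ((\<rho> + 2) / (\<rho> * (\<rho>\<^sup>2 - 2))) = 2 * ?t" .
    have "a - b - t + 2 * (d - b - t / 2) = 0" if "a - b = y" "d - b = z" "y + 2 * z = 2 * t"
      for a b d t y z :: real using that by argo
    from this[OF e e'] show ?thesis .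
  qed
  finally show ?thesis by simp
qed

text \<open>At the path rate an edge component is overcharged, by (\<rho> + 1)/(2\<rho>(\<rho> -
  1)(\<rho>^2 - 2)) per vertex. The resulting inequality has the direction a supersolution
  requires.\<close>

lemma sol_sum_all:
  assumes rho: "4 \<le> \<rho>"
  shows "(\<Sum>v\<in>K1_verts X \<union> K2_verts X \<union> (P3_centres X \<union> P3_ends X).
    sol \<rho> X v - 1 / \<rho> - (2 * \<rho> + 3) / (\<rho> * (\<rho>\<^sup>2 - 2)) / 2 * real (card (nb X v))) \<le> 0"
proof -
  let ?t = "(2 * \<rho> + 3) / (\<rho> * (\<rho>\<^sup>2 - 2))"
  let ?h = "\<lambda>v. sol \<rho> X v - 1 / \<rho> - ?t / 2 * real (card (nb X v))"
  have p: "0 < \<rho>\<^sup>2 - 2" using rho_square_gt[OF rho] by simp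
  have fin: "finite (K1_verts X \<union> K2_verts X)" "finite (P3_centres X \<union> P3_ends X)"
    using pair_graphD(1)[OF X] by (auto simp: P3_centres_def P3_ends_def K1_verts_def K2_verts_def)
  have "(\<Sum>v\<in>K1_verts X \<union> K2_verts X \<union> (P3_centres X \<union> P3_ends X). ?h v)
      = (\<Sum>v\<in>K1_verts X \<union> K2_verts X. ?h v) + (\<Sum>v\<in>P3_centres X \<union> P3_ends X. ?h v)"
    by (rule sum.union_disjoint[OF fin]) (use types_disjoint in blast)
  also have "\<dots> = (\<Sum>v\<in>K1_verts X \<union> K2_verts X. ?h v)" unfolding sol_sum_P3[OF rho] by simp
  also have "\<dots> \<le> 0"
  proof (rule sum_nonpos)
    fix v assume "v \<in> K1_verts X \<union> K2_verts X"
    then show "?h v \<le> 0"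
    proof
      assume v: "v \<in> K1_verts X"
      then have "card (nb X v) = 0" by (simp add: K1_verts_def)
      then show ?thesis using v by (simp add: sol_simps)
    next
      assume v: "v \<in> K2_verts X"
      then have "card (nb X v) = 1" by (simp add: K2_verts_def)
      moreover have "?t / 2 - (1 / (\<rho> - 1) - 1 / \<rho>) = (\<rho> + 1) / (2 * \<rho> * (\<rho> - 1) * (\<rho>\<^sup>2 - 2))"
      proof -
        have "(2 * \<rho> + 3) / (\<rho> * P) / 2 - (1 / (\<rho> - 1) - 1 / \<rho>)
            = ((2 * \<rho> + 3) * (\<rho> - 1) - 2 * P) / (2 * \<rho> * (\<rho> - 1) * P)" if "0 < P" for P
          using rho that by (simp add: field_simps)
        from this[OF p] have "?t / 2 - (1 / (\<rho> - 1) - 1 / \<rho>)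
            = ((2 * \<rho> + 3) * (\<rho> - 1) - 2 * (\<rho>\<^sup>2 - 2)) / (2 * \<rho> * (\<rho> - 1) * (\<rho>\<^sup>2 - 2))" .
        moreover have "(2 * \<rho> + 3) * (\<rho> - 1) - 2 * (\<rho>\<^sup>2 - 2) = \<rho> + 1"
          by (simp add: algebra_simps power2_eq_square)
        ultimately show ?thesis by simp
      qed
      moreover have "0 \<le> (\<rho> + 1) / (2 * \<rho> * (\<rho> - 1) * (\<rho>\<^sup>2 - 2))" using rho p by auto
      ultimately show ?thesis using v by (simp only: sol_simps; linarith)
    qed
  qed
  finally show ?thesis .
qed

end

text \<open>Both graphs are measured at one common rate \<theta>. The first alternative allows the
  edge rate, with equality on both sides. In the second, H must be almost all paths to reach the
  path rate from below, while R may mix all types, because the larger rate bounds it from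
  above.\<close>

lemma ex_separating_solutions:
  assumes R: "pair_graph R" "\<And>v. card (nb R v) \<le> c" and H: "pair_graph H" "\<And>v. card (nb H v) \<le> c"
    and card: "card (pverts R) = card (pverts H)" and edges: "num_edges R < num_edges H"
    and types: "(card (pverts R - (K1_verts R \<union> K2_verts R)) \<le> K \<and> card (pverts H - (K1_verts H \<union> K2_verts H)) \<le> K)
      \<or> (card (pverts R - (K1_verts R \<union> K2_verts R \<union> (P3_centres R \<union> P3_ends R))) \<le> K
         \<and> card (pverts H - (P3_centres H \<union> P3_ends H)) \<le> K)"
    and rho: "4 \<le> \<rho>" "real c * (real c + 3) \<le> \<rho>" "real K * (real c * (real c + 3) + 4 * real c) < \<rho>"
  shows "\<exists>\<phi> \<zeta>. (\<forall>v\<in>pverts R. 0 \<le> \<phi> v \<and> 1 + (\<Sum>w\<in>nb R v. \<phi> w) \<le> \<rho> * \<phi> v)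
    \<and> (\<forall>v\<in>pverts H. 0 \<le> \<zeta> v \<and> \<rho> * \<zeta> v \<le> 1 + (\<Sum>w\<in>nb H v. \<zeta> w))
    \<and> (\<Sum>v\<in>pverts R. \<phi> v) < (\<Sum>v\<in>pverts H. \<zeta> v)"
proof -
  have p: "0 < \<rho>\<^sup>2 - 2" using rho_square_gt[OF rho(1)] by simp
  have r0: "0 < \<rho>" using rho by simp
  have r4: "4 * \<rho> \<le> \<rho>\<^sup>2" "16 \<le> 4 * \<rho>" using rho by (auto simp: power2_eq_square)
  have sub: "K1_verts X \<subseteq> pverts X" "K2_verts X \<subseteq> pverts X" "P3_centres X \<subseteq> pverts X" "P3_ends X \<subseteq> pverts X" for X
    by (auto simp: K1_verts_def K2_verts_def P3_centres_def P3_ends_def)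
  have clK: "nb X v \<subseteq> K1_verts X \<union> K2_verts X" if "pair_graph X" "v \<in> K1_verts X \<union> K2_verts X" for X v
    using that K2_closed[OF that(1), of v] by (auto simp: K1_verts_def)
  have clP: "nb X v \<subseteq> P3_centres X \<union> P3_ends X" if "pair_graph X" "v \<in> P3_centres X \<union> P3_ends X" for X v
    using that P3_centres_nb[OF that(1), of v] P3_ends_nb[OF that(1), of v] by auto
  \<comment> \<open>One more edge in H is worth \<theta> \<ge> 2/\<rho>^2, while by the last bound
    in \<open>rho\<close> the two errors together stay below 1/\<rho>^2.\<close>
  have key: ?thesis
    if th: "2 / \<rho>\<^sup>2 \<le> \<theta>" "\<theta> / 2 \<le> 1 / \<rho>\<^sup>2 + 4 / \<rho> ^ 3"
      and A: "A \<subseteq> K1_verts R \<union> K2_verts R \<union> P3_centres R \<union> P3_ends R" "\<And>v. v \<in> A \<Longrightarrow> nb R v \<subseteq> A" "card (pverts R - A) \<le> K"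
      and sA: "(\<Sum>v\<in>A. sol \<rho> R v - 1 / \<rho> - \<theta> / 2 * real (card (nb R v))) \<le> 0"
      and B: "B \<subseteq> K1_verts H \<union> K2_verts H \<union> P3_centres H \<union> P3_ends H" "\<And>v. v \<in> B \<Longrightarrow> nb H v \<subseteq> B" "card (pverts H - B) \<le> K"
      and sB: "(\<Sum>v\<in>B. sol \<rho> H v - 1 / \<rho> - \<theta> / 2 * real (card (nb H v))) = 0"
    for \<theta> A B
  proof -
    have AV: "A \<subseteq> pverts R" "B \<subseteq> pverts H" using A(1) B(1) sub by blast+
    have gA: "1 / \<rho> \<le> sol \<rho> R v" "sol \<rho> R v \<le> 1 / \<rho> + 3 / \<rho>\<^sup>2" "\<rho> * sol \<rho> R v = 1 + (\<Sum>w\<in>nb R v. sol \<rho> R w)"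
      if "v \<in> A" for v using that A(1) sol_bounds[OF R(1) _ rho(1), of v] sol_eq[OF R(1) _ rho(1), of v] by blast+
    have gA0: "0 \<le> sol \<rho> R v" if "v \<in> A" for v using gA(1)[OF that] r0 by (meson less_imp_le order_trans zero_le_divide_1_iff)
    have gB: "1 / \<rho> \<le> sol \<rho> H v" "\<rho> * sol \<rho> H v = 1 + (\<Sum>w\<in>nb H v. sol \<rho> H w)"
      if "v \<in> B" for v using that B(1) sol_bounds[OF H(1) _ rho(1), of v] sol_eq[OF H(1) _ rho(1), of v] by blast+
    have "1 \<le> \<rho>" using rho(1) by simp
    from ex_supersolution[OF R AV(1) A(2,3) gA(3) gA0 gA(2) sA th(1) this rho(2)]
    obtain \<phi> where \<phi>: "\<forall>v\<in>pverts R. 0 \<le> \<phi> v \<and> 1 + (\<Sum>w\<in>nb R v. \<phi> w) \<le> \<rho> * \<phi> v"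
      "(\<Sum>v\<in>pverts R. \<phi> v) \<le> real (card (pverts R)) / \<rho> + \<theta> * real (num_edges R) + real K * (real c * (real c + 3)) / \<rho> ^ 3"
      by blast
    have sB': "0 \<le> (\<Sum>v\<in>B. sol \<rho> H v - 1 / \<rho> - \<theta> / 2 * real (card (nb H v)))" using sB by simp
    from ex_subsolution[OF H AV(2) B(2,3) gB(2) gB(1) sB' th(2) r0]
    obtain \<zeta> where \<zeta>: "\<forall>v\<in>pverts H. 0 \<le> \<zeta> v \<and> \<rho> * \<zeta> v \<le> 1 + (\<Sum>w\<in>nb H v. \<zeta> w)"
      "real (card (pverts H)) / \<rho> + \<theta> * real (num_edges H) - real K * (4 * real c) / \<rho> ^ 3 \<le> (\<Sum>v\<in>pverts H. \<zeta> v)"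
      by blast
    have t0: "0 \<le> \<theta>" using th(1) by (meson divide_nonneg_nonneg order_trans zero_le_numeral zero_le_power2)
    have "\<theta> * (real (num_edges R) + 1) \<le> \<theta> * real (num_edges H)"
      using edges t0 by (intro mult_left_mono) auto
    then have 1: "\<theta> * real (num_edges R) + 2 / \<rho>\<^sup>2 \<le> \<theta> * real (num_edges H)" using th(1) by (simp add: distrib_left)
    have "real K * (real c * (real c + 3)) / \<rho> ^ 3 + real K * (4 * real c) / \<rho> ^ 3
        = real K * (real c * (real c + 3) + 4 * real c) / \<rho> ^ 3" by (simp add: add_divide_distrib distrib_left)
    also have "\<dots> < \<rho> / \<rho> ^ 3" using rho(3) r0 by (intro divide_strict_right_mono) auto
    also have "\<rho> / \<rho> ^ 3 = 1 / \<rho>\<^sup>2" using r0 by (simp add: power2_eq_square power3_eq_cube)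
    finally have 2: "real K * (real c * (real c + 3)) / \<rho> ^ 3 + real K * (4 * real c) / \<rho> ^ 3 < 1 / \<rho>\<^sup>2" .
    have 3: "1 / \<rho>\<^sup>2 \<le> 2 / \<rho>\<^sup>2" by (intro divide_right_mono) auto
    have "(\<Sum>v\<in>pverts R. \<phi> v) < (\<Sum>v\<in>pverts H. \<zeta> v)" 
    proof -
      have "a < b" if "a \<le> m + r + k" "m + h - k' \<le> b" "r + u \<le> h" "k + k' < t" "t \<le> u"
        for a b m r k k' h u t :: real using that by linarith
      from this[OF \<phi>(2)[unfolded card] \<zeta>(2) 1 2 3] show ?thesis .
    qed
    then show ?thesis using \<phi>(1) \<zeta>(1) by blast
  qed
  from types show ?thesis
  proof
    assume t: "card (pverts R - (K1_verts R \<union> K2_verts R)) \<le> K \<and> card (pverts H - (K1_verts H \<union> K2_verts H)) \<le> K"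
    show ?thesis
    proof (rule key[of "2 / (\<rho> * (\<rho> - 1))" "K1_verts R \<union> K2_verts R" "K1_verts H \<union> K2_verts H"])
      show "2 / \<rho>\<^sup>2 \<le> 2 / (\<rho> * (\<rho> - 1))"
        using rho(1) by (intro divide_left_mono) (auto simp: power2_eq_square)
      have "1 / \<rho>\<^sup>2 + 4 / \<rho> ^ 3 - 2 / (\<rho> * (\<rho> - 1)) / 2 = (3 * \<rho> - 4) / (\<rho> ^ 3 * (\<rho> - 1))"
        using rho(1) by (simp add: field_simps power2_eq_square power3_eq_cube)
      moreover have "0 \<le> (3 * \<rho> - 4) / (\<rho> ^ 3 * (\<rho> - 1))" using rho(1) by simp
      ultimately show "2 / (\<rho> * (\<rho> - 1)) / 2 \<le> 1 / \<rho>\<^sup>2 + 4 / \<rho> ^ 3" by linarith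
    qed (use t clK R(1) H(1) sol_sum_K[OF R(1) rho(1)] sol_sum_K[OF H(1) rho(1)] in auto)
  next
    assume t: "card (pverts R - (K1_verts R \<union> K2_verts R \<union> (P3_centres R \<union> P3_ends R))) \<le> K
         \<and> card (pverts H - (P3_centres H \<union> P3_ends H)) \<le> K"
    show ?thesis
    proof (rule key[of "(2 * \<rho> + 3) / (\<rho> * (\<rho>\<^sup>2 - 2))" "K1_verts R \<union> K2_verts R \<union> (P3_centres R \<union> P3_ends R)"
          "P3_centres H \<union> P3_ends H"])
      have "(2 * \<rho> + 3) / (\<rho> * (\<rho>\<^sup>2 - 2)) - 2 / \<rho>\<^sup>2 = (3 * \<rho> + 4) / (\<rho>\<^sup>2 * (\<rho>\<^sup>2 - 2))"
        using r0 p by (simp add: field_simps power2_eq_square)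
      moreover have "0 \<le> (3 * \<rho> + 4) / (\<rho>\<^sup>2 * (\<rho>\<^sup>2 - 2))" using r0 p by simp
      ultimately show "2 / \<rho>\<^sup>2 \<le> (2 * \<rho> + 3) / (\<rho> * (\<rho>\<^sup>2 - 2))" by linarith
      have "1 / \<rho>\<^sup>2 + 4 / \<rho> ^ 3 - (2 * \<rho> + 3) / (\<rho> * (\<rho>\<^sup>2 - 2)) / 2
          = (5 * \<rho>\<^sup>2 - 4 * \<rho> - 16) / (2 * \<rho> ^ 3 * (\<rho>\<^sup>2 - 2))"
        using r0 p by (simp add: field_simps power2_eq_square power3_eq_cube)
      moreover have "0 \<le> (5 * \<rho>\<^sup>2 - 4 * \<rho> - 16) / (2 * \<rho> ^ 3 * (\<rho>\<^sup>2 - 2))"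
      proof -
        have "0 \<le> 5 * \<rho>\<^sup>2 - 4 * \<rho> - 16" using r4 by linarith
        then show ?thesis using r0 p by simp
      qed
      ultimately show "(2 * \<rho> + 3) / (\<rho> * (\<rho>\<^sup>2 - 2)) / 2 \<le> 1 / \<rho>\<^sup>2 + 4 / \<rho> ^ 3" by linarith
      show "nb R v \<subseteq> K1_verts R \<union> K2_verts R \<union> (P3_centres R \<union> P3_ends R)"
        if "v \<in> K1_verts R \<union> K2_verts R \<union> (P3_centres R \<union> P3_ends R)" for v
        using that clK[OF R(1), of v] clP[OF R(1), of v] by blast
      show "nb H v \<subseteq> P3_centres H \<union> P3_ends H" if "v \<in> P3_centres H \<union> P3_ends H" for v
        by (rule clP[OF H(1) that])
    qed (use t sol_sum_all[OF R(1) rho(1)] sol_sum_P3[OF H(1) rho(1)] in auto)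
  qed
qed

section \<open>Disjoint copies of a fixed graph\<close>


definition copy :: "ngraph \<Rightarrow> ngraph \<Rightarrow> (nat \<Rightarrow> nat) \<Rightarrow> bool" where
  "copy X J f \<longleftrightarrow> inj_on f (pverts J) \<and> f ` pverts J \<subseteq> pverts X \<and> (\<forall>(u, v)\<in>parcs J. (f u, f v) \<in> parcs X)"

lemma ball_sym:
  assumes X: "pair_graph X" and "w \<in> ball X k u"
  shows "u \<in> ball X k w"
proof -
  have left: "w \<in> ball X (Suc k) u" if "v \<in> nb X u" "w \<in> ball X k v" for k u v w
    using that(2)
  proof (induction k arbitrary: w)
    case 0
    then show ?case using that(1) by simp
  next
    case (Suc k)
    then consider "w \<in> ball X k v" | z where "z \<in> ball X k v" "w \<in> nb X z" by auto
    then show ?case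
    proof cases
      case 1
      then show ?thesis using Suc.IH[of w] by simp
    next
      case 2
      then show ?thesis using Suc.IH[of z] by auto
    qed
  qed
  show ?thesis using assms(2)
  proof (induction k arbitrary: w)
    case 0
    then show ?case by simp
  next
    case (Suc k)
    then consider "w \<in> ball X k u" | z where "z \<in> ball X k u" "w \<in> nb X z" by auto
    then show ?case
    proof cases
      case 1
      then show ?thesis using Suc.IH[of w] by simp
    next
      case 2
      then show ?thesis using Suc.IH[of z] left[of z w u k] nb_graph(4)[OF X, of z w] by blast
    qed
  qed
qed

text \<open>Centres are chosen greedily with disjoint balls of radius 3. Each chosen centre excludes
  only vertices within distance 6, hence at most (D + 1)^6 of them.\<close>

lemma ex_disjoint_copies:
  assumes X: "pair_graph X" and deg: "\<And>v. card (nb X v) \<le> D"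
    and B: "finite B" "\<And>v. v \<in> B \<Longrightarrow> \<exists>f. copy X J f \<and> f ` pverts J \<subseteq> ball X 3 v"
    and big: "k * (D + 1) ^ 6 \<le> card B"
  shows "\<exists>F. (\<forall>i<k. copy X J (F i)) \<and> (\<forall>i<k. \<forall>j<k. i \<noteq> j \<longrightarrow> F i ` pverts J \<inter> F j ` pverts J = {})"
proof -
  have "\<exists>g. (\<forall>i<l. g i \<in> B) \<and> (\<forall>i<l. \<forall>j<l. i \<noteq> j \<longrightarrow> ball X 3 (g i) \<inter> ball X 3 (g j) = {})" if "l \<le> k" for l
    using that
  proof (induction l)
    case 0
    show ?case by simp
  next
    case (Suc l)
    then have "\<exists>g. (\<forall>i<l. g i \<in> B) \<and> (\<forall>i<l. \<forall>j<l. i \<noteq> j \<longrightarrow> ball X 3 (g i) \<inter> ball X 3 (g j) = {})" by simp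
    then obtain g where "(\<forall>i<l. g i \<in> B) \<and> (\<forall>i<l. \<forall>j<l. i \<noteq> j \<longrightarrow> ball X 3 (g i) \<inter> ball X 3 (g j) = {})" ..
    then have g: "\<And>i. i < l \<Longrightarrow> g i \<in> B"
      "\<And>i j. i < l \<Longrightarrow> j < l \<Longrightarrow> i \<noteq> j \<Longrightarrow> ball X 3 (g i) \<inter> ball X 3 (g j) = {}" by blast+
    define Z where "Z u = (\<Union>z\<in>ball X 3 u. ball X 3 z)" for u
    have Z: "finite (Z u)" "card (Z u) \<le> (D + 1) ^ 6" for u
    proof -
      show "finite (Z u)" unfolding Z_def using card_ball[OF X deg] by blast
      have "card (Z u) \<le> (\<Sum>z\<in>ball X 3 u. card (ball X 3 z))"
        unfolding Z_def using card_ball[OF X deg] by (intro card_UN_le) blast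
      also have "\<dots> \<le> (\<Sum>z\<in>ball X 3 u. (D + 1) ^ 3)" using card_ball[OF X deg] by (intro sum_mono) blast
      also have "\<dots> = card (ball X 3 u) * (D + 1) ^ 3" by simp
      also have "\<dots> \<le> (D + 1) ^ 3 * (D + 1) ^ 3" using card_ball[OF X deg] by (intro mult_le_mono1) blast
      finally show "card (Z u) \<le> (D + 1) ^ 6" by (simp add: power_add[symmetric])
    qed
    have "card (\<Union>i<l. Z (g i)) \<le> (\<Sum>i<l. card (Z (g i)))" by (rule card_UN_le) simp
    also have "\<dots> \<le> (\<Sum>i<l. (D + 1) ^ 6)" by (rule sum_mono) (rule Z)
    also have "\<dots> = l * (D + 1) ^ 6" by simp
    also have "\<dots> < k * (D + 1) ^ 6" using Suc.prems by simp
    also have "\<dots> \<le> card B" by (rule big)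
    finally have "\<not> B \<subseteq> (\<Union>i<l. Z (g i))"
      using Z(1) card_mono[of "\<Union>i<l. Z (g i)" B] by (metis finite_UN finite_lessThan leD)
    then obtain v where v: "v \<in> B" "\<And>i. i < l \<Longrightarrow> v \<notin> Z (g i)" by auto
    have dis: "ball X 3 v \<inter> ball X 3 (g i) = {}" if "i < l" for i
    proof (rule ccontr)
      assume "ball X 3 v \<inter> ball X 3 (g i) \<noteq> {}"
      then obtain z where "z \<in> ball X 3 v" "z \<in> ball X 3 (g i)" by auto
      then have "v \<in> Z (g i)" using ball_sym[OF X] by (auto simp: Z_def)
      then show False using v(2)[OF that] by simp
    qed
    let ?g = "g(l := v)"
    have "?g i \<in> B" if "i < Suc l" for i using that v(1) g(1) by (auto simp: less_Suc_eq)
    moreover have "ball X 3 (?g i) \<inter> ball X 3 (?g j) = {}" if ij: "i < Suc l" "j < Suc l" "i \<noteq> j" for i j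
    proof -
      consider "i = l" "j < l" | "j = l" "i < l" | "i < l" "j < l" using ij by linarith
      then show ?thesis
      proof cases
        case 1
        then show ?thesis using dis[of j] by simp
      next
        case 2
        then show ?thesis using dis[of i] by (simp add: Int_commute)
      next
        case 3
        then show ?thesis using g(2)[of i j] ij(3) by simp
      qed
    qed
    ultimately show ?case by (intro exI[of _ ?g]) blast
  qed
  from this[OF order_refl]
  obtain g where "(\<forall>i<k. g i \<in> B) \<and> (\<forall>i<k. \<forall>j<k. i \<noteq> j \<longrightarrow> ball X 3 (g i) \<inter> ball X 3 (g j) = {})" ..
  then have g: "\<And>i. i < k \<Longrightarrow> g i \<in> B"
    "\<And>i j. i < k \<Longrightarrow> j < k \<Longrightarrow> i \<noteq> j \<Longrightarrow> ball X 3 (g i) \<inter> ball X 3 (g j) = {}" by blast+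
  define F where "F i = (SOME f. copy X J f \<and> f ` pverts J \<subseteq> ball X 3 (g i))" for i
  have F: "copy X J (F i) \<and> F i ` pverts J \<subseteq> ball X 3 (g i)" if "i < k" for i
    unfolding F_def by (rule someI_ex[OF B(2)[OF g(1)[OF that]]])
  have "F i ` pverts J \<inter> F j ` pverts J = {}" if "i < k" "j < k" "i \<noteq> j" for i j
    using F[OF that(1)] F[OF that(2)] g(2)[OF that] by blast
  then show ?thesis using F by (intro exI[of _ F]) blast
qed

section \<open>Disjoint unions of copies as competitors\<close>

text \<open>For J on {0, ..., j - 1}, vertex a is vertex a mod j of copy number a div j. Only
  complete blocks carry edges; the last m mod j vertices are isolated padding.\<close>

definition blocks :: "ngraph \<Rightarrow> nat \<Rightarrow> nat \<Rightarrow> ngraph" where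
  "blocks J j m = \<lparr>pverts = {..<m},
     parcs = {(a, b). a div j = b div j \<and> a div j < m div j \<and> (a mod j, b mod j) \<in> parcs J}\<rparr>"

lemma pair_graph_blocks:
  assumes J: "pair_graph J" and j: "0 < j"
  shows "pair_graph (blocks J j m)"
proof (rule pair_graphI)
  have "a < m" if "a div j < m div j" for a
    using that j by (metis div_le_mono leD not_le)
  then show "parcs (blocks J j m) \<subseteq> pverts (blocks J j m) \<times> pverts (blocks J j m)"
    by (auto simp: blocks_def)
qed (auto simp: blocks_def pair_graphD(4)[OF J] dest: pair_graphD(3)[OF J])

lemma num_edges_blocks:
  assumes J: "pair_graph J" "pverts J = {..<j}" and j: "0 < j"
  shows "num_edges (blocks J j m) = num_edges J * (m div j)"
proof -
  let ?f = "\<lambda>(i, (a, b)). (i * j + a, i * j + b)"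
  have lt: "a < j \<and> b < j" if "(a, b) \<in> parcs J" for a b
    using pair_graphD(5,6)[OF J(1) that] J(2) by auto
  have "parcs (blocks J j m) = ?f ` ({..<m div j} \<times> parcs J)"
  proof
    show "?f ` ({..<m div j} \<times> parcs J) \<subseteq> parcs (blocks J j m)"
      using lt by (fastforce simp: blocks_def)
    show "parcs (blocks J j m) \<subseteq> ?f ` ({..<m div j} \<times> parcs J)"
    proof
      fix p assume "p \<in> parcs (blocks J j m)"
      then obtain a b where p: "p = (a, b)" "a div j = b div j" "a div j < m div j" "(a mod j, b mod j) \<in> parcs J"
        by (auto simp: blocks_def)
      have "(a, b) = ?f (a div j, (a mod j, b mod j))"
        using p(2) by (simp add: div_mult_mod_eq) (metis div_mult_mod_eq)
      then show "p \<in> ?f ` ({..<m div j} \<times> parcs J)" using p by blast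
    qed
  qed
  moreover have "inj_on ?f ({..<m div j} \<times> parcs J)"
  proof (rule inj_onI)
    fix t t' assume "t \<in> {..<m div j} \<times> parcs J" "t' \<in> {..<m div j} \<times> parcs J" "?f t = ?f t'"
    then obtain i a b i' a' b' where t: "t = (i, (a, b))" "t' = (i', (a', b'))"
      and ab: "(a, b) \<in> parcs J" "(a', b') \<in> parcs J" and e: "i * j + a = i' * j + a'" "i * j + b = i' * j + b'"
      by auto
    have l: "a < j" "a' < j" using lt ab by auto
    have "(i * j + a) div j = (i' * j + a') div j" using e by simp
    then have "i = i'" using l by simp
    then show "t = t'" using e t by simp
  qed
  ultimately have "card (parcs (blocks J j m)) = m div j * card (parcs J)"
    by (simp add: card_image card_cartesian_product)
  then show ?thesis using card_parcs[OF J(1)] card_parcs[OF pair_graph_blocks[OF J(1) j], of m] by simp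
qed

context graph_family
begin

text \<open>
  Many disjoint copies of \<open>J\<close> can host every small part of a disjoint union of copies of \<open>J\<close>, so
  such a union would be admissible too.
\<close>

lemma blocks_free:
  assumes T: "pair_graph T" and X: "pair_graph X" "card (pverts X) = m" and free: "free_of \<F> (T \<^bold>\<or> X)"
    and J: "pair_graph J" "pverts J = {..<j}" and j: "0 < j"
    and cp: "\<And>i. i < c \<Longrightarrow> copy X J (cp i)"
    and disj: "\<And>i k. i < c \<Longrightarrow> k < c \<Longrightarrow> i \<noteq> k \<Longrightarrow> cp i ` pverts J \<inter> cp k ` pverts J = {}"
    and big: "c * j + c \<le> m"
  shows "free_of \<F> (T \<^bold>\<or> blocks J j m)"
  unfolding free_of_def
proof (intro ballI notI)
  fix F assume F: "F \<in> \<F>" and cont: "contains (T \<^bold>\<or> blocks J j m) F"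
  let ?Y = "blocks J j m" and ?q = "m div j"
  obtain f where f: "inj_on f (pverts F)" "f ` pverts F \<subseteq> pverts (T \<^bold>\<or> ?Y)"
    "\<forall>(u, v)\<in>parcs F. (f u, f v) \<in> parcs (T \<^bold>\<or> ?Y)" using cont unfolding contains_def by blast
  have FG: "pair_graph F" by (rule fam[OF F])
  have fF: "finite (pverts F)" by (rule pair_graphD[OF FG])
  define w where "w a = (case sum_decode (f a) of Inl u \<Rightarrow> u | Inr u \<Rightarrow> u)" for a
  have w: "w a = u" if "f a = inr u" for a u using that by (simp add: w_def)
  \<comment> \<open>\<open>P\<close> collects the vertices of F placed in complete blocks, and
    \<open>Q\<close> those placed on the isolated padding; the remaining ones lie in T and keep
    their places.\<close>
  define P where "P = {a \<in> pverts F. (\<exists>u. f a = inr u) \<and> w a div j < ?q}"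
  define Q where "Q = {a \<in> pverts F. (\<exists>u. f a = inr u) \<and> \<not> w a div j < ?q}"
  have frP: "f a = inr (w a)" if "a \<in> P \<union> Q" for a using that w by (auto simp: P_def Q_def)
  have fPQ: "finite P" "finite Q" using fF by (auto simp: P_def Q_def)
  let ?I = "(\<lambda>a. w a div j) ` P"
  have "card ?I \<le> card {..<c}"
  proof -
    have "card ?I \<le> card P" by (rule card_image_le[OF fPQ(1)])
    also have "\<dots> \<le> card (pverts F)" using fF by (intro card_mono) (auto simp: P_def)
    finally show ?thesis using fam_card[OF F] by simp
  qed
  \<comment> \<open>F meets at most \<open>c\<close> blocks, so distinct blocks can be assigned
    distinct copies of J in X.\<close>
  then obtain b where b: "b ` ?I \<subseteq> {..<c}" "inj_on b ?I"
    using card_le_inj[of ?I "{..<c}"] fPQ by blast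
  let ?U = "\<Union>i<c. cp i ` {..<j}"
  \<comment> \<open>The padding vertices go outside all \<open>c\<close> copies; \<open>big\<close>
    guarantees that at least \<open>c\<close> such vertices exist.\<close>
  have "card Q \<le> card (pverts X - ?U)"
  proof -
    have "card ?U \<le> (\<Sum>i<c. card (cp i ` {..<j}))" by (rule card_UN_le) simp
    also have "\<dots> \<le> (\<Sum>i<c. j)" using card_image_le[of "{..<j}"] by (intro sum_mono) fastforce
    finally have U: "card ?U \<le> c * j" by simp
    have "card Q \<le> card (pverts F)" using fF by (intro card_mono) (auto simp: Q_def)
    then have "card Q \<le> c" using fam_card[OF F] by linarith
    also have "c \<le> card (pverts X) - card ?U" using U big X(2) by linarith
    also have "\<dots> \<le> card (pverts X - ?U)" by (rule diff_card_le_card_Diff) simp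
    finally show ?thesis .
  qed
  then obtain h where h: "h ` Q \<subseteq> pverts X - ?U" "inj_on h Q"
    using card_le_inj[of Q "pverts X - ?U"] fPQ pair_graphD(1)[OF X(1)] by blast
  define p where "p a = cp (b (w a div j)) (w a mod j)" for a
  have bc: "b (w a div j) < c" if "a \<in> P" for a using b(1) that by auto
  have modj: "k mod j < j" for k using j by simp
  have pU: "p a \<in> ?U" if "a \<in> P" for a using bc[OF that] modj by (auto simp: p_def)
  have pX: "p a \<in> pverts X" if "a \<in> P" for a
    using cp[OF bc[OF that]] modj J(2) by (auto simp: p_def copy_def)
  define g where "g a = (if a \<in> P then inr (p a) else if a \<in> Q then inr (h a) else f a)" for a
  have PQ: "P \<inter> Q = {}" by (auto simp: P_def Q_def)
  have gQ: "g a = inr (h a)" if "a \<in> Q" for a using that PQ unfolding g_def by auto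
  have other: "\<exists>u\<in>pverts T. f a = inl u" if "a \<in> pverts F" "a \<notin> P" "a \<notin> Q" for a
  proof -
    have "f a \<in> inl ` pverts T \<union> inr ` pverts ?Y" using f(2) that(1) by (auto simp: pverts_join)
    then show ?thesis using that by (auto simp: P_def Q_def)
  qed
  have "contains (T \<^bold>\<or> X) F"
  proof (rule containsI[where f = g])
    show "inj_on g (pverts F)"
    proof (rule inj_onI)
      fix a a' assume a: "a \<in> pverts F" "a' \<in> pverts F" and e: "g a = g a'"
      have pinj: "a = a'" if aP: "a \<in> P" "a' \<in> P" "p a = p a'"
      proof -
        have "b (w a div j) = b (w a' div j)"
        proof (rule ccontr)
          assume "b (w a div j) \<noteq> b (w a' div j)"
          from disj[OF bc[OF aP(1)] bc[OF aP(2)] this]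
          have "cp (b (w a div j)) ` {..<j} \<inter> cp (b (w a' div j)) ` {..<j} = {}" unfolding J(2) .
          moreover have "p a \<in> cp (b (w a div j)) ` {..<j}" unfolding p_def using modj by blast
          moreover have "p a' \<in> cp (b (w a' div j)) ` {..<j}" unfolding p_def using modj by blast
          ultimately show False using aP(3) by auto
        qed
        moreover from this have d: "w a div j = w a' div j" using b(2) aP by (auto dest: inj_onD)
        ultimately have "cp (b (w a div j)) (w a mod j) = cp (b (w a div j)) (w a' mod j)"
          using aP(3) by (simp add: p_def)
        then have "w a mod j = w a' mod j"
          using cp[OF bc[OF aP(1)]] modj J(2) by (auto simp: copy_def dest: inj_onD)
        then have "w a = w a'" using d by (metis div_mult_mod_eq)
        then have "f a = f a'" using frP[of a] frP[of a'] aP by simp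
        then show ?thesis using f(1) a by (auto dest: inj_onD)
      qed
      have hU: "h z \<notin> ?U" if "z \<in> Q" for z using h(1) that by blast
      consider "a \<in> P" | "a \<in> Q" | "a \<notin> P" "a \<notin> Q" by blast
      then show "a = a'"
      proof cases
        case 1
        then have ga: "g a = inr (p a)" by (simp add: g_def)
        consider "a' \<in> P" | "a' \<in> Q" | "a' \<notin> P" "a' \<notin> Q" by blast
        then show ?thesis
        proof cases
          assume "a' \<in> P"
          then show ?thesis using 1 e ga pinj by (simp add: g_def sum_encode_eq)
        next
          assume q: "a' \<in> Q"
          have "p a = h a'" using e ga gQ[OF q] by (simp add: sum_encode_eq)
          then show ?thesis using pU[OF 1] hU[OF q] by simp
        next
          assume "a' \<notin> P" "a' \<notin> Q"
          then show ?thesis using other[OF a(2)] e ga by (auto simp: g_def sum_encode_eq)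
        qed
      next
        case 2
        then have ga: "g a = inr (h a)" by (rule gQ)
        consider "a' \<in> P" | "a' \<in> Q" | "a' \<notin> P" "a' \<notin> Q" by blast
        then show ?thesis
        proof cases
          assume q: "a' \<in> P"
          then have "p a' = h a" using e ga by (auto simp: g_def sum_encode_eq)
          then show ?thesis using pU[OF q] hU[OF 2] by simp
        next
          assume q: "a' \<in> Q"
          have "h a = h a'" using e ga gQ[OF q] by (simp add: sum_encode_eq)
          then show ?thesis using h(2) 2 q by (auto dest: inj_onD)
        next
          assume "a' \<notin> P" "a' \<notin> Q"
          then show ?thesis using other[OF a(2)] e ga by (auto simp: g_def sum_encode_eq)
        qed
      next
        case 3
        then obtain u where u: "f a = inl u" "g a = inl u" using other[OF a(1)] by (auto simp: g_def)
        have "a' \<notin> P" using e u(2) by (auto simp: g_def sum_encode_eq)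
        moreover have "a' \<notin> Q" using e u(2) gQ[of a'] by (auto simp: sum_encode_eq)
        ultimately have "a' \<notin> P" "a' \<notin> Q" .
        then have "f a' = f a" using e u by (simp add: g_def)
        then show ?thesis using f(1) a by (auto dest: inj_onD)
      qed
    qed
    have gX: "\<exists>u\<in>pverts X. g a = inr u" if "a \<in> P \<union> Q" for a
      using that pX[of a] h(1) gQ[of a] by (cases "a \<in> P") (auto simp: g_def)
    show "g a \<in> pverts (T \<^bold>\<or> X)" if "a \<in> pverts F" for a
    proof (cases "a \<in> P \<union> Q")
      case True
      then show ?thesis using gX[OF True] by (auto simp: pverts_join)
    next
      case False
      then show ?thesis using other[of a] that by (auto simp: pverts_join g_def)
    qed
    show "(g a, g a') \<in> parcs (T \<^bold>\<or> X)" if aa: "(a, a') \<in> parcs F" for a a'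
    proof -
      have V: "a \<in> pverts F" "a' \<in> pverts F" using pair_graphD(5,6)[OF FG aa] by auto
      have arc: "(f a, f a') \<in> parcs (T \<^bold>\<or> ?Y)" using f(3) aa by blast
      consider "a \<in> P \<union> Q" "a' \<in> P \<union> Q" | "a \<in> P \<union> Q" "a' \<notin> P \<union> Q" | "a \<notin> P \<union> Q" "a' \<in> P \<union> Q"
        | "a \<notin> P \<union> Q" "a' \<notin> P \<union> Q" by blast
      then show ?thesis
      proof cases
        case 1
        then have "(w a, w a') \<in> parcs ?Y" using arc frP by (simp add: parcs_join)
        then have y: "w a div j = w a' div j" "w a div j < ?q" "(w a mod j, w a' mod j) \<in> parcs J"
          by (auto simp: blocks_def)
        then have aP: "a \<in> P" "a' \<in> P" using 1 by (auto simp: P_def Q_def)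
        have "(p a, p a') \<in> parcs X"
          using cp[OF bc[OF aP(1)]] y unfolding p_def copy_def by auto
        then show ?thesis using aP by (simp add: g_def parcs_join)
      next
        case 2
        obtain u where "u \<in> pverts X" "g a = inr u" using gX[OF 2(1)] by auto
        moreover obtain t where "t \<in> pverts T" "g a' = inl t" using other[of a'] V 2 by (auto simp: g_def)
        ultimately show ?thesis by (simp add: parcs_join)
      next
        case 3
        obtain u where "u \<in> pverts X" "g a' = inr u" using gX[OF 3(2)] by auto
        moreover obtain t where "t \<in> pverts T" "g a = inl t" using other[of a] V 3 by (auto simp: g_def)
        ultimately show ?thesis by (simp add: parcs_join)
      next
        case 4
        then obtain t t' where "f a = inl t" "f a' = inl t'" using other[of a] other[of a'] V by auto
        then show ?thesis using arc 4 by (simp add: g_def parcs_join)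
      qed
    qed
  qed
  then show False using free F by (auto simp: free_of_def)
qed

text \<open>The core joined with disjoint copies of J is free by \<open>blocks_free\<close>, so it
  cannot have more edges than the core joined with H; the common terms cancel.\<close>

lemma many_copies_imp_edges:
  assumes hyp: "hyp C n H" and T: "T \<in> extremal s (\<H> \<F>)"
    and X: "pair_graph X" "card (pverts X) = n - s" "free_of \<F> (T \<^bold>\<or> X)" "\<And>v. card (nb X v) \<le> c"
    and J: "pair_graph J" "pverts J = {..<j}" and j: "0 < j" and big: "c * j + c \<le> n - s"
    and B: "c * (c + 1) ^ 6 \<le> card {v \<in> pverts X. \<exists>f. copy X J f \<and> f ` pverts J \<subseteq> ball X 3 v}"
  shows "num_edges J * ((n - s) div j) \<le> num_edges H"
proof -
  let ?B = "{v \<in> pverts X. \<exists>f. copy X J f \<and> f ` pverts J \<subseteq> ball X 3 v}" and ?Y = "blocks J j (n - s)"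
  have "finite ?B" using pair_graphD(1)[OF X(1)] by simp
  from ex_disjoint_copies[OF X(1,4) this _ B]
  obtain cp where cp: "\<forall>i<c. copy X J (cp i)"
    "\<forall>i<c. \<forall>k<c. i \<noteq> k \<longrightarrow> cp i ` pverts J \<inter> cp k ` pverts J = {}" by blast
  note TD = extremalD[OF T]
  have free: "free_of \<F> (T \<^bold>\<or> ?Y)"
    by (rule blocks_free[OF TD(1) X(1-3) J j _ _ big, where cp = cp]) (use cp in auto)
  have Y: "pair_graph ?Y" "card (pverts ?Y) = n - s"
    using pair_graph_blocks[OF J(1) j] by (auto simp: blocks_def)
  have "2 * s \<le> n" using hyp by (simp add: hyp_def)
  then have "T \<^bold>\<or> ?Y \<in> free_graphs n \<F>"
    using free pair_graph_join[OF TD(1) Y(1)] card_pverts_join[OF TD(1) Y(1)] TD(2) Y(2)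
    by (simp add: free_graphs_def)
  from hyp_num_edges_le[OF hyp T this] show ?thesis
    using num_edges_join[OF TD(1) Y(1)] TD(2) Y(2) num_edges_blocks[OF J j] by simp
qed

end

section \<open>Components that are not small trees\<close>


definition K3_graph :: ngraph where
  "K3_graph = \<lparr>pverts = {..<3}, parcs = {(0, 1), (1, 0), (1, 2), (2, 1), (0, 2), (2, 0)}\<rparr>"

definition P3_graph :: ngraph where
  "P3_graph = \<lparr>pverts = {..<3}, parcs = {(0, 1), (1, 0), (1, 2), (2, 1)}\<rparr>"

definition P4_graph :: ngraph where
  "P4_graph = \<lparr>pverts = {..<4}, parcs = {(0, 1), (1, 0), (1, 2), (2, 1), (2, 3), (3, 2)}\<rparr>"

definition K13_graph :: ngraph where
  "K13_graph = \<lparr>pverts = {..<4}, parcs = {(0, 1), (1, 0), (0, 2), (2, 0), (0, 3), (3, 0)}\<rparr>"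

lemma small_graphs:
  "pair_graph K3_graph" "pair_graph P3_graph" "pair_graph P4_graph" "pair_graph K13_graph"
  by (auto intro!: pair_graphI simp: K3_graph_def P3_graph_def P4_graph_def K13_graph_def)

lemma pverts_small_graphs:
  "pverts K3_graph = {..<3}" "pverts P3_graph = {..<3}" "pverts P4_graph = {..<4}" "pverts K13_graph = {..<4}"
  by (simp_all add: K3_graph_def P3_graph_def P4_graph_def K13_graph_def)

lemma num_edges_small_graphs:
  "num_edges K3_graph = 3" "num_edges P3_graph = 2" "num_edges P4_graph = 3" "num_edges K13_graph = 3"
  using card_parcs[OF small_graphs(1)] card_parcs[OF small_graphs(2)]
    card_parcs[OF small_graphs(3)] card_parcs[OF small_graphs(4)]
  by (simp_all add: K3_graph_def P3_graph_def P4_graph_def K13_graph_def)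

lemma P4_neq_K13: "P4_graph \<noteq> K13_graph"
proof -
  have "(1, 2) \<in> parcs P4_graph" "(1, 2) \<notin> parcs K13_graph" by (simp_all add: P4_graph_def K13_graph_def)
  then show ?thesis by metis
qed

lemma P3_neq_K3: "P3_graph \<noteq> K3_graph"
proof -
  have "(0, 2) \<notin> parcs P3_graph" "(0, 2) \<in> parcs K3_graph" by (simp_all add: P3_graph_def K3_graph_def)
  then show ?thesis by metis
qed

lemma lessThan_3: "{..<3::nat} = {0, 1, 2}" and lessThan_4: "{..<4::nat} = {0, 1, 2, 3}"
  by auto

text \<open>Radius 3 is what a path on four vertices needs when the given vertex is one of its
  ends.\<close>

definition near :: "ngraph \<Rightarrow> ngraph \<Rightarrow> nat set" where
  "near X J = {v \<in> pverts X. \<exists>f. copy X J f \<and> f ` pverts J \<subseteq> ball X 3 v}"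

context
  fixes X :: ngraph
  assumes X: "pair_graph X"
begin

lemma nb_parcs: "w \<in> nb X v \<longleftrightarrow> (v, w) \<in> parcs X" "w \<in> nb X v \<longleftrightarrow> (w, v) \<in> parcs X"
  using pair_graphD(3)[OF X] by (auto simp: nb_def)

lemma nearI4:
  assumes "J = P4_graph \<or> J = K13_graph" and "v \<in> pverts X" and "distinct [p, q, r, t]"
    and "{p, q, r, t} \<subseteq> ball X 3 v" and "q \<in> nb X p"
    and "J = P4_graph \<Longrightarrow> r \<in> nb X q \<and> t \<in> nb X r" and "J = K13_graph \<Longrightarrow> r \<in> nb X p \<and> t \<in> nb X p"
  shows "v \<in> near X J"
proof -
  define f where "f i = (if i = 0 then p else if i = 1 then q else if i = 2 then r else t)" for i :: nat
  have f: "f 0 = p" "f 1 = q" "f 2 = r" "f 3 = t" "f (Suc 0) = q" by (simp_all add: f_def)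
  have V: "pverts J = {0, 1, 2, 3}" using assms(1) pverts_small_graphs lessThan_4 by auto
  have "{p, q, r, t} \<subseteq> pverts X"
    using assms(1,5-7) pair_graphD(5,6)[OF X] by (auto simp: nb_def)
  moreover have "inj_on f {0, 1, 2, 3}" using assms(3) by (auto simp: inj_on_def f)
  moreover have "\<forall>(a, b)\<in>parcs J. (f a, f b) \<in> parcs X"
    using assms(1,5-7) nb_parcs by (auto simp: P4_graph_def K13_graph_def f)
  ultimately have "copy X J f" unfolding copy_def V by (simp add: f)
  moreover have "f ` pverts J \<subseteq> ball X 3 v" using assms(4) unfolding V by (simp add: f)
  ultimately show ?thesis using assms(2) unfolding near_def by blast
qed

lemma nearI3:
  assumes "J = P3_graph \<or> J = K3_graph" and "v \<in> pverts X" and "distinct [p, q, r]"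
    and "{p, q, r} \<subseteq> ball X 3 v" and "q \<in> nb X p" "r \<in> nb X q" and "J = K3_graph \<Longrightarrow> r \<in> nb X p"
  shows "v \<in> near X J"
proof -
  define f where "f i = (if i = 0 then p else if i = 1 then q else r)" for i :: nat
  have f: "f 0 = p" "f 1 = q" "f 2 = r" "f (Suc 0) = q" by (simp_all add: f_def)
  have V: "pverts J = {0, 1, 2}" using assms(1) pverts_small_graphs lessThan_3 by auto
  have "{p, q, r} \<subseteq> pverts X"
    using assms(5,6) pair_graphD(5,6)[OF X] by (auto simp: nb_def)
  moreover have "inj_on f {0, 1, 2}" using assms(3) by (auto simp: inj_on_def f)
  moreover have "\<forall>(a, b)\<in>parcs J. (f a, f b) \<in> parcs X"
    using assms(1,5-7) nb_parcs by (auto simp: P3_graph_def K3_graph_def f)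
  ultimately have "copy X J f" unfolding copy_def V by (simp add: f)
  moreover have "f ` pverts J \<subseteq> ball X 3 v" using assms(4) unfolding V by (simp add: f)
  ultimately show ?thesis using assms(2) unfolding near_def by blast
qed

lemma ball_3: "v \<in> ball X 3 v" "a \<in> nb X v \<Longrightarrow> a \<in> ball X 3 v" "a \<in> nb X v \<Longrightarrow> b \<in> nb X a \<Longrightarrow> b \<in> ball X 3 v"
  "a \<in> nb X v \<Longrightarrow> b \<in> nb X a \<Longrightarrow> d \<in> nb X b \<Longrightarrow> d \<in> ball X 3 v"
  by (auto simp: numeral_3_eq_3)

lemma high_degree_near_P3:
  assumes "v \<in> pverts X" and "2 \<le> card (nb X v)"
  shows "v \<in> near X P3_graph"
proof -
  obtain S where "S \<subseteq> nb X v" "card S = 2" using obtain_subset_with_card_n[OF assms(2)] by blast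
  then obtain a b where ab: "a \<in> nb X v" "b \<in> nb X v" "a \<noteq> b" by (auto simp: card_2_iff)
  have "a \<noteq> v" "b \<noteq> v" using ab nb_graph(3)[OF X] by auto
  then show ?thesis
    using ab assms(1) ball_3(1)[of v] ball_3(2)[of a v] ball_3(2)[of b v] nb_graph(4)[OF X, of a v] P3_neq_K3
    by (intro nearI3[where p = a and q = v and r = b]) simp_all
qed

lemma three_neighbours_near_K13:
  assumes v: "v \<in> pverts X" and w: "w \<in> ball X 3 v" "nb X w \<subseteq> ball X 3 v" and d: "3 \<le> card (nb X w)"
  shows "v \<in> near X K13_graph"
proof -
  obtain S where "S \<subseteq> nb X w" "card S = 3" using obtain_subset_with_card_n[OF d] by blast
  then obtain a b e where "S = {a, b, e}" "a \<noteq> b" "b \<noteq> e" "a \<noteq> e" by (auto simp: card_3_iff)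
  with \<open>S \<subseteq> nb X w\<close> have ab: "a \<in> nb X w" "b \<in> nb X w" "e \<in> nb X w" "a \<noteq> b" "b \<noteq> e" "a \<noteq> e"
    by simp_all
  have "a \<noteq> w" "b \<noteq> w" "e \<noteq> w" using ab nb_graph(3)[OF X] by auto
  then show ?thesis
    using ab v w P4_neq_K13 by (intro nearI4[where p = w and q = a and r = b and t = e]) (simp_all, blast)
qed

lemma ex_other_neighbour:
  assumes "card (nb X w) \<noteq> 1" and "v \<in> nb X w"
  shows "\<exists>u\<in>nb X w. u \<noteq> v"
proof (rule ccontr)
  assume "\<not> ?thesis"
  then have "nb X w = {v}" using assms(2) by blast
  then show False using assms(1) by simp
qed

text \<open>By the degree of v. Degree at least 3 gives a star. For degree 2, some neighbour has
  another neighbour besides v, closing a triangle or extending to a path on four vertices. For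
  degree 1, the neighbour w has degree at least 3, giving a star, or leads through a second
  neighbour to a path on four vertices starting at v.\<close>

lemma untyped_near:
  assumes v: "v \<in> pverts X" "v \<notin> K1_verts X \<union> K2_verts X \<union> (P3_centres X \<union> P3_ends X)"
  shows "v \<in> near X K3_graph \<union> near X P4_graph \<union> near X K13_graph"
proof -
  have fin: "finite (nb X v)" for v by (rule nb_graph[OF X])
  have ne: "nb X v \<noteq> {}" using v by (auto simp: K1_verts_def)
  then have "card (nb X v) \<noteq> 0" using fin by simp
  then consider "card (nb X v) = 1" | "card (nb X v) = 2" | "3 \<le> card (nb X v)" by linarith
  then show ?thesis
  proof cases
    case 1
    then obtain w where w: "nb X v = {w}" by (auto simp: card_1_singleton_iff)
    have vw: "v \<in> nb X w" using w nb_graph(4)[OF X, of w v] by auto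
    have w1: "card (nb X w) \<noteq> 1" using v 1 w by (auto simp: K2_verts_def)
    have "w \<notin> P3_centres X" using v 1 w by (auto simp: P3_ends_def)
    moreover have "w \<in> pverts X" using w nb_graph(2)[OF X, of v] by auto
    ultimately have wC: "card (nb X w) \<noteq> 2 \<or> (\<exists>z\<in>nb X w. card (nb X z) \<noteq> 1)" by (auto simp: P3_centres_def)
    have wv: "w \<in> nb X v" using w by simp
    have "card (nb X w) \<noteq> 0" using vw fin by auto
    then consider "3 \<le> card (nb X w)" | "card (nb X w) = 2" using w1 by linarith
    then show ?thesis
    proof cases
      case 1
      then have "v \<in> near X K13_graph"
        using v(1) ball_3(2)[OF wv] ball_3(3)[OF wv] by (intro three_neighbours_near_K13[of v w] subsetI)
      then show ?thesis by simp
    next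
      case 2
      then obtain z where z: "z \<in> nb X w" "card (nb X z) \<noteq> 1" using wC by auto
      have zv: "z \<noteq> v" using z(2) \<open>card (nb X v) = 1\<close> by auto
      have "w \<in> nb X z" using z(1) nb_graph(4)[OF X] by auto
      then obtain y where y: "y \<in> nb X z" "y \<noteq> w" using ex_other_neighbour[OF z(2)] by auto
      have "z \<noteq> w" "y \<noteq> z" "v \<noteq> w" using z y vw nb_graph(3)[OF X] by auto
      moreover have "y \<noteq> v" using y w \<open>z \<noteq> w\<close> nb_graph(4)[OF X, of z v] by auto
      ultimately have "v \<in> near X P4_graph"
        using v(1) wv z(1) y zv P4_neq_K13 ball_3(1)[of v] ball_3(2)[OF wv] ball_3(3)[OF wv z(1)] ball_3(4)[OF wv z(1) y(1)]
        by (intro nearI4[where p = v and q = w and r = z and t = y]) simp_all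
      then show ?thesis by simp
    qed
  next
    case 2
    then obtain a0 where a0: "a0 \<in> nb X v" "card (nb X a0) \<noteq> 1" using v by (auto simp: P3_centres_def)
    have va: "v \<in> nb X a0" using a0(1) nb_graph(4)[OF X] by auto
    obtain e where e: "e \<in> nb X v" "e \<noteq> a0" using ex_other_neighbour[of v a0] 2 a0 by auto
    obtain y where y: "y \<in> nb X a0" "y \<noteq> v" using ex_other_neighbour[OF a0(2) va] by auto
    have ne: "a0 \<noteq> v" "e \<noteq> v" "y \<noteq> a0" using a0 e y nb_graph(3)[OF X] by auto
    have ya: "a0 \<in> nb X y" using y(1) nb_graph(4)[OF X] by auto
    show ?thesis
    proof (cases "y = e")
      case True
      then have "v \<in> near X K3_graph"
        using v(1) a0 e y ne ball_3(1)[of v] ball_3(2)[OF a0(1)] ball_3(2)[OF e(1)]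
        by (intro nearI3[where p = v and q = a0 and r = y]) simp_all
      then show ?thesis by simp
    next
      case False
      then have "v \<in> near X P4_graph"
        using v(1) a0 e y ne ya va P4_neq_K13 ball_3(1)[of v] ball_3(2)[OF a0(1)] ball_3(2)[OF e(1)] ball_3(3)[OF a0(1) y(1)]
        by (intro nearI4[where p = y and q = a0 and r = v and t = e]) simp_all
      then show ?thesis by simp
    qed
  next
    case 3
    then have "v \<in> near X K13_graph"
      using v(1) ball_3(1)[of v] ball_3(2)[of _ v] by (intro three_neighbours_near_K13[of v v] subsetI)
    then show ?thesis by simp
  qed
qed

lemma finite_near: "finite (near X J)"
  using pair_graphD(1)[OF X] by (simp add: near_def)

lemma card_untyped:
  assumes "card (near X K3_graph) \<le> M" "card (near X P4_graph) \<le> M" "card (near X K13_graph) \<le> M"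
  shows "card (pverts X - (K1_verts X \<union> K2_verts X \<union> (P3_centres X \<union> P3_ends X))) \<le> 3 * M"
proof -
  have "pverts X - (K1_verts X \<union> K2_verts X \<union> (P3_centres X \<union> P3_ends X))
      \<subseteq> near X K3_graph \<union> near X P4_graph \<union> near X K13_graph"
    using untyped_near by blast
  then have "card (pverts X - (K1_verts X \<union> K2_verts X \<union> (P3_centres X \<union> P3_ends X)))
      \<le> card (near X K3_graph \<union> near X P4_graph \<union> near X K13_graph)"
    using finite_near by (intro card_mono) auto
  also have "\<dots> \<le> card (near X K3_graph \<union> near X P4_graph) + card (near X K13_graph)" by (rule card_Un_le)
  also have "card (near X K3_graph \<union> near X P4_graph) \<le> card (near X K3_graph) + card (near X P4_graph)"
    by (rule card_Un_le)
  finally show ?thesis using assms by linarith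
qed

text \<open>A vertex outside these two types has degree at least 2 or is a neighbour of such a
  vertex; vertices of degree at least 2 lie in \<open>near X P3_graph\<close>.\<close>

lemma card_not_K12:
  assumes deg: "\<And>v. card (nb X v) \<le> c" and few: "card (near X P3_graph) \<le> M"
  shows "card (pverts X - (K1_verts X \<union> K2_verts X)) \<le> M * (c + 1)"
proof -
  let ?N = "near X P3_graph"
  have "pverts X - (K1_verts X \<union> K2_verts X) \<subseteq> ?N \<union> (\<Union>w\<in>?N. nb X w)"
  proof
    fix v assume v: "v \<in> pverts X - (K1_verts X \<union> K2_verts X)"
    have "nb X v \<noteq> {}" using v by (auto simp: K1_verts_def)
    then have "card (nb X v) \<noteq> 0" using nb_graph(1)[OF X] by simp
    show "v \<in> ?N \<union> (\<Union>w\<in>?N. nb X w)"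
    proof (cases "2 \<le> card (nb X v)")
      case True
      then show ?thesis using high_degree_near_P3[of v] v by auto
    next
      case False
      then have "card (nb X v) = 1" using \<open>card (nb X v) \<noteq> 0\<close> by simp
      then obtain w where w: "w \<in> nb X v" "card (nb X w) \<noteq> 1" using v by (auto simp: K2_verts_def)
      have vw: "v \<in> nb X w" using w(1) nb_graph(4)[OF X, of w v] by auto
      then have "card (nb X w) \<noteq> 0" using nb_graph(1)[OF X] by auto
      then have "2 \<le> card (nb X w)" using w(2) by simp
      then have "w \<in> ?N" using high_degree_near_P3[of w] w(1) nb_graph(2)[OF X] by auto
      then show ?thesis using vw by auto
    qed
  qed
  then have "card (pverts X - (K1_verts X \<union> K2_verts X)) \<le> card (?N \<union> (\<Union>w\<in>?N. nb X w))"
    using finite_near nb_graph(1)[OF X] by (intro card_mono) auto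
  also have "\<dots> \<le> card ?N + card (\<Union>w\<in>?N. nb X w)" by (rule card_Un_le)
  also have "card (\<Union>w\<in>?N. nb X w) \<le> (\<Sum>w\<in>?N. card (nb X w))" by (rule card_UN_le[OF finite_near])
  also have "\<dots> \<le> (\<Sum>w\<in>?N. c)" by (rule sum_mono) (rule deg)
  also have "\<dots> = card ?N * c" by simp
  also have "card ?N + card ?N * c = card ?N * (c + 1)" by simp
  also have "\<dots> \<le> M * (c + 1)" using few by (rule mult_le_mono1)
  finally show ?thesis by simp
qed

text \<open>Charge each vertex with 4 - 3d, where d is its degree. A path component has total charge
  -2 + 1 + 1 = 0, a K1 or K2 vertex has charge at least 1, and an untyped vertex at least -3c. The
  total 4|V| - 6 e(X) is at most 8 by the edge bound, so few K1 and K2 vertices exist.\<close>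

lemma card_not_P3:
  assumes deg: "\<And>v. card (nb X v) \<le> c"
    and untyped: "card (pverts X - (K1_verts X \<union> K2_verts X \<union> (P3_centres X \<union> P3_ends X))) \<le> M"
    and edges: "2 * (card (pverts X) div 3) \<le> num_edges X"
  shows "card (pverts X - (P3_centres X \<union> P3_ends X)) \<le> M + (8 + 3 * c * M)"
proof -
  let ?V = "pverts X" and ?P = "P3_centres X \<union> P3_ends X" and ?K = "K1_verts X \<union> K2_verts X"
  let ?U = "?V - (?K \<union> ?P)"
  let ?h = "\<lambda>v. 4 - 3 * int (card (nb X v))"
  have fV: "finite ?V" by (rule pair_graphD[OF X])
  have sub: "?K \<subseteq> ?V" "?P \<subseteq> ?V" by (auto simp: K1_verts_def K2_verts_def P3_centres_def P3_ends_def)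
  have fin: "finite ?K" "finite ?P" "finite (P3_centres X)" "finite (P3_ends X)"
    using sub fV by (auto intro: finite_subset)
  have disj: "?K \<inter> ?P = {}" using types_disjoint[OF X] by blast
  have "(\<Sum>v\<in>?V. ?h v) = (\<Sum>v\<in>?U. ?h v) + (\<Sum>v\<in>?K \<union> ?P. ?h v)"
    by (rule sum.subset_diff) (use sub fV in auto)
  also have "(\<Sum>v\<in>?K \<union> ?P. ?h v) = (\<Sum>v\<in>?K. ?h v) + (\<Sum>v\<in>?P. ?h v)"
    by (rule sum.union_disjoint[OF fin(1,2) disj])
  also have "(\<Sum>v\<in>?P. ?h v) = (\<Sum>v\<in>P3_centres X. ?h v) + (\<Sum>v\<in>P3_ends X. ?h v)"
    by (rule sum.union_disjoint[OF fin(3,4) types_disjoint(6)[OF X]])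
  also have "(\<Sum>v\<in>P3_centres X. ?h v) = (\<Sum>v\<in>P3_centres X. - 2)"
    by (rule sum.cong) (auto simp: P3_centres_def)
  also have "(\<Sum>v\<in>P3_ends X. ?h v) = (\<Sum>v\<in>P3_ends X. 1)"
    by (rule sum.cong) (auto simp: P3_ends_def)
  also have "(\<Sum>v\<in>P3_centres X. - 2) + (\<Sum>v\<in>P3_ends X. 1) = (0::int)"
    using card_P3_ends[OF X] by simp
  finally have tot: "(\<Sum>v\<in>?V. ?h v) = (\<Sum>v\<in>?U. ?h v) + (\<Sum>v\<in>?K. ?h v)" by simp
  have "int (card ?K) = (\<Sum>v\<in>?K. 1)" by simp
  also have "\<dots> \<le> (\<Sum>v\<in>?K. ?h v)"
    by (rule sum_mono) (auto simp: K1_verts_def K2_verts_def)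
  finally have K: "int (card ?K) \<le> (\<Sum>v\<in>?K. ?h v)" .
  have "- (3 * int c * int M) \<le> - (3 * int c) * int (card ?U)"
    using untyped by (simp add: mult_left_mono)
  also have "\<dots> = (\<Sum>v\<in>?U. - (3 * int c))" by simp
  also have "\<dots> \<le> (\<Sum>v\<in>?U. ?h v)"
  proof (rule sum_mono)
    fix v
    have "int (card (nb X v)) \<le> int c" using deg[of v] by simp
    then show "- (3 * int c) \<le> ?h v" by linarith
  qed
  finally have U: "- (3 * int c * int M) \<le> (\<Sum>v\<in>?U. ?h v)" .
  have "(\<Sum>v\<in>?V. ?h v) = 4 * int (card ?V) - 3 * int (\<Sum>v\<in>?V. card (nb X v))"
    by (simp add: sum_subtractf sum_distrib_left)
  also have "\<dots> = 4 * int (card ?V) - 6 * int (num_edges X)" unfolding sum_degrees[OF X] by simp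
  also have "\<dots> \<le> 8"
  proof -
    \<comment> \<open>The constant 8 is four times the largest remainder modulo 3.\<close>
    have "card ?V \<le> 3 * (card ?V div 3) + 2" by linarith
    then have "4 * card ?V \<le> 6 * num_edges X + 8" using edges by linarith
    then show ?thesis by linarith
  qed
  finally have "int (card ?K) \<le> 8 + 3 * int c * int M" using tot K U by linarith
  then have cK: "card ?K \<le> 8 + 3 * c * M" by (metis of_nat_le_iff of_nat_add of_nat_mult of_nat_numeral)
  have "card (?V - ?P) \<le> card (?U \<union> ?K)" using fV fin by (intro card_mono) auto
  also have "\<dots> \<le> card ?U + card ?K" by (rule card_Un_le)
  finally show ?thesis using cK untyped by linarith
qed

end

section \<open>Conclusion\<close>


lemma contains_join_edgeless:
  assumes X: "pair_graph X" "card (pverts X) = m"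
  shows "contains (T \<^bold>\<or> X) (T \<^bold>\<or> edgeless_graph m)"
proof -
  obtain h where h: "h ` {..<m} \<subseteq> pverts X" "inj_on h {..<m}"
    using card_le_inj[of "{..<m}" "pverts X"] X(2) pair_graphD(1)[OF X(1)] by auto
  define f where "f v = (case sum_decode v of Inl u \<Rightarrow> inl u | Inr u \<Rightarrow> inr (h u))" for v
  have f: "f (inl u) = inl u" "f (inr u) = inr (h u)" for u by (simp_all add: f_def)
  have V: "pverts (edgeless_graph m) = {..<m}" "parcs (edgeless_graph m) = {}"
    by (simp_all add: edgeless_graph_def)
  show ?thesis
  proof (rule containsI[where f = f])
    show "inj_on f (pverts (T \<^bold>\<or> edgeless_graph m))"
      using h(2) by (auto simp: inj_on_def pverts_join V f sum_encode_eq)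
    show "f v \<in> pverts (T \<^bold>\<or> X)" if "v \<in> pverts (T \<^bold>\<or> edgeless_graph m)" for v
      using that h(1) by (auto simp: pverts_join V f)
    show "(f u, f v) \<in> parcs (T \<^bold>\<or> X)" if "(u, v) \<in> parcs (T \<^bold>\<or> edgeless_graph m)" for u v
      using that h(1) by (auto simp: graph_join_eq V f)
  qed
qed

context graph_family
begin

text \<open>The vertex v together with \<open>L\<close> gives s + 1 vertices; \<open>c\<close>
  neighbours of v outside \<open>L\<close> would complete a forbidden bipartite graph.\<close>

lemma degree_outside_core_le:
  assumes G: "pair_graph G" "free_of \<F> G" and L: "L \<subseteq> pverts G" "card L = s"
    and join: "\<And>v. v \<in> pverts G - L \<Longrightarrow> L \<subseteq> nb G v" and v: "v \<in> pverts G - L"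
  shows "card (nb G v - L) \<le> c"
proof (rule ccontr)
  assume "\<not> ?thesis"
  then have "c \<le> card (nb G v - L)" by simp
  then obtain B where B: "B \<subseteq> nb G v - L" "card B = c" by (rule obtain_subset_with_card_n)
  have fL: "finite L" using L(1) pair_graphD(1)[OF G(1)] by (rule finite_subset)
  have BV: "B \<subseteq> pverts G - L" using B(1) nb_graph(2)[OF G(1)] by blast
  have "\<exists>a\<in>insert v L. \<exists>b\<in>B. b \<notin> nb G a"
  proof (rule free_no_complete_bipartite[OF G])
    show "insert v L \<subseteq> pverts G" using v L by auto
    show "B \<subseteq> pverts G" using BV by auto
    show "card (insert v L) = s + 1" using v L fL by simp
    show "insert v L \<inter> B = {}" using B(1) nb_graph(3)[OF G(1)] by auto
  qed (rule B)
  then obtain a b where ab: "a \<in> insert v L" "b \<in> B" "b \<notin> nb G a" by blast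
  have "a \<in> nb G b"
  proof (cases "a = v")
    case True
    then show ?thesis using ab B(1) nb_graph(4)[OF G(1), of b v] by auto
  next
    case False
    then show ?thesis using ab join[of b] BV by auto
  qed
  then show False using ab(3) nb_graph(4)[OF G(1), of a b] by blast
qed

lemma join_free_degree_le:
  assumes T: "pair_graph T" "card (pverts T) = s" and X: "pair_graph X" and free: "free_of \<F> (T \<^bold>\<or> X)"
  shows "card (nb X v) \<le> c"
proof (cases "v \<in> pverts X")
  case True
  have L: "inl ` pverts T \<subseteq> pverts (T \<^bold>\<or> X)" "card (inl ` pverts T) = s"
    using T(2) by (auto simp: pverts_join card_image inj_inl)
  have rest: "pverts (T \<^bold>\<or> X) - inl ` pverts T = inr ` pverts X" by (auto simp: pverts_join sum_encode_eq)
  have "card (nb (T \<^bold>\<or> X) (inr v) - inl ` pverts T) \<le> c"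
    by (rule degree_outside_core_le[OF pair_graph_join[OF T(1) X] free L])
      (use True rest in \<open>auto simp: nb_join\<close>)
  moreover have "nb (T \<^bold>\<or> X) (inr v) - inl ` pverts T = inr ` nb X v"
    using True by (auto simp: nb_join sum_encode_eq)
  ultimately show ?thesis by (simp add: card_image inj_inr)
next
  case False
  then show ?thesis using nb_graph(5)[OF X] by simp
qed

text \<open>Otherwise \<open>c\<close> disjoint copies of J exist, and
  \<open>many_copies_imp_edges\<close> contradicts the bound on e(H). The number c (c + 1)^6 is the
  supply of centres that the greedy choice requires.\<close>

lemma few_near:
  assumes hyp: "hyp C n H" and T: "T \<in> extremal s (\<H> \<F>)"
    and X: "pair_graph X" "card (pverts X) = n - s" "free_of \<F> (T \<^bold>\<or> X)"
    and J: "pair_graph J" "pverts J = {..<j}" and j: "0 < j" "j \<le> 4" and big: "c * 4 + c \<le> n - s"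
    and H: "num_edges H < num_edges J * ((n - s) div j)"
  shows "card (near X J) \<le> c * (c + 1) ^ 6"
proof (rule ccontr)
  assume "\<not> ?thesis"
  then have B: "c * (c + 1) ^ 6 \<le> card {v \<in> pverts X. \<exists>f. copy X J f \<and> f ` pverts J \<subseteq> ball X 3 v}"
    unfolding near_def by simp
  have "c * j + c \<le> n - s" using big mult_le_mono2[OF j(2), of c] by linarith
  from many_copies_imp_edges[OF hyp T X join_free_degree_le[OF extremalD(1,2)[OF T] X(1,3)] J j(1) this B]
  show False using H by simp
qed

text \<open>The gap 9 is three times the largest remainder modulo 4, so e(H) lies below the size of
  a maximal union of four-vertex trees; the analogous bound for triangles is weaker and follows as
  well.\<close>

lemma few_untyped:
  assumes hyp: "hyp C n H" and T: "T \<in> extremal s (\<H> \<F>)"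
    and X: "pair_graph X" "card (pverts X) = n - s" "free_of \<F> (T \<^bold>\<or> X)"
    and big: "c * 4 + c \<le> n - s" and H: "4 * num_edges H + 9 < 3 * (n - s)"
  shows "card (pverts X - (K1_verts X \<union> K2_verts X \<union> (P3_centres X \<union> P3_ends X))) \<le> 3 * (c * (c + 1) ^ 6)"
proof -
  have 3: "num_edges H < 3 * ((n - s) div 3)"
  proof -
    have "n - s \<le> 3 * ((n - s) div 3) + 2" by linarith
    then show ?thesis using H by linarith
  qed
  have 4: "num_edges H < 3 * ((n - s) div 4)"
  proof -
    have "n - s \<le> 4 * ((n - s) div 4) + 3" by linarith
    then show ?thesis using H by linarith
  qed
  show ?thesis
    by (intro card_untyped[OF X(1)] few_near[OF hyp T X small_graphs(1) pverts_small_graphs(1) _ _ big]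
        few_near[OF hyp T X small_graphs(3) pverts_small_graphs(3) _ _ big]
        few_near[OF hyp T X small_graphs(4) pverts_small_graphs(4) _ _ big])
      (use 3 4 in \<open>simp_all add: num_edges_small_graphs\<close>)
qed

lemma spectral_extremal_edges:
  fixes r C :: real
  assumes r: "0 \<le> r" "r < 3 / 4"
  shows "\<exists>N. \<forall>n\<ge>N. \<forall>H G. hyp C n H \<longrightarrow> real (num_edges H) \<le> r * real n + C \<longrightarrow> G \<in> extremal_sp n \<F> \<longrightarrow>
    (\<exists>T\<in>extremal s (\<H> \<F>). G \<in> extremal n \<F> \<and> contains G (T \<^bold>\<or> edgeless_graph (n - s)))"
proof -
  have rs: "1 \<le> real s" and rc: "1 \<le> real c" using s c by simp_all
  \<comment> \<open>Normalised so that c (s + 1)^2 \<delta> = 1/25; since 2(s + 1) and s^2 are at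
    most (s + 1)^2, all four requirements \<open>d2\<close> to \<open>d5\<close> follow.\<close>
  define \<delta> where "\<delta> = 1 / (25 * real c * (real s + 1)\<^sup>2)"
  have dpos: "0 < \<delta>" using rc rs by (simp add: \<delta>_def)
  have dcs: "real c * ((real s + 1)\<^sup>2 * \<delta>) = 1 / 25" using rc rs by (simp add: \<delta>_def)
  have s2: "2 * (real s + 1) \<le> (real s + 1)\<^sup>2" "real s * real s \<le> (real s + 1)\<^sup>2"
    unfolding power2_eq_square using rs by (intro mult_mono; simp)+
  have sd: "(real s + 1)\<^sup>2 * \<delta> \<le> 1 / 25"
  proof -
    have "1 * ((real s + 1)\<^sup>2 * \<delta>) \<le> real c * ((real s + 1)\<^sup>2 * \<delta>)"
      using rc dpos by (intro mult_right_mono) auto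
    then show ?thesis using dcs by simp
  qed
  have ssd: "2 * ((real s + 1) * \<delta>) \<le> (real s + 1)\<^sup>2 * \<delta>"
    using mult_right_mono[OF s2(1) less_imp_le[OF dpos]] by (simp only: mult.assoc)
  have d2: "4 * (real s + 1) * \<delta> \<le> 1" using sd ssd by argo
  have d3: "3 * real c * ((4 * real s + 4) * \<delta>) < 1 / 2"
  proof -
    have "real c * (2 * ((real s + 1) * \<delta>)) \<le> real c * ((real s + 1)\<^sup>2 * \<delta>)"
      using ssd by (intro mult_left_mono) auto
    then have "real c * (2 * ((real s + 1) * \<delta>)) \<le> 1 / 25" using dcs by simp
    moreover have "3 * real c * ((4 * real s + 4) * \<delta>) = 6 * (real c * (2 * ((real s + 1) * \<delta>)))"
      by (simp add: algebra_simps)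
    ultimately show ?thesis by linarith
  qed
  have d4: "\<delta> * real (s * s) \<le> 1 / 2"
    using mult_right_mono[OF s2(2) less_imp_le[OF dpos]] sd by (simp add: mult.commute)
  have d5: "\<delta> < 1"
  proof -
    have "1 * \<delta> \<le> (real s + 1) * \<delta>" using dpos by (intro mult_right_mono) auto
    then show ?thesis using ssd sd by linarith
  qed
  obtain N0 where N0: "\<forall>n\<ge>N0. \<forall>H G. hyp C n H \<longrightarrow> G \<in> extremal_sp n \<F> \<longrightarrow>
    (\<exists>x L. (\<forall>v. 0 \<le> x v) \<and> (\<forall>v\<in>pverts G. x v \<le> 1)
      \<and> (\<forall>v\<in>pverts G. graph_spectral_radius G * x v \<le> (\<Sum>w\<in>nb G v. x w))
      \<and> L \<subseteq> pverts G \<and> card L = s \<and> (\<forall>w\<in>L. 1 - \<delta> \<le> x w) \<and> (\<forall>v\<in>pverts G - L. L \<subseteq> nb G v)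
      \<and> 0 \<le> graph_spectral_radius G \<and> real s * (real n - real s) \<le> (graph_spectral_radius G)\<^sup>2)"
    using spectral_extremal_structure[OF dpos d2 d3, of C] ..
  define M where "M = c * (c + 1) ^ 6"
  \<comment> \<open>The sum of the bounds on leftover vertices from all cases, so that one value
    serves both alternatives.\<close>
  define K where "K = 3 * M + (8 + 3 * c * (3 * M)) + M * (c + 1)"
  \<comment> \<open>The sum of all lower bounds demanded of \<rho>; a summand 1 is added where the
    demand is strict.\<close>
  define \<rho>0 where "\<rho>0 = 4 + 2 * real c + (2 * real s ^ 2 * (2 * real s ^ 2 + 4 * real c + 2 * real c * \<bar>C\<bar>) + 1)
    + real c * (real c + 3) + (real K * (real c * (real c + 3) + 4 * real c) + 1)"
  \<comment> \<open>The term with \<rho>0 works through \<rho>^2 \<ge> n/2; the last one turns the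
    strict inequality r < 3/4 into \<open>H9\<close>.\<close>
  define N where "N = N0 + 5 * c + 2 * s + nat \<lceil>2 * \<rho>0\<^sup>2\<rceil> + nat \<lceil>(4 * C + 3 * real s + 10) / (3 - 4 * r)\<rceil>"
  have "\<exists>T\<in>extremal s (\<H> \<F>). G \<in> extremal n \<F> \<and> contains G (T \<^bold>\<or> edgeless_graph (n - s))"
    if nN: "n \<ge> N" and hyp: "hyp C n H" and Hr: "real (num_edges H) \<le> r * real n + C"
      and Gx: "G \<in> extremal_sp n \<F>" for n H G
  proof -
    let ?\<rho> = "graph_spectral_radius G"
    have n: "N0 \<le> n" "c * 4 + c \<le> n - s" "c \<le> n - s" "2 * s \<le> n" using nN by (auto simp: N_def)
    have n1: "2 * \<rho>0\<^sup>2 \<le> real n" using nN unfolding N_def by linarith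
    have "(4 * C + 3 * real s + 10) / (3 - 4 * r) \<le> real n" using nN unfolding N_def by linarith
    then have n2: "4 * C + 3 * real s + 10 \<le> real n * (3 - 4 * r)" using r by (simp add: pos_divide_le_eq)
    have H9: "4 * num_edges H + 9 < 3 * (n - s)"
    proof -
      have "real n * (3 - 4 * r) = 3 * real n - 4 * (r * real n)" by (simp add: algebra_simps)
      then have "real (4 * num_edges H + 9) < 3 * (real n - real s)" using n2 Hr by simp
      also have "3 * (real n - real s) = real (3 * (n - s))" using n(4) by (simp add: of_nat_diff)
      finally show ?thesis by (simp only: of_nat_less_iff)
    qed
    note D = extremal_spD[OF Gx]
    have Gfree: "G \<in> free_graphs n \<F>" using D by (simp add: free_graphs_def)
    have HD: "pair_graph H" "card (pverts H) = n - s" "real (num_edges H) \<le> real n + C"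
      and HT: "\<And>T. T \<in> extremal s (\<H> \<F>) \<Longrightarrow> T \<^bold>\<or> H \<in> extremal n \<F>"
      using hyp by (auto simp: hyp_def)
    have max: "graph_spectral_radius (T \<^bold>\<or> H) \<le> ?\<rho>" if "T \<in> extremal s (\<H> \<F>)" for T
      using extremalD[OF HT[OF that]] by (intro D(4)) (simp add: free_graphs_def)
    obtain x L where x: "\<forall>v. 0 \<le> x v" "\<forall>v\<in>pverts G. x v \<le> 1"
      "\<forall>v\<in>pverts G. ?\<rho> * x v \<le> (\<Sum>w\<in>nb G v. x w)" "\<forall>w\<in>L. 1 - \<delta> \<le> x w"
      and L: "L \<subseteq> pverts G" "card L = s" "\<forall>v\<in>pverts G - L. L \<subseteq> nb G v"
      and rho: "0 \<le> ?\<rho>" "real s * (real n - real s) \<le> ?\<rho>\<^sup>2"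
      using N0[rule_format, OF n(1) hyp Gx] by blast
    have L3: "L \<subseteq> nb G v" if "v \<in> pverts G - L" for v using L(3) that by blast
    interpret E: joined G n s c x ?\<rho> L \<delta>
    proof (rule joined.intro)
      show "card (nb G v - L) \<le> c" if "v \<in> pverts G - L" for v
        by (rule degree_outside_core_le[OF D(1,3) L(1,2) L3 that])
    qed (use D s L x dpos d5 in auto)
    have "1 * (real n / 2) \<le> real s * (real n - real s)" using s n by (intro mult_mono) auto
    then have nrho: "real n \<le> 2 * ?\<rho>\<^sup>2" using rho(2) by linarith
    have rho0: "\<rho>0 \<le> ?\<rho>" by (rule power2_le_imp_le[OF _ rho(1)]) (use n1 nrho in linarith)
    have parts: "0 \<le> 2 * real s ^ 2 * (2 * real s ^ 2 + 4 * real c + 2 * real c * \<bar>C\<bar>)"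
      "0 \<le> real c * (real c + 3)" "0 \<le> real K * (real c * (real c + 3) + 4 * real c)" by simp_all
    have rhos: "4 \<le> ?\<rho>" "2 * real c \<le> ?\<rho>" "2 * real s ^ 2 * (2 * real s ^ 2 + 4 * real c + 2 * real c * \<bar>C\<bar>) < ?\<rho>"
      "real c * (real c + 3) \<le> ?\<rho>" "real K * (real c * (real c + 3) + 4 * real c) < ?\<rho>"
      using rho0 parts rc unfolding \<rho>0_def by linarith+
    have TL: "E.T \<in> free_graphs s (\<H> \<F>)"
      unfolding E.T_def
    proof (rule join_free_imp_\<H>_free[OF D(1,3) L(1,2) L3])
      show "c \<le> card (pverts G - L)" using n(3) E.card_R E.R(2) by simp
    qed
    obtain T0 where T0: "T0 \<in> extremal s (\<H> \<F>)" using ex_extremal_\<H> by auto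
    note T0D = extremalD[OF T0]
    have "num_edges E.T = num_edges T0"
    proof (rule ccontr)
      assume "num_edges E.T \<noteq> num_edges T0"
      then have "num_edges E.T < num_edges T0" using T0D(4)[OF TL] by simp
      then have "?\<rho> < graph_spectral_radius (T0 \<^bold>\<or> H)"
        by (rule E.fewer_core_edges_imp_not_maximal[OF T0D(1,2) HD(1,2) _ hyp_num_edges_le[OF hyp T0 Gfree]
            num_edges_le_square[OF T0D(1,2)] d4 HD(3) nrho c rhos(2,3)])
      then show False using max[OF T0] by simp
    qed
    then have T: "E.T \<in> extremal s (\<H> \<F>)"
      using TL T0D(4) by (auto simp: extremal_def is_arg_max_def not_less)
    note TD = extremalD[OF T]
    have Gle: "num_edges G \<le> num_edges E.T + num_edges H + s * (n - s)"
      by (rule hyp_num_edges_le[OF hyp T Gfree])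
    have Rfree: "free_of \<F> (E.T \<^bold>\<or> E.R)"
      using contains_trans[OF E.contains_join _ fam] D(3) unfolding free_of_def by blast
    have Hfree: "free_of \<F> (E.T \<^bold>\<or> H)" by (rule extremalD[OF HT[OF T]])
    have "num_edges E.R = num_edges H"
    proof (rule ccontr)
      assume "num_edges E.R \<noteq> num_edges H"
      then have less: "num_edges E.R < num_edges H" using Gle E.num_edges_G by simp
      note degR = join_free_degree_le[OF TD(1,2) E.R(1) Rfree] and degH = join_free_degree_le[OF TD(1,2) HD(1) Hfree]
      have unR: "card (pverts E.R - (K1_verts E.R \<union> K2_verts E.R \<union> (P3_centres E.R \<union> P3_ends E.R))) \<le> 3 * M"
        unfolding M_def by (rule few_untyped[OF hyp T E.R(1) E.card_R Rfree n(2) H9])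
      have unH: "card (pverts H - (K1_verts H \<union> K2_verts H \<union> (P3_centres H \<union> P3_ends H))) \<le> 3 * M"
        unfolding M_def by (rule few_untyped[OF hyp T HD(1,2) Hfree n(2) H9])
      have "(card (pverts E.R - (K1_verts E.R \<union> K2_verts E.R)) \<le> K \<and> card (pverts H - (K1_verts H \<union> K2_verts H)) \<le> K)
        \<or> (card (pverts E.R - (K1_verts E.R \<union> K2_verts E.R \<union> (P3_centres E.R \<union> P3_ends E.R))) \<le> K
         \<and> card (pverts H - (P3_centres H \<union> P3_ends H)) \<le> K)"
      \<comment> \<open>The threshold is the size of a maximal disjoint union of P3. Below it
        neither graph can have many P3; at or above it the charge argument shows that H is almost
        entirely made of them.\<close>
      proof (cases "2 * ((n - s) div 3) \<le> num_edges H")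
        case True
        then have "card (pverts H - (P3_centres H \<union> P3_ends H)) \<le> 3 * M + (8 + 3 * c * (3 * M))"
          using HD(2) by (intro card_not_P3[OF HD(1) degH unH]) simp
        then have "card (pverts H - (P3_centres H \<union> P3_ends H)) \<le> K" unfolding K_def by linarith
        moreover have "3 * M \<le> K" unfolding K_def by linarith
        ultimately show ?thesis using unR by linarith
      next
        case False
        have P3: "card (near X P3_graph) \<le> M"
          if "pair_graph X" "card (pverts X) = n - s" "free_of \<F> (E.T \<^bold>\<or> X)" for X
          unfolding M_def
          by (rule few_near[OF hyp T that small_graphs(2) pverts_small_graphs(2) _ _ n(2)])
            (use False in \<open>simp_all add: num_edges_small_graphs\<close>)
        have "card (pverts E.R - (K1_verts E.R \<union> K2_verts E.R)) \<le> M * (c + 1)"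
          by (rule card_not_K12[OF E.R(1) degR P3[OF E.R(1) E.card_R Rfree]])
        moreover have "card (pverts H - (K1_verts H \<union> K2_verts H)) \<le> M * (c + 1)"
          by (rule card_not_K12[OF HD(1) degH P3[OF HD(1,2) Hfree]])
        moreover have "M * (c + 1) \<le> K" unfolding K_def by linarith
        ultimately show ?thesis by linarith
      qed
      from ex_separating_solutions[OF E.R(1) degR HD(1) degH _ less this rhos(1,4,5)]
      obtain \<phi> \<zeta> where "\<forall>v\<in>pverts E.R. 0 \<le> \<phi> v \<and> 1 + (\<Sum>w\<in>nb E.R v. \<phi> w) \<le> ?\<rho> * \<phi> v"
        "\<forall>v\<in>pverts H. 0 \<le> \<zeta> v \<and> ?\<rho> * \<zeta> v \<le> 1 + (\<Sum>w\<in>nb H v. \<zeta> w)"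
        "(\<Sum>v\<in>pverts E.R. \<phi> v) < (\<Sum>v\<in>pverts H. \<zeta> v)"
        using E.card_R HD(2) by auto
      then have "?\<rho> < graph_spectral_radius (E.T \<^bold>\<or> H)"
        by (intro E.subsolution_exceeds_imp_not_maximal[OF HD(1), of \<phi> \<zeta>]) auto
      then show False using max[OF T] by simp
    qed
    then have "num_edges G = num_edges (E.T \<^bold>\<or> H)"
      using E.num_edges_G num_edges_join[OF TD(1) HD(1)] TD(2) HD(2) by simp
    then have "G \<in> extremal n \<F>"
      using Gfree extremalD(4)[OF HT[OF T]] by (auto simp: extremal_def is_arg_max_def not_less)
    moreover have "contains G (E.T \<^bold>\<or> edgeless_graph (n - s))"
    proof (rule contains_trans[OF E.contains_join contains_join_edgeless[OF E.R(1) E.card_R]])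
      show "pair_graph (E.T \<^bold>\<or> edgeless_graph (n - s))"
        by (rule pair_graph_join[OF TD(1)]) (auto simp: edgeless_graph_def intro: pair_graphI)
    qed
    ultimately show ?thesis using T by blast
  qed
  then show ?thesis by blast
qed

end

theorem theorem1p3:
  fixes \<F> :: "ngraph set" and r C :: real
  assumes "finite_degenerate \<F>"
    and "2 \<le> \<beta>'_fam \<F>"
    and "0 \<le> r" and "r < 3 / 4"
  shows "\<exists>N. \<forall>n\<ge>N. \<forall>H.
    pair_graph H \<longrightarrow>
    card (pverts H) = n + 1 - the_enat (\<beta>'_fam \<F>) \<longrightarrow>
    real (num_edges H) \<le> r * real n + C \<longrightarrow>
    {T \<^bold>\<or> H |T. T \<in> extremal (the_enat (\<beta>'_fam \<F>) - 1) (\<H> \<F>)} \<subseteq> extremal n \<F> \<longrightarrow>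
    extremal_sp n \<F> \<subseteq> \<G> n \<F> \<and> \<G> n \<F> \<subseteq> extremal n \<F>"
proof -
  obtain F c0 where fam: "\<And>F. F \<in> \<F> \<Longrightarrow> pair_graph F" and F: "F \<in> \<F>" "bipartite F"
    and c0: "\<And>F. F \<in> \<F> \<Longrightarrow> card (pverts F) \<le> c0"
    using assms(1) unfolding finite_degenerate_def by auto
  have "\<beta>' F \<noteq> \<infinity>" using \<beta>'_infinity_iff[OF fam[OF F(1)]] F(2) by simp
  moreover have "\<beta>'_fam \<F> \<le> \<beta>' F" unfolding \<beta>'_fam_def by (rule INF_lower[OF F(1)])
  ultimately obtain k where k: "\<beta>'_fam \<F> = enat k" by (cases "\<beta>'_fam \<F>") auto
  have k2: "2 \<le> k" using assms(2) unfolding k by (simp add: numeral_eq_enat)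
  define s where "s = k - 1"
  have ks: "k = s + 1" "1 \<le> s" using k2 by (auto simp: s_def)
  \<comment> \<open>The order bound is raised by one so that the constant \<open>c\<close> of the
    locale is positive.\<close>
  interpret graph_family \<F> s "c0 + 1"
  proof (rule graph_family.intro)
    show "card (pverts F) \<le> c0 + 1" if "F \<in> \<F>" for F using c0[OF that] by simp
  qed (use fam k ks in auto)
  have the: "the_enat (\<beta>'_fam \<F>) = s + 1" unfolding k ks(1) by simp
  obtain N0 where N0: "\<forall>n\<ge>N0. \<forall>H G. hyp C n H \<longrightarrow> real (num_edges H) \<le> r * real n + C \<longrightarrow> G \<in> extremal_sp n \<F> \<longrightarrow>
    (\<exists>T\<in>extremal s (\<H> \<F>). G \<in> extremal n \<F> \<and> contains G (T \<^bold>\<or> edgeless_graph (n - s)))"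
    using spectral_extremal_edges[OF assms(3,4), of C] ..
  have "extremal_sp n \<F> \<subseteq> \<G> n \<F> \<and> \<G> n \<F> \<subseteq> extremal n \<F>"
    if n: "n \<ge> N0 + 2 * s" and H: "pair_graph H" "card (pverts H) = n - s" "real (num_edges H) \<le> r * real n + C"
      and ext: "{T \<^bold>\<or> H |T. T \<in> extremal s (\<H> \<F>)} \<subseteq> extremal n \<F>" for n H
  proof
    have HT: "T \<^bold>\<or> H \<in> extremal n \<F>" if "T \<in> extremal s (\<H> \<F>)" for T using ext that by blast
    have "r * real n \<le> 1 * real n" using assms(4) by (intro mult_right_mono) auto
    then have hyp: "hyp C n H" using H HT n by (auto simp: hyp_def)
    have GG: "\<G> n \<F> = (\<Union>T\<in>extremal s (\<H> \<F>). extremal_containing (T \<^bold>\<or> edgeless_graph (n - s)) n \<F>)"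
      unfolding \<G>_def \<G>\<^sub>0_def the by auto
    show "extremal_sp n \<F> \<subseteq> \<G> n \<F>"
    proof
      fix G assume "G \<in> extremal_sp n \<F>"
      then obtain T where T: "T \<in> extremal s (\<H> \<F>)" "G \<in> extremal n \<F>" "contains G (T \<^bold>\<or> edgeless_graph (n - s))"
        using N0 n hyp H(3) by (meson add_leD1)
      then have "G \<in> extremal_containing (T \<^bold>\<or> edgeless_graph (n - s)) n \<F>"
        by (auto simp: extremal_containing_def extremal_def is_arg_max_def)
      then show "G \<in> \<G> n \<F>" unfolding GG using T(1) by blast
    qed
    show "\<G> n \<F> \<subseteq> extremal n \<F>"
    proof
      fix G assume "G \<in> \<G> n \<F>"
      then obtain T where T: "T \<in> extremal s (\<H> \<F>)"
        and G: "G \<in> extremal_containing (T \<^bold>\<or> edgeless_graph (n - s)) n \<F>" unfolding GG by blast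
      have TH: "T \<^bold>\<or> H \<in> free_graphs n \<F>" using extremalD[OF HT[OF T]] by (simp add: free_graphs_def)
      have "num_edges (T \<^bold>\<or> H) \<le> num_edges G"
        using G TH contains_join_edgeless[OF H(1,2), of T]
        by (auto simp: extremal_containing_def is_arg_max_def not_less)
      then show "G \<in> extremal n \<F>"
        using G extremalD(4)[OF HT[OF T]]
        by (auto simp: extremal_containing_def extremal_def is_arg_max_def not_less) (meson order_trans)
    qed
  qed
  then show ?thesis unfolding the by (intro exI[of _ "N0 + 2 * s"]) simp
qed

end
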